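(* Let $\mathcal C$ be a well-powered ideally exact category: it is Barr exact and protomodular, has finite coproducts, and the unique morphism $p:0\to1$ from its initial object $0$ to its terminal object $1$ is a regular epimorphism. Then $\mathcal C$ has a noetherian form inducing its regular-epimorphism--monomorphism factorization system. A canonical choice has, for each object $X\in\mathcal C$, the fibre $$\Lambda_X=\operatorname{Sub}_{\mathcal C/0}\bigl(0\times X\longrightarrow0\bigr),$$ where $0\times X\to0$ is the first projection and $\mathcal C/0$ is the slice category. For a morphism $f:X\to Y$ of $\mathcal C$, direct and inverse images are the subobject transports in $\mathcal C/0$ along $p^*f=1_0\times f:(0\times X\to0)\to(0\times Y\to0)$.
   Context: $\operatorname{Sub}_{\mathcal B}(B)$ is the lattice of subobjects (classes of monomorphisms) of $B$ in $\mathcal B$; the subobject transports along a morphism $g:A\to B$ of a regular category send a subobject of $A$ to its regular image in $B$ (direct image $g_!$) and a subobject of $B$ to its pullback along $g$ (inverse image $g^*$). Conventions: categories are locally small; "set" is relative to a fixed universe. A proper factorization system $(\mathcal E,\mathcal M)$ is an orthogonal factorization system with every morphism in $\mathcal E$ an epimorphism and every morphism in $\mathcal M$ a monomorphism. Forms. An (orean) form $\mathsf F$ on a category $\mathcal C$ assigns to each object $X$ a set-sized bounded lattice $\mathsf F(X)$ (the fibre over $X$; its elements are called clusters) and to each morphism $f:X\to Y$ monotone maps $f_!:\mathsf F(X)\to\mathsf F(Y)$ (direct image) and $f^*:\mathsf F(Y)\to\mathsf F(X)$ (inverse image) with $f_!S\le T\iff S\le f^*T$, such that $(gf)_!=g_!f_!$,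 $(gf)^*=f^*g^*$, and identities act as identities. Put $\operatorname{Im}f=f_!\top_X$ and $\operatorname{Ker}f=f^*\bot_Y$. A cluster in $\mathsf F(X)$ is conormal if it is the image of some morphism of $\mathcal C$ with codomain $X$, and normal if it is the kernel of some morphism of $\mathcal C$ with domain $X$. An embedding of a conormal $S\in\mathsf F(X)$ is a morphism $\iota$ into $X$ with $\operatorname{Im}\iota=S$ such that every morphism $f$ into $X$ with $\operatorname{Im}f\le S$ factors as $f=\iota h$ for a unique $h$. A quotient of a normal $K\in\mathsf F(X)$ is a morphism $\pi$ out of $X$ with $\operatorname{Ker}\pi=K$ such that every morphism $g$ out of $X$ with $K\le\operatorname{Ker}g$ factors as $g=h\pi$ for a unique $h$. The form is noetherian if: (N1) $f^*f_!S=S\vee\operatorname{Ker}f$ and $f_!f^*T=T\wedge\operatorname{Im}f$ for all $f,S,T$; (N2) every morphism $f$ factors as $f=me$ with $e$ a quotient of $\operatorname{Ker}f$ and $m$ an embedding of $\operatorname{Im}f$; (N3) the join of two normal clusters (in the same fibre) is normal, and the meet of two conormal clusters is conormal. For a noetherian form, the class of all quotients (of normal clusters) and the class of all embeddings (of conormal clusters) form a proper factorization system, the one induced by the form (quotients as left class, embeddings as right class). *)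

theory Defs
  imports "HOL-Algebra.Lattice" "HOL-Library.FuncSet"
begin

section \<open>Categories\<close>

record ('o, 'a) cat =
  Obj  :: "'o set"
  Arr  :: "'a set"
  Dom  :: "'a \<Rightarrow> 'o"
  Cod  :: "'a \<Rightarrow> 'o"
  Id   :: "'o \<Rightarrow> 'a"
  Comp :: "'a \<Rightarrow> 'a \<Rightarrow> 'a"  (infixl "\<cdot>\<index>" 70)

text \<open>Composition is written in applicative order: \<open>g \<cdot> f\<close> is ``first \<open>f\<close>, then \<open>g\<close>''.
  It is meaningful only for composable arrows.\<close>

definition hom_set :: "('o, 'a) cat \<Rightarrow> 'o \<Rightarrow> 'o \<Rightarrow> 'a set" where
  "hom_set C X Y = {f \<in> Arr C. Dom C f = X \<and> Cod C f = Y}"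

locale category =
  fixes C :: "('o, 'a) cat" (structure)
  assumes Dom_closed: "f \<in> Arr C \<Longrightarrow> Dom C f \<in> Obj C"
    and Cod_closed: "f \<in> Arr C \<Longrightarrow> Cod C f \<in> Obj C"
    and Id_closed: "X \<in> Obj C \<Longrightarrow> Id C X \<in> hom_set C X X"
    and Comp_closed: "\<lbrakk>f \<in> hom_set C X Y; g \<in> hom_set C Y Z\<rbrakk> \<Longrightarrow> g \<cdot> f \<in> hom_set C X Z"
    and Comp_Id: "f \<in> hom_set C X Y \<Longrightarrow> f \<cdot> Id C X = f"
    and Id_Comp: "f \<in> hom_set C X Y \<Longrightarrow> Id C Y \<cdot> f = f"
    and Comp_assoc: "\<lbrakk>f \<in> hom_set C W X; g \<in> hom_set C X Y; h \<in> hom_set C Y Z\<rbrakk>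
          \<Longrightarrow> (h \<cdot> g) \<cdot> f = h \<cdot> (g \<cdot> f)"

definition is_iso :: "('o, 'a) cat \<Rightarrow> 'a \<Rightarrow> bool" where
  "is_iso C f \<longleftrightarrow> f \<in> Arr C \<and>
     (\<exists>g \<in> hom_set C (Cod C f) (Dom C f).
        g \<cdot>\<^bsub>C\<^esub> f = Id C (Dom C f) \<and> f \<cdot>\<^bsub>C\<^esub> g = Id C (Cod C f))"

definition monic :: "('o, 'a) cat \<Rightarrow> 'a \<Rightarrow> bool" where
  "monic C m \<longleftrightarrow> m \<in> Arr C \<and>
     (\<forall>W \<in> Obj C. \<forall>f \<in> hom_set C W (Dom C m). \<forall>g \<in> hom_set C W (Dom C m).
        m \<cdot>\<^bsub>C\<^esub> f = m \<cdot>\<^bsub>C\<^esub> g \<longrightarrow> f = g)"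

definition epic :: "('o, 'a) cat \<Rightarrow> 'a \<Rightarrow> bool" where
  "epic C e \<longleftrightarrow> e \<in> Arr C \<and>
     (\<forall>W \<in> Obj C. \<forall>f \<in> hom_set C (Cod C e) W. \<forall>g \<in> hom_set C (Cod C e) W.
        f \<cdot>\<^bsub>C\<^esub> e = g \<cdot>\<^bsub>C\<^esub> e \<longrightarrow> f = g)"


section \<open>Limits and colimits\<close>

definition is_terminal :: "('o, 'a) cat \<Rightarrow> 'o \<Rightarrow> bool" where
  "is_terminal C T \<longleftrightarrow> T \<in> Obj C \<and> (\<forall>X \<in> Obj C. \<exists>!f. f \<in> hom_set C X T)"

definition is_initial :: "('o, 'a) cat \<Rightarrow> 'o \<Rightarrow> bool" where
  "is_initial C Z \<longleftrightarrow> Z \<in> Obj C \<and> (\<forall>X \<in> Obj C. \<exists>!f. f \<in> hom_set C Z X)"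

definition is_product :: "('o, 'a) cat \<Rightarrow> 'o \<Rightarrow> 'o \<Rightarrow> 'o \<Rightarrow> 'a \<Rightarrow> 'a \<Rightarrow> bool" where
  "is_product C X Y P p q \<longleftrightarrow> p \<in> hom_set C P X \<and> q \<in> hom_set C P Y \<and>
     (\<forall>W \<in> Obj C. \<forall>u \<in> hom_set C W X. \<forall>v \<in> hom_set C W Y.
        \<exists>!h. h \<in> hom_set C W P \<and> p \<cdot>\<^bsub>C\<^esub> h = u \<and> q \<cdot>\<^bsub>C\<^esub> h = v)"

definition is_coproduct :: "('o, 'a) cat \<Rightarrow> 'o \<Rightarrow> 'o \<Rightarrow> 'o \<Rightarrow> 'a \<Rightarrow> 'a \<Rightarrow> bool" where
  "is_coproduct C X Y S i j \<longleftrightarrow> i \<in> hom_set C X S \<and> j \<in> hom_set C Y S \<and>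
     (\<forall>W \<in> Obj C. \<forall>u \<in> hom_set C X W. \<forall>v \<in> hom_set C Y W.
        \<exists>!h. h \<in> hom_set C S W \<and> h \<cdot>\<^bsub>C\<^esub> i = u \<and> h \<cdot>\<^bsub>C\<^esub> j = v)"

text \<open>\<open>is_pullback C f g p q\<close>: the square \<open>f \<cdot> p = g \<cdot> q\<close> is a pullback of the cospan \<open>f, g\<close>,
  so that \<open>p\<close> is a pullback of \<open>g\<close> along \<open>f\<close> and \<open>q\<close> one of \<open>f\<close> along \<open>g\<close>.\<close>

definition is_pullback :: "('o, 'a) cat \<Rightarrow> 'a \<Rightarrow> 'a \<Rightarrow> 'a \<Rightarrow> 'a \<Rightarrow> bool" where
  "is_pullback C f g p q \<longleftrightarrow>
     f \<in> Arr C \<and> g \<in> Arr C \<and> Cod C f = Cod C g \<and>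
     p \<in> hom_set C (Dom C p) (Dom C f) \<and> q \<in> hom_set C (Dom C p) (Dom C g) \<and>
     f \<cdot>\<^bsub>C\<^esub> p = g \<cdot>\<^bsub>C\<^esub> q \<and>
     (\<forall>W \<in> Obj C. \<forall>u \<in> hom_set C W (Dom C f). \<forall>v \<in> hom_set C W (Dom C g).
        f \<cdot>\<^bsub>C\<^esub> u = g \<cdot>\<^bsub>C\<^esub> v \<longrightarrow>
        (\<exists>!h. h \<in> hom_set C W (Dom C p) \<and> p \<cdot>\<^bsub>C\<^esub> h = u \<and> q \<cdot>\<^bsub>C\<^esub> h = v))"

definition is_coequalizer :: "('o, 'a) cat \<Rightarrow> 'a \<Rightarrow> 'a \<Rightarrow> 'a \<Rightarrow> bool" where
  "is_coequalizer C f g q \<longleftrightarrow>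
     f \<in> Arr C \<and> g \<in> hom_set C (Dom C f) (Cod C f) \<and> q \<in> hom_set C (Cod C f) (Cod C q) \<and>
     q \<cdot>\<^bsub>C\<^esub> f = q \<cdot>\<^bsub>C\<^esub> g \<and>
     (\<forall>W \<in> Obj C. \<forall>u \<in> hom_set C (Cod C f) W. u \<cdot>\<^bsub>C\<^esub> f = u \<cdot>\<^bsub>C\<^esub> g \<longrightarrow>
        (\<exists>!h. h \<in> hom_set C (Cod C q) W \<and> h \<cdot>\<^bsub>C\<^esub> q = u))"

definition regular_epi :: "('o, 'a) cat \<Rightarrow> 'a \<Rightarrow> bool" where
  "regular_epi C e \<longleftrightarrow> (\<exists>f g. is_coequalizer C f g e)"

text \<open>A terminal object together with all pullbacks amounts to all finite limits; an initial
  object together with all binary coproducts amounts to all finite coproducts.\<close>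

definition finitely_complete :: "('o, 'a) cat \<Rightarrow> bool" where
  "finitely_complete C \<longleftrightarrow> (\<exists>T. is_terminal C T) \<and>
     (\<forall>f \<in> Arr C. \<forall>g \<in> Arr C. Cod C f = Cod C g \<longrightarrow> (\<exists>p q. is_pullback C f g p q))"

definition has_finite_coproducts :: "('o, 'a) cat \<Rightarrow> bool" where
  "has_finite_coproducts C \<longleftrightarrow> (\<exists>Z. is_initial C Z) \<and>
     (\<forall>X \<in> Obj C. \<forall>Y \<in> Obj C. \<exists>S i j. is_coproduct C X Y S i j)"


section \<open>Regular and Barr exact categories\<close>

text \<open>\<open>is_pullback C f f r s\<close> says that \<open>(r, s)\<close> is a kernel pair of \<open>f\<close>.\<close>

definition regular_category :: "('o, 'a) cat \<Rightarrow> bool" where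
  "regular_category C \<longleftrightarrow> category C \<and> finitely_complete C \<and>
     (\<forall>f r s. is_pullback C f f r s \<longrightarrow> (\<exists>q. is_coequalizer C r s q)) \<and>
     (\<forall>f g p q. is_pullback C f g p q \<and> regular_epi C g \<longrightarrow> regular_epi C p)"

text \<open>An internal equivalence relation on \<open>X\<close>: a jointly monic pair \<open>r, s : R \<rightarrow> X\<close> with
  reflexivity \<open>X \<rightarrow> R\<close>, symmetry \<open>R \<rightarrow> R\<close> and transitivity \<open>R \<times>\<^sub>X R \<rightarrow> R\<close>.\<close>

definition equivalence_relation :: "('o, 'a) cat \<Rightarrow> 'a \<Rightarrow> 'a \<Rightarrow> bool" where
  "equivalence_relation C r s \<longleftrightarrow>
     r \<in> Arr C \<and> s \<in> hom_set C (Dom C r) (Cod C r) \<and>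
     (\<forall>W \<in> Obj C. \<forall>u \<in> hom_set C W (Dom C r). \<forall>v \<in> hom_set C W (Dom C r).
        r \<cdot>\<^bsub>C\<^esub> u = r \<cdot>\<^bsub>C\<^esub> v \<and> s \<cdot>\<^bsub>C\<^esub> u = s \<cdot>\<^bsub>C\<^esub> v \<longrightarrow> u = v) \<and>
     (\<exists>d \<in> hom_set C (Cod C r) (Dom C r).
        r \<cdot>\<^bsub>C\<^esub> d = Id C (Cod C r) \<and> s \<cdot>\<^bsub>C\<^esub> d = Id C (Cod C r)) \<and>
     (\<exists>t \<in> hom_set C (Dom C r) (Dom C r). r \<cdot>\<^bsub>C\<^esub> t = s \<and> s \<cdot>\<^bsub>C\<^esub> t = r) \<and>
     (\<forall>p q. is_pullback C s r p q \<longrightarrow>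
        (\<exists>t \<in> hom_set C (Dom C p) (Dom C r).
           r \<cdot>\<^bsub>C\<^esub> t = r \<cdot>\<^bsub>C\<^esub> p \<and> s \<cdot>\<^bsub>C\<^esub> t = s \<cdot>\<^bsub>C\<^esub> q))"

definition barr_exact :: "('o, 'a) cat \<Rightarrow> bool" where
  "barr_exact C \<longleftrightarrow> regular_category C \<and>
     (\<forall>r s. equivalence_relation C r s \<longrightarrow> (\<exists>f. is_pullback C f f r s))"


section \<open>Protomodularity\<close>

text \<open>The category of points over \<open>Y\<close>: split epimorphisms \<open>p\<close> onto \<open>Y\<close> with a chosen section
  \<open>s\<close>, with arrows commuting with the epimorphisms and with the sections.\<close>

definition Points :: "('o, 'a) cat \<Rightarrow> 'o \<Rightarrow> ('a \<times> 'a, ('a \<times> 'a) \<times> 'a \<times> ('a \<times> 'a)) cat" where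
  "Points C Y = (let ob = {(p, s). p \<in> Arr C \<and> Cod C p = Y \<and> s \<in> hom_set C Y (Dom C p) \<and>
                                   p \<cdot>\<^bsub>C\<^esub> s = Id C Y}
    in \<lparr> Obj = ob,
         Arr = {((p, s), h, (p', s')). (p, s) \<in> ob \<and> (p', s') \<in> ob \<and>
                  h \<in> hom_set C (Dom C p) (Dom C p') \<and>
                  p' \<cdot>\<^bsub>C\<^esub> h = p \<and> h \<cdot>\<^bsub>C\<^esub> s = s'},
         Dom = (\<lambda>(a, h, b). a),
         Cod = (\<lambda>(a, h, b). b),
         Id = (\<lambda>(p, s). ((p, s), Id C (Dom C p), (p, s))),
         Comp = (\<lambda>(b, k, c) (a, h, b'). (a, k \<cdot>\<^bsub>C\<^esub> h, c)) \<rparr>)"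

text \<open>\<open>(q, t)\<close> is the value at \<open>(p, s)\<close> of the change-of-base functor along \<open>f\<close>, with
  comparison arrow \<open>g\<close>; then the value of that functor at an arrow.\<close>

definition point_pullback ::
    "('o, 'a) cat \<Rightarrow> 'a \<Rightarrow> 'a \<times> 'a \<Rightarrow> 'a \<times> 'a \<Rightarrow> 'a \<Rightarrow> bool" where
  "point_pullback C f ps qt g \<longleftrightarrow>
     ps \<in> Obj (Points C (Cod C f)) \<and> qt \<in> Obj (Points C (Dom C f)) \<and>
     is_pullback C f (fst ps) (fst qt) g \<and> g \<cdot>\<^bsub>C\<^esub> snd qt = snd ps \<cdot>\<^bsub>C\<^esub> f"

definition point_arrow_pullback ::
    "('o, 'a) cat \<Rightarrow> 'a \<Rightarrow> ('a \<times> 'a) \<times> 'a \<times> ('a \<times> 'a) \<Rightarrow> ('a \<times> 'a) \<times> 'a \<times> ('a \<times> 'a) \<Rightarrow> bool" where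
  "point_arrow_pullback C f \<alpha> \<beta> \<longleftrightarrow>
     \<alpha> \<in> Arr (Points C (Cod C f)) \<and> \<beta> \<in> Arr (Points C (Dom C f)) \<and>
     (\<exists>g g'. point_pullback C f (fst \<alpha>) (fst \<beta>) g \<and>
             point_pullback C f (snd (snd \<alpha>)) (snd (snd \<beta>)) g' \<and>
             g' \<cdot>\<^bsub>C\<^esub> fst (snd \<beta>) = fst (snd \<alpha>) \<cdot>\<^bsub>C\<^esub> g)"

text \<open>Change of base between categories of points reflects isomorphisms. Pullbacks are part of
  Barr exactness and are not asked for again.\<close>

definition protomodular :: "('o, 'a) cat \<Rightarrow> bool" where
  "protomodular C \<longleftrightarrow>
     (\<forall>f \<in> Arr C. \<forall>\<alpha> \<beta>. point_arrow_pullback C f \<alpha> \<beta> \<and> is_iso (Points C (Dom C f)) \<beta>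
        \<longrightarrow> is_iso (Points C (Cod C f)) \<alpha>)"


section \<open>Ideally exact categories\<close>

definition ideally_exact :: "('o, 'a) cat \<Rightarrow> bool" where
  "ideally_exact C \<longleftrightarrow> barr_exact C \<and> protomodular C \<and> has_finite_coproducts C \<and>
     (\<forall>Z T p. is_initial C Z \<and> is_terminal C T \<and> p \<in> hom_set C Z T \<longrightarrow> regular_epi C p)"


section \<open>Slices and subobjects\<close>

definition slice :: "('o, 'a) cat \<Rightarrow> 'o \<Rightarrow> ('a, 'a \<times> 'a \<times> 'a) cat" where
  "slice C B =
     \<lparr> Obj = {a \<in> Arr C. Cod C a = B},
       Arr = {(a, h, b). a \<in> Arr C \<and> Cod C a = B \<and> b \<in> Arr C \<and> Cod C b = B \<and>
                         h \<in> hom_set C (Dom C a) (Dom C b) \<and> b \<cdot>\<^bsub>C\<^esub> h = a},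
       Dom = (\<lambda>(a, h, b). a),
       Cod = (\<lambda>(a, h, b). b),
       Id = (\<lambda>a. (a, Id C (Dom C a), a)),
       Comp = (\<lambda>(b, k, c) (a, h, b'). (a, k \<cdot>\<^bsub>C\<^esub> h, c)) \<rparr>"

definition monos_into :: "('o, 'a) cat \<Rightarrow> 'o \<Rightarrow> 'a set" where
  "monos_into C B = {m. monic C m \<and> Cod C m = B}"

definition factors_through :: "('o, 'a) cat \<Rightarrow> 'a \<Rightarrow> 'a \<Rightarrow> bool" where
  "factors_through C m n \<longleftrightarrow> (\<exists>h \<in> hom_set C (Dom C m) (Dom C n). m = n \<cdot>\<^bsub>C\<^esub> h)"

definition subobject_equiv :: "('o, 'a) cat \<Rightarrow> 'o \<Rightarrow> ('a \<times> 'a) set" where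
  "subobject_equiv C B = {(m, n). m \<in> monos_into C B \<and> n \<in> monos_into C B \<and>
     factors_through C m n \<and> factors_through C n m}"

definition Sub :: "('o, 'a) cat \<Rightarrow> 'o \<Rightarrow> 'a set gorder" where
  "Sub C B = \<lparr> carrier = monos_into C B // subobject_equiv C B,
               eq = (=),
               le = (\<lambda>S T. \<exists>m \<in> S. \<exists>n \<in> T. factors_through C m n) \<rparr>"

text \<open>The transports along \<open>g\<close>, given as sets of representatives: for \<open>m\<close> representing \<open>S\<close>, the
  direct image consists of all monomorphic parts of regular-epi--mono factorizations of \<open>g \<cdot> m\<close>,
  and the inverse image of all monomorphisms that are pullbacks of \<open>m\<close> along \<open>g\<close>.\<close>

definition sub_direct_image :: "('o, 'a) cat \<Rightarrow> 'a \<Rightarrow> 'a set \<Rightarrow> 'a set" where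
  "sub_direct_image C g S = {n \<in> monos_into C (Cod C g).
     \<exists>m \<in> S. \<exists>e \<in> hom_set C (Dom C m) (Dom C n). regular_epi C e \<and> g \<cdot>\<^bsub>C\<^esub> m = n \<cdot>\<^bsub>C\<^esub> e}"

definition sub_inverse_image :: "('o, 'a) cat \<Rightarrow> 'a \<Rightarrow> 'a set \<Rightarrow> 'a set" where
  "sub_inverse_image C g T = {n \<in> monos_into C (Dom C g). \<exists>m \<in> T. \<exists>h. is_pullback C g m n h}"


section \<open>Size\<close>

text \<open>The universe enters through its cardinality \<open>\<kappa>\<close>: a collection is set-sized iff it has fewer
  than \<open>\<kappa>\<close> elements. For a Grothendieck universe \<open>\<kappa>\<close> is an inaccessible cardinal.\<close>

definition set_sized :: "'u rel \<Rightarrow> 'b set \<Rightarrow> bool" where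
  "set_sized \<kappa> A \<longleftrightarrow> (card_of A, \<kappa>) \<in> ordLess"

definition locally_small :: "'u rel \<Rightarrow> ('o, 'a) cat \<Rightarrow> bool" where
  "locally_small \<kappa> C \<longleftrightarrow> (\<forall>X \<in> Obj C. \<forall>Y \<in> Obj C. set_sized \<kappa> (hom_set C X Y))"

definition well_powered :: "'u rel \<Rightarrow> ('o, 'a) cat \<Rightarrow> bool" where
  "well_powered \<kappa> C \<longleftrightarrow> (\<forall>X \<in> Obj C. set_sized \<kappa> (carrier (Sub C X)))"


section \<open>Proper factorization systems\<close>

definition orthogonal :: "('o, 'a) cat \<Rightarrow> 'a \<Rightarrow> 'a \<Rightarrow> bool" where
  "orthogonal C e m \<longleftrightarrow>
     (\<forall>u \<in> hom_set C (Dom C e) (Dom C m). \<forall>v \<in> hom_set C (Cod C e) (Cod C m).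
        m \<cdot>\<^bsub>C\<^esub> u = v \<cdot>\<^bsub>C\<^esub> e \<longrightarrow>
        (\<exists>!d. d \<in> hom_set C (Cod C e) (Dom C m) \<and> d \<cdot>\<^bsub>C\<^esub> e = u \<and> m \<cdot>\<^bsub>C\<^esub> d = v))"

definition proper_factorization_system :: "('o, 'a) cat \<Rightarrow> 'a set \<Rightarrow> 'a set \<Rightarrow> bool" where
  "proper_factorization_system C E M \<longleftrightarrow>
     (\<forall>e \<in> E. epic C e) \<and> (\<forall>m \<in> M. monic C m) \<and>
     (\<forall>f. is_iso C f \<longrightarrow> f \<in> E \<and> f \<in> M) \<and>
     (\<forall>e \<in> E. \<forall>e' \<in> E. Cod C e = Dom C e' \<longrightarrow> e' \<cdot>\<^bsub>C\<^esub> e \<in> E) \<and>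
     (\<forall>m \<in> M. \<forall>m' \<in> M. Cod C m = Dom C m' \<longrightarrow> m' \<cdot>\<^bsub>C\<^esub> m \<in> M) \<and>
     (\<forall>f \<in> Arr C. \<exists>e \<in> E. \<exists>m \<in> M. Dom C e = Dom C f \<and> Cod C e = Dom C m \<and>
        Cod C m = Cod C f \<and> f = m \<cdot>\<^bsub>C\<^esub> e) \<and>
     (\<forall>e \<in> E. \<forall>m \<in> M. orthogonal C e m)"


section \<open>Noetherian forms\<close>

record ('o, 'a, 'c) form =
  fibre :: "'o \<Rightarrow> 'c gorder"
  dirim :: "'a \<Rightarrow> 'c \<Rightarrow> 'c"
  invim :: "'a \<Rightarrow> 'c \<Rightarrow> 'c"

definition orean_form :: "'u rel \<Rightarrow> ('o, 'a) cat \<Rightarrow> ('o, 'a, 'c) form \<Rightarrow> bool" where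
  "orean_form \<kappa> C F \<longleftrightarrow>
     (\<forall>X \<in> Obj C. bounded_lattice (fibre F X) \<and> set_sized \<kappa> (carrier (fibre F X))) \<and>
     (\<forall>X Y. \<forall>f \<in> hom_set C X Y.
        dirim F f \<in> carrier (fibre F X) \<rightarrow> carrier (fibre F Y) \<and>
        invim F f \<in> carrier (fibre F Y) \<rightarrow> carrier (fibre F X) \<and>
        isotone (fibre F X) (fibre F Y) (dirim F f) \<and>
        isotone (fibre F Y) (fibre F X) (invim F f) \<and>
        (\<forall>S \<in> carrier (fibre F X). \<forall>T \<in> carrier (fibre F Y).
           dirim F f S \<sqsubseteq>\<^bsub>fibre F Y\<^esub> T \<longleftrightarrow> S \<sqsubseteq>\<^bsub>fibre F X\<^esub> invim F f T)) \<and>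
     (\<forall>X Y Z. \<forall>f \<in> hom_set C X Y. \<forall>g \<in> hom_set C Y Z.
        (\<forall>S \<in> carrier (fibre F X). dirim F (g \<cdot>\<^bsub>C\<^esub> f) S = dirim F g (dirim F f S)) \<and>
        (\<forall>T \<in> carrier (fibre F Z). invim F (g \<cdot>\<^bsub>C\<^esub> f) T = invim F f (invim F g T))) \<and>
     (\<forall>X \<in> Obj C. \<forall>S \<in> carrier (fibre F X).
        dirim F (Id C X) S = S \<and> invim F (Id C X) S = S)"

definition Im_cl :: "('o, 'a) cat \<Rightarrow> ('o, 'a, 'c) form \<Rightarrow> 'a \<Rightarrow> 'c" where
  "Im_cl C F f = dirim F f \<top>\<^bsub>fibre F (Dom C f)\<^esub>"

definition Ker_cl :: "('o, 'a) cat \<Rightarrow> ('o, 'a, 'c) form \<Rightarrow> 'a \<Rightarrow> 'c" where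
  "Ker_cl C F f = invim F f \<bottom>\<^bsub>fibre F (Cod C f)\<^esub>"

definition conormal :: "('o, 'a) cat \<Rightarrow> ('o, 'a, 'c) form \<Rightarrow> 'o \<Rightarrow> 'c \<Rightarrow> bool" where
  "conormal C F X S \<longleftrightarrow> S \<in> carrier (fibre F X) \<and> (\<exists>f \<in> Arr C. Cod C f = X \<and> Im_cl C F f = S)"

definition normal :: "('o, 'a) cat \<Rightarrow> ('o, 'a, 'c) form \<Rightarrow> 'o \<Rightarrow> 'c \<Rightarrow> bool" where
  "normal C F X K \<longleftrightarrow> K \<in> carrier (fibre F X) \<and> (\<exists>f \<in> Arr C. Dom C f = X \<and> Ker_cl C F f = K)"

definition embedding_of ::
    "('o, 'a) cat \<Rightarrow> ('o, 'a, 'c) form \<Rightarrow> 'o \<Rightarrow> 'c \<Rightarrow> 'a \<Rightarrow> bool" where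
  "embedding_of C F X S \<iota> \<longleftrightarrow> conormal C F X S \<and>
     \<iota> \<in> Arr C \<and> Cod C \<iota> = X \<and> Im_cl C F \<iota> = S \<and>
     (\<forall>f \<in> Arr C. Cod C f = X \<and> Im_cl C F f \<sqsubseteq>\<^bsub>fibre F X\<^esub> S \<longrightarrow>
        (\<exists>!h. h \<in> hom_set C (Dom C f) (Dom C \<iota>) \<and> f = \<iota> \<cdot>\<^bsub>C\<^esub> h))"

definition quotient_of ::
    "('o, 'a) cat \<Rightarrow> ('o, 'a, 'c) form \<Rightarrow> 'o \<Rightarrow> 'c \<Rightarrow> 'a \<Rightarrow> bool" where
  "quotient_of C F X K \<pi> \<longleftrightarrow> normal C F X K \<and>
     \<pi> \<in> Arr C \<and> Dom C \<pi> = X \<and> Ker_cl C F \<pi> = K \<and>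
     (\<forall>g \<in> Arr C. Dom C g = X \<and> K \<sqsubseteq>\<^bsub>fibre F X\<^esub> Ker_cl C F g \<longrightarrow>
        (\<exists>!h. h \<in> hom_set C (Cod C \<pi>) (Cod C g) \<and> g = h \<cdot>\<^bsub>C\<^esub> \<pi>))"

definition noetherian_form :: "'u rel \<Rightarrow> ('o, 'a) cat \<Rightarrow> ('o, 'a, 'c) form \<Rightarrow> bool" where
  "noetherian_form \<kappa> C F \<longleftrightarrow> orean_form \<kappa> C F \<and>
     (\<forall>X Y. \<forall>f \<in> hom_set C X Y.
        (\<forall>S \<in> carrier (fibre F X).
           invim F f (dirim F f S) = S \<squnion>\<^bsub>fibre F X\<^esub> Ker_cl C F f) \<and>
        (\<forall>T \<in> carrier (fibre F Y).
           dirim F f (invim F f T) = T \<sqinter>\<^bsub>fibre F Y\<^esub> Im_cl C F f)) \<and>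
     (\<forall>X Y. \<forall>f \<in> hom_set C X Y. \<exists>e m.
        quotient_of C F X (Ker_cl C F f) e \<and> embedding_of C F Y (Im_cl C F f) m \<and>
        Cod C e = Dom C m \<and> f = m \<cdot>\<^bsub>C\<^esub> e) \<and>
     (\<forall>X \<in> Obj C.
        (\<forall>K L. normal C F X K \<and> normal C F X L \<longrightarrow> normal C F X (K \<squnion>\<^bsub>fibre F X\<^esub> L)) \<and>
        (\<forall>S T. conormal C F X S \<and> conormal C F X T \<longrightarrow> conormal C F X (S \<sqinter>\<^bsub>fibre F X\<^esub> T)))"

definition quotients :: "('o, 'a) cat \<Rightarrow> ('o, 'a, 'c) form \<Rightarrow> 'a set" where
  "quotients C F = {\<pi>. \<exists>X \<in> Obj C. \<exists>K. quotient_of C F X K \<pi>}"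

definition embeddings :: "('o, 'a) cat \<Rightarrow> ('o, 'a, 'c) form \<Rightarrow> 'a set" where
  "embeddings C F = {\<iota>. \<exists>X \<in> Obj C. \<exists>S. embedding_of C F X S \<iota>}"

definition form_induces ::
    "('o, 'a) cat \<Rightarrow> ('o, 'a, 'c) form \<Rightarrow> 'a set \<Rightarrow> 'a set \<Rightarrow> bool" where
  "form_induces C F E M \<longleftrightarrow>
     proper_factorization_system C E M \<and> quotients C F = E \<and> embeddings C F = M"


section \<open>The canonical form\<close>

text \<open>\<open>P X\<close>, with projections \<open>\<pi>\<^sub>1 X\<close> and \<open>\<pi>\<^sub>2 X\<close>, stands for a chosen product \<open>Z \<times> X\<close>;
  \<open>\<pi>\<^sub>1 X\<close> is then the object \<open>Z \<times> X \<rightarrow> Z\<close> of the slice over \<open>Z\<close>.\<close>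

definition product_choice ::
    "('o, 'a) cat \<Rightarrow> 'o \<Rightarrow> ('o \<Rightarrow> 'o) \<Rightarrow> ('o \<Rightarrow> 'a) \<Rightarrow> ('o \<Rightarrow> 'a) \<Rightarrow> bool" where
  "product_choice C Z P \<pi>\<^sub>1 \<pi>\<^sub>2 \<longleftrightarrow> (\<forall>X \<in> Obj C. is_product C Z X (P X) (\<pi>\<^sub>1 X) (\<pi>\<^sub>2 X))"

text \<open>The arrow \<open>1\<^sub>Z \<times> f\<close> of \<open>C\<close>, and the same regarded as an arrow of the slice.\<close>

definition id_times ::
    "('o, 'a) cat \<Rightarrow> 'o \<Rightarrow> ('o \<Rightarrow> 'o) \<Rightarrow> ('o \<Rightarrow> 'a) \<Rightarrow> ('o \<Rightarrow> 'a) \<Rightarrow> 'a \<Rightarrow> 'a" where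
  "id_times C Z P \<pi>\<^sub>1 \<pi>\<^sub>2 f = (THE h. h \<in> hom_set C (P (Dom C f)) (P (Cod C f)) \<and>
     \<pi>\<^sub>1 (Cod C f) \<cdot>\<^bsub>C\<^esub> h = Id C Z \<cdot>\<^bsub>C\<^esub> \<pi>\<^sub>1 (Dom C f) \<and>
     \<pi>\<^sub>2 (Cod C f) \<cdot>\<^bsub>C\<^esub> h = f \<cdot>\<^bsub>C\<^esub> \<pi>\<^sub>2 (Dom C f))"

definition base_change ::
    "('o, 'a) cat \<Rightarrow> 'o \<Rightarrow> ('o \<Rightarrow> 'o) \<Rightarrow> ('o \<Rightarrow> 'a) \<Rightarrow> ('o \<Rightarrow> 'a) \<Rightarrow> 'a \<Rightarrow> 'a \<times> 'a \<times> 'a" where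
  "base_change C Z P \<pi>\<^sub>1 \<pi>\<^sub>2 f = (\<pi>\<^sub>1 (Dom C f), id_times C Z P \<pi>\<^sub>1 \<pi>\<^sub>2 f, \<pi>\<^sub>1 (Cod C f))"

definition canonical_form ::
    "('o, 'a) cat \<Rightarrow> 'o \<Rightarrow> ('o \<Rightarrow> 'o) \<Rightarrow> ('o \<Rightarrow> 'a) \<Rightarrow> ('o \<Rightarrow> 'a) \<Rightarrow>
     ('o, 'a, ('a \<times> 'a \<times> 'a) set) form" where
  "canonical_form C Z P \<pi>\<^sub>1 \<pi>\<^sub>2 =
     \<lparr> fibre = (\<lambda>X. Sub (slice C Z) (\<pi>\<^sub>1 X)),
       dirim = (\<lambda>f. sub_direct_image (slice C Z) (base_change C Z P \<pi>\<^sub>1 \<pi>\<^sub>2 f)),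
       invim = (\<lambda>f. sub_inverse_image (slice C Z) (base_change C Z P \<pi>\<^sub>1 \<pi>\<^sub>2 f)) \<rparr>"

end

theory Submission
  imports Defs
begin

text \<open>
  Subobjects are compared through their generalized elements: \<open>x\<close> belongs to a monomorphism \<open>m\<close> if it
  factors through \<open>m\<close>. In a regular category membership is stable under pulling back, descends along
  regular epimorphisms, and membership in an image is existence of a preimage locally, so the
  transports can be computed as for sets.

  Since \<open>0\<close> is initial, the bottom subobject of \<open>0 \<times> Y\<close> is the unique arrow from \<open>0\<close>, and the
  kernel of \<open>f\<close> consists of the pairs \<open>(z, x)\<close> with \<open>f x = !\<^sub>Y z\<close>. Protomodularity is used in one form
  only: a point is generated by its section and any one fibre. Applied to kernel pairs and fibres
  over \<open>0\<close>, it shows that a subobject containing \<open>Ker f\<close> is saturated for \<open>f\<close> (giving (N1)), and that a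
  regular epimorphism is determined by its kernel (giving (N2)). It also makes reflexive symmetric
  relations transitive, so by Barr exactness the image of a kernel pair is again a kernel pair,
  which gives joins of normal clusters.
\<close>


text \<open>The fibres are taken over 0 because C has in general no zero object, hence no kernels of
  its own. In C/0 the identity of 0 is both initial and terminal, and \<open>Ker f\<close> is there
  an honest kernel, that of 1 \<times> f. The slice is nevertheless never shown to be exact or
  protomodular: its monomorphisms, its regular epimorphisms and the pullbacks that occur are those
  of C, so a cluster is handled as a monomorphism of C into 0 \<times> X, and exactness and
  protomodularity are applied to C alone. Protomodularity concerns change of base along every arrow;
  this is what lets the single fibre over 0 \<rightarrow> Y, an arrow far from epic in general,
  decide a question about a whole point. Binary coproducts supply the joins of subobjects.
  Regularity of 0 \<rightarrow> 1 lets the form detect factorization through a monomorphism of C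
  itself, and not only after applying 0 \<times> -.\<close>

declare hom_set_def [simp]

section \<open>Normalisation of composites\<close>

context category
begin

declare Dom_closed [simp] Cod_closed [simp]

lemma Comp_simps [simp]:
  assumes "f \<in> Arr C" "g \<in> Arr C" "Cod C f = Dom C g"
  shows "g \<cdot> f \<in> Arr C" "Dom C (g \<cdot> f) = Dom C f" "Cod C (g \<cdot> f) = Cod C g"
  using Comp_closed[of f "Dom C f" "Dom C g" g "Cod C g"] assms by auto

lemma Id_simps [simp]:
  assumes "X \<in> Obj C"
  shows "Id C X \<in> Arr C" "Dom C (Id C X) = X" "Cod C (Id C X) = X"
  using Id_closed[OF assms] by auto

lemma Comp_assoc_simp [simp]:
  assumes "f \<in> Arr C" "g \<in> Arr C" "h \<in> Arr C" "Cod C f = Dom C g" "Cod C g = Dom C h"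
  shows "(h \<cdot> g) \<cdot> f = h \<cdot> (g \<cdot> f)"
  using Comp_assoc[of f "Dom C f" "Cod C f" g "Cod C g" h "Cod C h"] assms by auto

lemma Id_Comp_simp [simp]: "f \<in> Arr C \<Longrightarrow> Cod C f = Y \<Longrightarrow> Id C Y \<cdot> f = f"
  using Id_Comp[of f "Dom C f" Y] by auto

lemma Comp_Id_simp [simp]: "f \<in> Arr C \<Longrightarrow> Dom C f = X \<Longrightarrow> f \<cdot> Id C X = f"
  using Comp_Id[of f X "Cod C f"] by auto

text \<open>Composites are normalised by nesting to the right, which hides
  \<open>f \<cdot> g\<close> inside \<open>f \<cdot> (g \<cdot> x)\<close>. An equation between
  composites does not rewrite there; this prolonged form and \<open>Comp_eq_assoc\<close> take its
  place.\<close>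

lemma Comp_reassoc:
  assumes "f \<cdot> g = h \<cdot> k" "f \<in> Arr C" "g \<in> Arr C" "h \<in> Arr C" "k \<in> Arr C"
    "Cod C g = Dom C f" "Cod C k = Dom C h" "x \<in> Arr C" "Cod C x = Dom C g" "Dom C k = Dom C g"
  shows "f \<cdot> (g \<cdot> x) = h \<cdot> (k \<cdot> x)"
  using assms by (metis Comp_assoc_simp)

lemma Comp_eq_assoc:
  assumes "g \<cdot> f = x" "f \<in> Arr C" "g \<in> Arr C" "Cod C f = Dom C g" "k \<in> Arr C" "Cod C k = Dom C f"
  shows "g \<cdot> (f \<cdot> k) = x \<cdot> k"
  using assms Comp_assoc_simp[of k f g] by simp


section \<open>Monomorphisms, epimorphisms and generalized elements\<close>

lemma monicD:
  assumes "monic C m" "m \<cdot> f = m \<cdot> g" "f \<in> Arr C" "g \<in> Arr C" "Dom C f = Dom C g"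
    "Cod C f = Dom C m" "Cod C g = Dom C m"
  shows "f = g"
proof -
  have "f \<in> hom_set C (Dom C f) (Dom C m)" "g \<in> hom_set C (Dom C f) (Dom C m)" "Dom C f \<in> Obj C"
    using assms by simp_all
  then show ?thesis using assms(1,2) unfolding monic_def by blast
qed

lemma monic_Arr [simp]: "monic C m \<Longrightarrow> m \<in> Arr C"
  by (simp add: monic_def)

lemma monicI:
  assumes "m \<in> Arr C"
    "\<And>f g. \<lbrakk>f \<in> Arr C; g \<in> Arr C; Dom C f = Dom C g; Cod C f = Dom C m; Cod C g = Dom C m;
       m \<cdot> f = m \<cdot> g\<rbrakk> \<Longrightarrow> f = g"
  shows "monic C m"
  using assms unfolding monic_def by auto

lemma epicD:
  assumes "epic C e" "f \<cdot> e = g \<cdot> e" "f \<in> Arr C" "g \<in> Arr C" "Cod C f = Cod C g"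
    "Dom C f = Cod C e" "Dom C g = Cod C e"
  shows "f = g"
proof -
  have "f \<in> hom_set C (Cod C e) (Cod C f)" "g \<in> hom_set C (Cod C e) (Cod C f)" "Cod C f \<in> Obj C"
    using assms by simp_all
  then show ?thesis using assms(1,2) unfolding epic_def by blast
qed

lemma epic_Arr [simp]: "epic C e \<Longrightarrow> e \<in> Arr C"
  by (simp add: epic_def)

lemma monic_Comp:
  assumes "monic C m" "monic C n" "Cod C m = Dom C n"
  shows "monic C (n \<cdot> m)"
proof (rule monicI)
  fix f g assume *: "f \<in> Arr C" "g \<in> Arr C" "Dom C f = Dom C g" "Cod C f = Dom C (n \<cdot> m)"
    "Cod C g = Dom C (n \<cdot> m)" "(n \<cdot> m) \<cdot> f = (n \<cdot> m) \<cdot> g"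
  have "m \<cdot> f = m \<cdot> g" by (rule monicD[OF assms(2)]) (use assms * in simp_all)
  then show "f = g" by (rule monicD[OF assms(1)]) (use assms * in simp_all)
qed (use assms in simp)

lemma monic_factor:
  assumes "monic C (n \<cdot> m)" "n \<in> Arr C" "m \<in> Arr C" "Cod C m = Dom C n"
  shows "monic C m"
proof (rule monicI)
  fix f g assume *: "f \<in> Arr C" "g \<in> Arr C" "Dom C f = Dom C g" "Cod C f = Dom C m"
    "Cod C g = Dom C m" "m \<cdot> f = m \<cdot> g"
  show "f = g"
    by (rule monicD[OF assms(1)]) (use assms * in simp_all)
qed (use assms in simp)

lemma monic_Id: "X \<in> Obj C \<Longrightarrow> monic C (Id C X)"
  by (rule monicI) auto

lemma split_monic: 
  assumes "r \<cdot> m = Id C (Dom C m)" "m \<in> Arr C" "r \<in> Arr C" "Cod C m = Dom C r"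
  shows "monic C m"
  by (rule monic_factor[of r m]) (use assms monic_Id in simp_all)

lemma is_isoE:
  assumes "is_iso C f"
  obtains g where "f \<in> Arr C" "g \<in> Arr C" "Dom C g = Cod C f" "Cod C g = Dom C f"
    "g \<cdot> f = Id C (Dom C f)" "f \<cdot> g = Id C (Cod C f)"
  using assms unfolding is_iso_def by auto

lemma is_isoI:
  assumes "f \<in> Arr C" "g \<in> Arr C" "Dom C g = Cod C f" "Cod C g = Dom C f"
    "g \<cdot> f = Id C (Dom C f)" "f \<cdot> g = Id C (Cod C f)"
  shows "is_iso C f"
  using assms unfolding is_iso_def by auto

text \<open>In m h m = m the monomorphism \<open>m\<close> cancels, so \<open>h\<close> is a
  two-sided inverse. Monomorphic parts of factorizations are recognised as isomorphisms in this
  way.\<close>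

lemma monic_split_epi_is_iso:
  assumes "monic C m" "h \<in> Arr C" "Dom C h = Cod C m" "Cod C h = Dom C m" "m \<cdot> h = Id C (Cod C m)"
  shows "is_iso C m"
proof (rule is_isoI[of m h])
  have "m \<cdot> (h \<cdot> m) = (m \<cdot> h) \<cdot> m" using assms by (subst Comp_assoc_simp) auto
  then have "m \<cdot> (h \<cdot> m) = m \<cdot> Id C (Dom C m)" using assms by simp
  then show "h \<cdot> m = Id C (Dom C m)"
    by (rule monicD[OF assms(1)]) (use assms in simp_all)
qed (use assms in simp_all)

lemma iso_monic: "is_iso C f \<Longrightarrow> monic C f"
  by (metis is_isoE split_monic)

lemma factors_throughE:
  assumes "factors_through C x m"
  obtains h where "h \<in> Arr C" "Dom C h = Dom C x" "Cod C h = Dom C m" "m \<cdot> h = x"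
  using assms unfolding factors_through_def by auto

lemma factors_throughI:
  assumes "x = m \<cdot> h" "h \<in> Arr C" "m \<in> Arr C" "Cod C h = Dom C m"
  shows "factors_through C x m"
  using assms unfolding factors_through_def by auto

lemma factors_through_refl [simp]: "m \<in> Arr C \<Longrightarrow> factors_through C m m"
  by (rule factors_throughI[of _ _ "Id C (Dom C m)"]) auto

lemma factors_through_Id: "m \<in> Arr C \<Longrightarrow> Cod C m = X \<Longrightarrow> factors_through C m (Id C X)"
  by (rule factors_throughI[of _ _ m]) auto

lemma factors_through_comp:
  assumes "factors_through C x m" "m \<in> Arr C" "k \<in> Arr C" "Cod C k = Dom C x"
  shows "factors_through C (x \<cdot> k) m"
proof -
  obtain h where "h \<in> Arr C" "Dom C h = Dom C x" "Cod C h = Dom C m" "m \<cdot> h = x"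
    using assms by (auto elim: factors_throughE)
  then show ?thesis by (intro factors_throughI[of _ _ "h \<cdot> k"]) (use assms in \<open>auto simp: Comp_eq_assoc\<close>)
qed

lemma factors_through_trans:
  assumes "factors_through C x m" "factors_through C m n" "n \<in> Arr C"
  shows "factors_through C x n"
proof -
  obtain h where h: "h \<in> Arr C" "Dom C h = Dom C x" "Cod C h = Dom C m" "m \<cdot> h = x"
    using assms by (auto elim: factors_throughE)
  obtain k where k: "k \<in> Arr C" "Dom C k = Dom C m" "Cod C k = Dom C n" "n \<cdot> k = m"
    using assms(2) by (auto elim: factors_throughE)
  then have "n \<cdot> (k \<cdot> h) = x" using h assms by (metis Comp_assoc_simp)
  then show ?thesis by (intro factors_throughI[of _ _ "k \<cdot> h"]) (use assms h k in simp_all)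
qed

lemma factors_through_postcomp:
  assumes "factors_through C x m" "m \<in> Arr C" "g \<in> Arr C" "Cod C m = Dom C g"
  shows "factors_through C (g \<cdot> x) (g \<cdot> m)"
proof -
  obtain h where h: "h \<in> Arr C" "Dom C h = Dom C x" "Cod C h = Dom C m" "m \<cdot> h = x"
    using assms by (auto elim: factors_throughE)
  then show ?thesis by (intro factors_throughI[of _ _ "h"]) (use assms h in simp_all)
qed

lemma factors_through_Cod:
  assumes "factors_through C x m" "m \<in> Arr C"
  shows "x \<in> Arr C" "Cod C x = Cod C m"
  using assms by (auto elim!: factors_throughE)


section \<open>Pullbacks, products and regular epimorphisms\<close>

lemma pullbackD:
  assumes "is_pullback C f g p q"
  shows "f \<in> Arr C" "g \<in> Arr C" "p \<in> Arr C" "q \<in> Arr C" "Cod C f = Cod C g"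
    "Dom C q = Dom C p" "Cod C p = Dom C f" "Cod C q = Dom C g" "f \<cdot> p = g \<cdot> q"
  using assms unfolding is_pullback_def by auto

lemma pullback_ex1:
  assumes "is_pullback C f g p q" "u \<in> Arr C" "v \<in> Arr C" "Dom C u = Dom C v"
    "Cod C u = Dom C f" "Cod C v = Dom C g" "f \<cdot> u = g \<cdot> v"
  shows "\<exists>!h. h \<in> hom_set C (Dom C v) (Dom C p) \<and> p \<cdot> h = u \<and> q \<cdot> h = v"
proof -
  have uv: "u \<in> hom_set C (Dom C v) (Dom C f)" "v \<in> hom_set C (Dom C v) (Dom C g)" "Dom C v \<in> Obj C"
    using assms by simp_all
  have "\<forall>W \<in> Obj C. \<forall>u \<in> hom_set C W (Dom C f). \<forall>v \<in> hom_set C W (Dom C g). f \<cdot> u = g \<cdot> v \<longrightarrow>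
        (\<exists>!h. h \<in> hom_set C W (Dom C p) \<and> p \<cdot> h = u \<and> q \<cdot> h = v)"
    using assms(1) unfolding is_pullback_def by (elim conjE)
  from this[rule_format, OF uv(3,1,2) assms(7)] show ?thesis .
qed

lemma pullback_lift:
  assumes "is_pullback C f g p q" "u \<in> Arr C" "v \<in> Arr C" "Dom C u = Dom C v"
    "Cod C u = Dom C f" "Cod C v = Dom C g" "f \<cdot> u = g \<cdot> v"
  obtains h where "h \<in> Arr C" "Dom C h = Dom C v" "Cod C h = Dom C p" "p \<cdot> h = u" "q \<cdot> h = v"
  using pullback_ex1[OF assms] by auto

lemma pullback_unique:
  assumes "is_pullback C f g p q" "h \<in> Arr C" "k \<in> Arr C" "Dom C h = Dom C k"
    "Cod C h = Dom C p" "Cod C k = Dom C p" "p \<cdot> h = p \<cdot> k" "q \<cdot> h = q \<cdot> k"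
  shows "h = k"
proof -
  note D = pullbackD[OF assms(1)]
  have "f \<cdot> (p \<cdot> h) = g \<cdot> (q \<cdot> h)" using Comp_reassoc[OF D(9), of h] D assms by simp
  then have "\<exists>!r. r \<in> hom_set C (Dom C (q \<cdot> h)) (Dom C p) \<and> p \<cdot> r = p \<cdot> h \<and> q \<cdot> r = q \<cdot> h"
    by (intro pullback_ex1[OF assms(1)]) (use D assms in simp_all)
  moreover have "h \<in> hom_set C (Dom C (q \<cdot> h)) (Dom C p)" "k \<in> hom_set C (Dom C (q \<cdot> h)) (Dom C p)"
    using D assms by simp_all
  ultimately show ?thesis using assms(7,8) by metis
qed

lemma pullbackI:
  assumes "f \<in> Arr C" "g \<in> Arr C" "p \<in> Arr C" "q \<in> Arr C" "Cod C f = Cod C g"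
    "Dom C q = Dom C p" "Cod C p = Dom C f" "Cod C q = Dom C g" "f \<cdot> p = g \<cdot> q"
    "\<And>u v. \<lbrakk>u \<in> Arr C; v \<in> Arr C; Dom C u = Dom C v; Cod C u = Dom C f; Cod C v = Dom C g;
       f \<cdot> u = g \<cdot> v\<rbrakk> \<Longrightarrow> \<exists>h. h \<in> Arr C \<and> Dom C h = Dom C v \<and> Cod C h = Dom C p \<and> p \<cdot> h = u \<and> q \<cdot> h = v"
    "\<And>h k. \<lbrakk>h \<in> Arr C; k \<in> Arr C; Dom C h = Dom C k; Cod C h = Dom C p; Cod C k = Dom C p;
       p \<cdot> h = p \<cdot> k; q \<cdot> h = q \<cdot> k\<rbrakk> \<Longrightarrow> h = k"
  shows "is_pullback C f g p q"
  unfolding is_pullback_def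
proof (intro conjI ballI impI)
  fix W u v assume *: "W \<in> Obj C" "u \<in> hom_set C W (Dom C f)" "v \<in> hom_set C W (Dom C g)" "f \<cdot> u = g \<cdot> v"
  obtain h where h: "h \<in> Arr C \<and> Dom C h = W \<and> Cod C h = Dom C p \<and> p \<cdot> h = u \<and> q \<cdot> h = v"
    using assms(10)[of u v] * by auto
  show "\<exists>!h. h \<in> hom_set C W (Dom C p) \<and> p \<cdot> h = u \<and> q \<cdot> h = v"
    by (rule ex1I[of _ h]) (use h assms(11) in auto)
qed (use assms in simp_all)

lemma pullback_monic:
  assumes "is_pullback C f g p q" "monic C g" shows "monic C p"
proof (rule monicI)
  note D = pullbackD[OF assms(1)]
  show "p \<in> Arr C" using D by simp
  fix h k assume *: "h \<in> Arr C" "k \<in> Arr C" "Dom C h = Dom C k" "Cod C h = Dom C p" "Cod C k = Dom C p"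
       "p \<cdot> h = p \<cdot> k"
  have "g \<cdot> (q \<cdot> h) = g \<cdot> (q \<cdot> k)"
    using Comp_reassoc[OF D(9), of h] Comp_reassoc[OF D(9), of k] * D by auto
  then have q: "q \<cdot> h = q \<cdot> k" by (rule monicD[OF assms(2)]) (use D * in simp_all)
  show "h = k" by (rule pullback_unique[OF assms(1)]) (use * q in simp_all)
qed

lemma pullback_factors_iff:
  assumes "is_pullback C g m n h" "x \<in> Arr C" "Cod C x = Dom C g"
  shows "factors_through C x n \<longleftrightarrow> factors_through C (g \<cdot> x) m"
proof
  note D = pullbackD[OF assms(1)]
  assume "factors_through C x n"
  then obtain k where k: "k \<in> Arr C" "Dom C k = Dom C x" "Cod C k = Dom C n" "n \<cdot> k = x"
    by (auto elim: factors_throughE)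
  show "factors_through C (g \<cdot> x) m"
    by (rule factors_throughI[of _ _ "h \<cdot> k"]) (use k D Comp_reassoc[OF D(9), of k] in auto)
next
  note D = pullbackD[OF assms(1)]
  assume "factors_through C (g \<cdot> x) m"
  then obtain k where k: "k \<in> Arr C" "Dom C k = Dom C x" "Cod C k = Dom C m" "m \<cdot> k = g \<cdot> x"
    using assms D by (auto elim: factors_throughE)
  then obtain l where "l \<in> Arr C" "Dom C l = Dom C x" "Cod C l = Dom C n" "n \<cdot> l = x"
    using pullback_lift[OF assms(1), of x k] assms by auto
  then show "factors_through C x n" by (intro factors_throughI[of _ _ l]) (use D in auto)
qed

lemma productD:
  assumes "is_product C X Y P p q"
  shows "p \<in> Arr C" "q \<in> Arr C" "Dom C p = P" "Dom C q = P" "Cod C p = X" "Cod C q = Y"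
  using assms unfolding is_product_def by auto

lemma product_ex1:
  assumes "is_product C X Y P p q" "u \<in> Arr C" "v \<in> Arr C" "Dom C u = Dom C v"
    "Cod C u = X" "Cod C v = Y"
  shows "\<exists>!h. h \<in> hom_set C (Dom C v) P \<and> p \<cdot> h = u \<and> q \<cdot> h = v"
proof -
  have "u \<in> hom_set C (Dom C v) X" "v \<in> hom_set C (Dom C v) Y" "Dom C v \<in> Obj C"
    using assms by simp_all
  then show ?thesis using assms(1) unfolding is_product_def by blast
qed

lemma product_lift:
  assumes "is_product C X Y P p q" "u \<in> Arr C" "v \<in> Arr C" "Dom C u = Dom C v"
    "Cod C u = X" "Cod C v = Y"
  obtains h where "h \<in> Arr C" "Dom C h = Dom C v" "Cod C h = P" "p \<cdot> h = u" "q \<cdot> h = v"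
  using product_ex1[OF assms] by auto

lemma product_unique:
  assumes "is_product C X Y P p q" "h \<in> Arr C" "k \<in> Arr C" "Dom C h = Dom C k"
    "Cod C h = P" "Cod C k = P" "p \<cdot> h = p \<cdot> k" "q \<cdot> h = q \<cdot> k"
  shows "h = k"
proof -
  note D = productD[OF assms(1)]
  have "\<exists>!r. r \<in> hom_set C (Dom C (q \<cdot> h)) P \<and> p \<cdot> r = p \<cdot> h \<and> q \<cdot> r = q \<cdot> h"
    by (intro product_ex1[OF assms(1)]) (use D assms in simp_all)
  moreover have "h \<in> hom_set C (Dom C (q \<cdot> h)) P" "k \<in> hom_set C (Dom C (q \<cdot> h)) P"
    using D assms by simp_all
  ultimately show ?thesis using assms(7,8) by metis
qed

lemma coequalizerD:
  assumes "is_coequalizer C f g q"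
  shows "f \<in> Arr C" "g \<in> Arr C" "q \<in> Arr C" "Dom C g = Dom C f" "Cod C g = Cod C f" "Dom C q = Cod C f"
    "q \<cdot> f = q \<cdot> g"
  using assms unfolding is_coequalizer_def by auto

lemma coequalizer_ex1:
  assumes "is_coequalizer C f g q" "u \<in> Arr C" "Dom C u = Cod C f" "u \<cdot> f = u \<cdot> g"
  shows "\<exists>!h. h \<in> hom_set C (Cod C q) (Cod C u) \<and> h \<cdot> q = u"
proof -
  have u: "u \<in> hom_set C (Cod C f) (Cod C u)" "Cod C u \<in> Obj C" using assms by simp_all
  have "\<forall>W \<in> Obj C. \<forall>u \<in> hom_set C (Cod C f) W. u \<cdot> f = u \<cdot> g \<longrightarrow>
        (\<exists>!h. h \<in> hom_set C (Cod C q) W \<and> h \<cdot> q = u)"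
    using assms(1) unfolding is_coequalizer_def by (elim conjE)
  from this[rule_format, OF u(2,1) assms(4)] show ?thesis .
qed

lemma coequalizer_lift:
  assumes "is_coequalizer C f g q" "u \<in> Arr C" "Dom C u = Cod C f" "u \<cdot> f = u \<cdot> g"
  obtains h where "h \<in> Arr C" "Dom C h = Cod C q" "Cod C h = Cod C u" "h \<cdot> q = u"
  using coequalizer_ex1[OF assms] by auto

lemma coequalizer_epic:
  assumes "is_coequalizer C f g q" shows "epic C q"
  unfolding epic_def
proof (intro conjI ballI impI)
  note D = coequalizerD[OF assms(1)]
  show "q \<in> Arr C" using D by simp
  fix W h k assume *: "W \<in> Obj C" "h \<in> hom_set C (Cod C q) W" "k \<in> hom_set C (Cod C q) W" "h \<cdot> q = k \<cdot> q"
  have "(h \<cdot> q) \<cdot> f = (h \<cdot> q) \<cdot> g" using D * by simp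
  then have "\<exists>!r. r \<in> hom_set C (Cod C q) (Cod C (h \<cdot> q)) \<and> r \<cdot> q = h \<cdot> q"
    by (intro coequalizer_ex1[OF assms]) (use D * in simp_all)
  moreover have "Cod C (h \<cdot> q) = W" using D * by simp
  ultimately show "h = k" using * by metis
qed

lemma coequalizerI:
  assumes "f \<in> Arr C" "g \<in> Arr C" "Dom C g = Dom C f" "Cod C g = Cod C f" "Dom C q = Cod C f"
    "q \<cdot> f = q \<cdot> g" "epic C q"
    "\<And>u. \<lbrakk>u \<in> Arr C; Dom C u = Cod C f; u \<cdot> f = u \<cdot> g\<rbrakk>
       \<Longrightarrow> \<exists>h. h \<in> Arr C \<and> Dom C h = Cod C q \<and> Cod C h = Cod C u \<and> h \<cdot> q = u"
  shows "is_coequalizer C f g q"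
  unfolding is_coequalizer_def
proof (intro conjI ballI impI)
  fix W u assume *: "W \<in> Obj C" "u \<in> hom_set C (Cod C f) W" "u \<cdot> f = u \<cdot> g"
  obtain h where h: "h \<in> Arr C" "Dom C h = Cod C q" "Cod C h = Cod C u" "h \<cdot> q = u" 
    using assms(8)[of u] * by auto
  show "\<exists>!h. h \<in> hom_set C (Cod C q) W \<and> h \<cdot> q = u"
  proof (rule ex1I[of _ h])
    fix k assume k: "k \<in> hom_set C (Cod C q) W \<and> k \<cdot> q = u"
    show "k = h" by (rule epicD[OF assms(7)]) (use h k * in auto)
  qed (use h * in auto)
qed (use assms in simp_all)

lemma regular_epi_epic: "regular_epi C e \<Longrightarrow> epic C e"
  unfolding regular_epi_def using coequalizer_epic by blast

lemma regular_epi_Arr [simp]: "regular_epi C e \<Longrightarrow> e \<in> Arr C"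
  using regular_epi_epic epic_Arr by blast

text \<open>As \<open>m\<close> cancels, \<open>u\<close> has equal composites with the pair that
  \<open>e\<close> coequalizes and so extends along \<open>e\<close> to \<open>d\<close>; the lower
  triangle commutes because \<open>e\<close> is epic.\<close>

lemma regular_epi_diagonal:
  assumes "regular_epi C e" "monic C m" "u \<in> Arr C" "v \<in> Arr C" "Dom C u = Dom C e" "Cod C u = Dom C m"
    "Dom C v = Cod C e" "Cod C v = Cod C m" "m \<cdot> u = v \<cdot> e"
  obtains d where "d \<in> Arr C" "Dom C d = Cod C e" "Cod C d = Dom C m" "d \<cdot> e = u" "m \<cdot> d = v"
proof -
  obtain f g where fg: "is_coequalizer C f g e" using assms(1) unfolding regular_epi_def by blast
  note D = coequalizerD[OF fg]
  have "m \<cdot> (u \<cdot> f) = v \<cdot> (e \<cdot> f)" using Comp_reassoc[OF assms(9), of f] assms D by auto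
  also have "\<dots> = m \<cdot> (u \<cdot> g)" using Comp_reassoc[OF assms(9), of g] assms D by auto
  finally have "u \<cdot> f = u \<cdot> g" by (rule monicD[OF assms(2)]) (use D assms in simp_all)
  then obtain d where d: "d \<in> Arr C" "Dom C d = Cod C e" "Cod C d = Dom C m" "d \<cdot> e = u"
    using coequalizer_lift[OF fg, of u] assms D by auto
  have "(m \<cdot> d) \<cdot> e = v \<cdot> e" using assms d D by simp
  then have "m \<cdot> d = v" by (rule epicD[OF regular_epi_epic[OF assms(1)]]) (use assms d in simp_all)
  with d that show ?thesis by blast
qed

text \<open>A factorization of \<open>y \<cdot> c\<close> gives a square from \<open>c\<close> to
  \<open>m\<close>, whose diagonal factors \<open>y\<close>. Membership that is found only after a
  cover \<open>c\<close> thus holds for \<open>y\<close> itself; most arguments with local preimages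
  end here.\<close>

lemma factors_through_descent:
  assumes "factors_through C (y \<cdot> c) m" "regular_epi C c" "monic C m" "y \<in> Arr C" "Dom C y = Cod C c"
    "Cod C y = Cod C m"
  shows "factors_through C y m"
proof -
  obtain h where h: "h \<in> Arr C" "Dom C h = Dom C c" "Cod C h = Dom C m" "m \<cdot> h = y \<cdot> c"
    using assms by (auto elim: factors_throughE)
  then obtain d where "d \<in> Arr C" "Dom C d = Cod C c" "Cod C d = Dom C m" "m \<cdot> d = y"
    using regular_epi_diagonal[OF assms(2,3), of h y] assms by auto
  then show ?thesis by (intro factors_throughI[of _ _ d]) (use assms in auto)
qed

text \<open>Both \<open>e\<close> and \<open>m \<cdot> e\<close> are coequalizers of the same
  pair.\<close>

lemma iso_comp_regular_epi:
  assumes "regular_epi C e" "is_iso C m" "Dom C m = Cod C e"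
  shows "regular_epi C (m \<cdot> e)"
proof -
  obtain f g where fg: "is_coequalizer C f g e" using assms(1) unfolding regular_epi_def by blast
  note D = coequalizerD[OF fg]
  obtain n where n: "m \<in> Arr C" "n \<in> Arr C" "Dom C n = Cod C m" "Cod C n = Dom C m"
    "n \<cdot> m = Id C (Dom C m)" "m \<cdot> n = Id C (Cod C m)"
    using is_isoE[OF assms(2)] by metis
  have "is_coequalizer C f g (m \<cdot> e)"
  proof (rule coequalizerI)
    show "epic C (m \<cdot> e)" unfolding epic_def
    proof (intro conjI ballI impI)
      fix W h k assume *: "h \<in> hom_set C (Cod C (m \<cdot> e)) W" "k \<in> hom_set C (Cod C (m \<cdot> e)) W"
        "h \<cdot> (m \<cdot> e) = k \<cdot> (m \<cdot> e)"
      then have "(h \<cdot> m) \<cdot> e = (k \<cdot> m) \<cdot> e" using n assms D by simp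
      then have "h \<cdot> m = k \<cdot> m" by (rule epicD[OF coequalizer_epic[OF fg]]) (use n assms D * in simp_all)
      then have "(h \<cdot> m) \<cdot> n = (k \<cdot> m) \<cdot> n" by simp
      then show "h = k" using n assms D * by simp
    qed (use n D assms in simp)
    fix u assume u: "u \<in> Arr C" "Dom C u = Cod C f" "u \<cdot> f = u \<cdot> g"
    then obtain h where "h \<in> Arr C" "Dom C h = Cod C e" "Cod C h = Cod C u" "h \<cdot> e = u"
      using coequalizer_lift[OF fg u] by auto
    moreover from this have "n \<cdot> (m \<cdot> e) = e" using n assms D Comp_eq_assoc[OF n(5), of e] by simp
    ultimately show "\<exists>h. h \<in> Arr C \<and> Dom C h = Cod C (m \<cdot> e) \<and> Cod C h = Cod C u \<and> h \<cdot> (m \<cdot> e) = u"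
      by (intro exI[of _ "h \<cdot> n"]) (use n assms D in simp)
  qed (use D n assms in simp_all)
  then show ?thesis unfolding regular_epi_def by blast
qed

text \<open>The identity coequalizes a pair of identities, and composing it with the isomorphism
  preserves regularity.\<close>

lemma iso_regular_epi:
  assumes "is_iso C f" shows "regular_epi C f"
proof -
  have f: "f \<in> Arr C" using assms unfolding is_iso_def by simp
  have "is_coequalizer C (Id C (Dom C f)) (Id C (Dom C f)) (Id C (Dom C f))"
  proof (rule coequalizerI)
    show "epic C (Id C (Dom C f))" unfolding epic_def using f by auto
    show "\<exists>h. h \<in> Arr C \<and> Dom C h = Cod C (Id C (Dom C f)) \<and> Cod C h = Cod C u \<and> h \<cdot> Id C (Dom C f) = u"
      if "u \<in> Arr C" "Dom C u = Cod C (Id C (Dom C f))" for u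
      by (rule exI[of _ u]) (use f that in auto)
  qed (use f in auto)
  then have "regular_epi C (Id C (Dom C f))" unfolding regular_epi_def by blast
  from iso_comp_regular_epi[OF this assms] show ?thesis using f by simp
qed

lemma terminal_unique:
  assumes "is_terminal C T" "f \<in> Arr C" "g \<in> Arr C" "Dom C f = Dom C g" "Cod C f = T" "Cod C g = T"
  shows "f = g"
proof -
  have "\<exists>!h. h \<in> hom_set C (Dom C f) T" using assms(1) unfolding is_terminal_def using assms(2) Dom_closed by blast
  then show ?thesis using assms by auto
qed

lemma initial_unique:
  assumes "is_initial C Z" "f \<in> Arr C" "g \<in> Arr C" "Cod C f = Cod C g" "Dom C f = Z" "Dom C g = Z"
  shows "f = g"
proof -
  have "\<exists>!h. h \<in> hom_set C Z (Cod C f)" using assms(1) unfolding is_initial_def using assms(2) Cod_closed by blast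
  then show ?thesis using assms by auto
qed

end


section \<open>Images in regular categories\<close>

context category
begin

text \<open>The pair of which \<open>e\<close> is known to be a coequalizer factors through the
  kernel pair, so an arrow that agrees on the kernel pair agrees on that pair too.\<close>

lemma kernel_pair_coequalizer:
  assumes "regular_epi C e" "is_pullback C e e r s"
  shows "is_coequalizer C r s e"
proof -
  note P = pullbackD[OF assms(2)]
  obtain f g where fg: "is_coequalizer C f g e" using assms(1) unfolding regular_epi_def by blast
  note D = coequalizerD[OF fg]
  obtain k where k: "k \<in> Arr C" "Dom C k = Dom C g" "Cod C k = Dom C r" "r \<cdot> k = f" "s \<cdot> k = g"
    by (rule pullback_lift[OF assms(2), of f g]) (use D in simp_all)
  show ?thesis
  proof (rule coequalizerI)
    show "epic C e" using assms(1) by (rule regular_epi_epic)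
    fix u assume u: "u \<in> Arr C" "Dom C u = Cod C r" "u \<cdot> r = u \<cdot> s"
    have "u \<cdot> (r \<cdot> k) = u \<cdot> (s \<cdot> k)"
      by (rule Comp_reassoc[OF u(3)]) (use u P k in simp_all)
    then have uf: "u \<cdot> f = u \<cdot> g" using k by simp
    obtain h where "h \<in> Arr C" "Dom C h = Cod C e" "Cod C h = Cod C u" "h \<cdot> e = u"
      by (rule coequalizer_lift[OF fg u(1) _ uf]) (use u P D in simp_all)
    then show "\<exists>h. h \<in> Arr C \<and> Dom C h = Cod C e \<and> Cod C h = Cod C u \<and> h \<cdot> e = u" by blast
  qed (use P in simp_all)
qed

lemma products_are_pullbacks_over_terminal:
  assumes "is_terminal C T" "is_pullback C f g p q" "Cod C f = T"
  shows "is_product C (Dom C f) (Dom C g) (Dom C p) p q"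
  unfolding is_product_def
proof (intro conjI ballI)
  note P = pullbackD[OF assms(2)]
  fix W u v assume uv: "W \<in> Obj C" "u \<in> hom_set C W (Dom C f)" "v \<in> hom_set C W (Dom C g)"
  have "f \<cdot> u = g \<cdot> v" by (rule terminal_unique[OF assms(1)]) (use P uv assms in simp_all)
  then have "\<exists>!h. h \<in> hom_set C (Dom C v) (Dom C p) \<and> p \<cdot> h = u \<and> q \<cdot> h = v"
    by (intro pullback_ex1[OF assms(2)]) (use uv in simp_all)
  then show "\<exists>!h. h \<in> hom_set C W (Dom C p) \<and> p \<cdot> h = u \<and> q \<cdot> h = v" using uv by simp
qed (use pullbackD[OF assms(2)] in simp_all)

end

locale regular_cat =
  fixes C :: "('o, 'a) cat" (structure)
  assumes regular: "regular_category C"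

sublocale regular_cat \<subseteq> category
  using regular unfolding regular_category_def by blast

context regular_cat
begin

lemma pullback_exists:
  assumes "f \<in> Arr C" "g \<in> Arr C" "Cod C f = Cod C g"
  obtains p q where "is_pullback C f g p q"
  using regular assms unfolding regular_category_def finitely_complete_def by blast

lemma terminal_exists:
  obtains T where "is_terminal C T"
  using regular unfolding regular_category_def finitely_complete_def by blast

lemma product_exists:
  assumes "X \<in> Obj C" "Y \<in> Obj C"
  obtains P p q where "is_product C X Y P p q"
proof -
  obtain T where T: "is_terminal C T" by (rule terminal_exists)
  obtain f g where fg: "f \<in> hom_set C X T" "g \<in> hom_set C Y T"
    using T assms unfolding is_terminal_def by blast
  obtain p q where "is_pullback C f g p q"
    by (rule pullback_exists[of f g]) (use fg in simp_all)
  from products_are_pullbacks_over_terminal[OF T this] fg that show ?thesis by simp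
qed

lemma regular_epi_pullback: "is_pullback C f g p q \<Longrightarrow> regular_epi C g \<Longrightarrow> regular_epi C p"
  using regular unfolding regular_category_def by blast

lemma regular_epi_lift:
  assumes "regular_epi C e" "y \<in> Arr C" "Cod C y = Cod C e"
  obtains c x where "regular_epi C c" "Cod C c = Dom C y" "x \<in> Arr C" "Dom C x = Dom C c"
    "Cod C x = Dom C e" "y \<cdot> c = e \<cdot> x"
proof -
  obtain p q where pq: "is_pullback C y e p q"
    by (rule pullback_exists[of y e]) (use assms in simp_all)
  show ?thesis
    by (rule that[of p q]) (use regular_epi_pullback[OF pq assms(1)] pullbackD[OF pq] in simp_all)
qed

text \<open>\<open>e\<close> is the coequalizer of the kernel pair of \<open>f\<close>. The induced
  \<open>m\<close> is monic because two elements with the same value under \<open>m\<close> lift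
  along \<open>e\<close> after a cover; the lifts have the same value under \<open>f\<close>, hence
  form an element of the kernel pair and are identified by \<open>e\<close>.\<close>

lemma factorization:
  assumes "f \<in> Arr C"
  obtains e m where "regular_epi C e" "monic C m" "Dom C e = Dom C f" "Cod C e = Dom C m"
    "Cod C m = Cod C f" "m \<cdot> e = f"
proof -
  obtain r s where rs: "is_pullback C f f r s" by (rule pullback_exists[OF assms assms]) simp
  note R = pullbackD[OF rs]
  obtain e where e: "is_coequalizer C r s e"
    using regular rs unfolding regular_category_def by blast
  note E = coequalizerD[OF e]
  have re: "regular_epi C e" using e unfolding regular_epi_def by blast
  obtain m where m: "m \<in> Arr C" "Dom C m = Cod C e" "Cod C m = Cod C f" "m \<cdot> e = f"
    by (rule coequalizer_lift[OF e, of f]) (use R assms in simp_all)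
  have "monic C m"
  proof (rule monicI)
    fix u v assume uv: "u \<in> Arr C" "v \<in> Arr C" "Dom C u = Dom C v" "Cod C u = Dom C m" "Cod C v = Dom C m"
      "m \<cdot> u = m \<cdot> v"
    obtain c a where c: "regular_epi C c" "Cod C c = Dom C u" "a \<in> Arr C" "Dom C a = Dom C c"
      "Cod C a = Dom C e" "u \<cdot> c = e \<cdot> a"
      by (rule regular_epi_lift[OF re uv(1)]) (use uv m in simp_all)
    \<comment> \<open>The second lift starts from \<open>v \<cdot> c\<close> instead of
      \<open>v\<close>, so that both lifts can be compared on the domain of
      \<open>d\<close>.\<close>
    obtain d b where d: "regular_epi C d" "Cod C d = Dom C (v \<cdot> c)" "b \<in> Arr C" "Dom C b = Dom C d"
      "Cod C b = Dom C e" "(v \<cdot> c) \<cdot> d = e \<cdot> b"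
      by (rule regular_epi_lift[OF re, of "v \<cdot> c"]) (use uv m c in simp_all)
    have dc: "Cod C d = Dom C c" using d c uv by simp
    have ua: "(u \<cdot> c) \<cdot> d = e \<cdot> (a \<cdot> d)" using c d dc E by simp
    have "f \<cdot> (a \<cdot> d) = m \<cdot> (e \<cdot> (a \<cdot> d))" using m c d dc E Comp_eq_assoc[OF m(4), of "a \<cdot> d"] by simp
    also have "\<dots> = (m \<cdot> u) \<cdot> (c \<cdot> d)" unfolding ua[symmetric] using m c(1-4) d(1-4) dc uv(1-5) by simp
    also have "\<dots> = m \<cdot> ((v \<cdot> c) \<cdot> d)" unfolding uv(6) using m c(1-4) d(1-4) dc uv(1-5) by simp
    also have "\<dots> = f \<cdot> b" unfolding d(6) using m d E Comp_eq_assoc[OF m(4), of b] by simp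
    finally have fa: "f \<cdot> (a \<cdot> d) = f \<cdot> b" .
    obtain h where h: "h \<in> Arr C" "Dom C h = Dom C b" "Cod C h = Dom C r" "r \<cdot> h = a \<cdot> d" "s \<cdot> h = b"
      by (rule pullback_lift[OF rs _ _ _ _ _ fa]) (use c d dc R E in simp_all)
    have "e \<cdot> (r \<cdot> h) = e \<cdot> (s \<cdot> h)"
      by (rule Comp_reassoc[OF E(7)]) (use h R E in simp_all)
    then have eq: "(u \<cdot> c) \<cdot> d = (v \<cdot> c) \<cdot> d" using h ua d(6) by simp
    have "u \<cdot> c = v \<cdot> c"
      by (rule epicD[OF regular_epi_epic[OF d(1)] eq]) (use uv(1-5) c(1-4) dc in simp_all)
    then show "u = v"
      by (rule epicD[OF regular_epi_epic[OF c(1)]]) (use uv(1-5) c(1,2) in simp_all)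
  qed (use m in simp)
  with m re that[of e m] R E show ?thesis by simp
qed

text \<open>The monomorphic part of the composite is invertible: the composite factors through it,
  and descent along \<open>e\<close> and then along \<open>e'\<close> shows that the identity of
  \<open>Cod C e'\<close> does.\<close>

lemma regular_epi_comp:
  assumes "regular_epi C e" "regular_epi C e'" "Cod C e = Dom C e'"
  shows "regular_epi C (e' \<cdot> e)"
proof -
  obtain q m where qm: "regular_epi C q" "monic C m" "Dom C q = Dom C (e' \<cdot> e)" "Cod C q = Dom C m"
    "Cod C m = Cod C (e' \<cdot> e)" "m \<cdot> q = e' \<cdot> e"
    by (rule factorization[of "e' \<cdot> e"]) (use assms in simp_all)
  have "factors_through C (e' \<cdot> e) m"
    by (rule factors_throughI[of _ _ q]) (use qm in simp_all)
  then have "factors_through C e' m"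
    by (rule factors_through_descent[OF _ assms(1) qm(2)]) (use assms qm in simp_all)
  then have "factors_through C (Id C (Cod C e') \<cdot> e') m" using assms by simp
  then have "factors_through C (Id C (Cod C e')) m"
    by (rule factors_through_descent[OF _ assms(2) qm(2)]) (use assms qm in simp_all)
  then obtain h where "h \<in> Arr C" "Dom C h = Cod C e'" "Cod C h = Dom C m" "m \<cdot> h = Id C (Cod C e')"
    using assms by (auto elim!: factors_throughE)
  then have "is_iso C m"
    by (intro monic_split_epi_is_iso[OF qm(2)]) (use qm assms in simp_all)
  from iso_comp_regular_epi[OF qm(1) this] qm show ?thesis by simp
qed

text \<open>The equalizer is the intersection of the graphs (1, u) and (1, v) inside the product. It
  is delivered through its membership criterion, the form in which it is applied.\<close>

lemma equalizer_exists:
  assumes "u \<in> Arr C" "v \<in> Arr C" "Dom C u = Dom C v" "Cod C u = Cod C v"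
  obtains m where "monic C m" "Cod C m = Dom C v"
    "\<And>x. \<lbrakk>x \<in> Arr C; Cod C x = Dom C v\<rbrakk> \<Longrightarrow> factors_through C x m \<longleftrightarrow> u \<cdot> x = v \<cdot> x"
proof -
  obtain P a b where P: "is_product C (Dom C v) (Cod C v) P a b"
    by (rule product_exists[of "Dom C v" "Cod C v"]) (use assms in simp_all)
  note D = productD[OF P]
  obtain f where f: "f \<in> Arr C" "Dom C f = Dom C u" "Cod C f = P" "a \<cdot> f = Id C (Dom C v)" "b \<cdot> f = u"
    by (rule product_lift[OF P, of "Id C (Dom C v)" u]) (use assms in simp_all)
  obtain g where g: "g \<in> Arr C" "Dom C g = Dom C v" "Cod C g = P" "a \<cdot> g = Id C (Dom C v)" "b \<cdot> g = v"
    by (rule product_lift[OF P, of "Id C (Dom C v)" v]) (use assms in simp_all)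
  obtain m n where mn: "is_pullback C f g m n"
    by (rule pullback_exists[of f g]) (use f g in simp_all)
  note M = pullbackD[OF mn]
  have g_monic: "monic C g" by (rule split_monic[of a]) (use g D in simp_all)
  show ?thesis
  proof (rule that[of m])
    show "monic C m" by (rule pullback_monic[OF mn g_monic])
    show "Cod C m = Dom C v" using M f assms by simp
    fix x assume x: "x \<in> Arr C" "Cod C x = Dom C v"
    have af: "a \<cdot> (f \<cdot> x) = x" "b \<cdot> (f \<cdot> x) = u \<cdot> x" "a \<cdot> (g \<cdot> x) = x" "b \<cdot> (g \<cdot> x) = v \<cdot> x"
      using f g x D assms
      by (simp_all add: Comp_eq_assoc[OF f(4)] Comp_eq_assoc[OF f(5)] Comp_eq_assoc[OF g(4)] Comp_eq_assoc[OF g(5)])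
    have "factors_through C x m \<longleftrightarrow> factors_through C (f \<cdot> x) g"
      by (rule pullback_factors_iff[OF mn]) (use x f assms in simp_all)
    also have "\<dots> \<longleftrightarrow> f \<cdot> x = g \<cdot> x"
    proof
      assume "factors_through C (f \<cdot> x) g"
      then obtain k where k: "k \<in> Arr C" "Dom C k = Dom C x" "Cod C k = Dom C v" "g \<cdot> k = f \<cdot> x"
        using f g x assms by (auto elim!: factors_throughE)
      have "a \<cdot> (g \<cdot> k) = k" using Comp_eq_assoc[OF g(4), of k] g k(1-3) D by simp
      then have "k = x" using k(4) af by simp
      then show "f \<cdot> x = g \<cdot> x" using k by simp
    qed (use x f g assms in \<open>auto intro: factors_throughI\<close>)
    also have "\<dots> \<longleftrightarrow> u \<cdot> x = v \<cdot> x"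
    proof
      assume "f \<cdot> x = g \<cdot> x" then show "u \<cdot> x = v \<cdot> x" using af by metis
    next
      assume "u \<cdot> x = v \<cdot> x" then show "f \<cdot> x = g \<cdot> x"
        by (intro product_unique[OF P, of "f \<cdot> x" "g \<cdot> x"]) (use af x f g assms in simp_all)
    qed
    finally show "factors_through C x m \<longleftrightarrow> u \<cdot> x = v \<cdot> x" .
  qed
qed


text \<open>Images, like the preimages below, are fixed by choice, which makes the transports
  operations on monomorphisms. Clusters are equivalence classes, so the choice disappears once
  classes are formed.\<close>

definition img :: "'a \<Rightarrow> 'a" where
  "img f = (SOME m. monic C m \<and> Cod C m = Cod C f \<and>
     (\<exists>e. regular_epi C e \<and> Dom C e = Dom C f \<and> Cod C e = Dom C m \<and> m \<cdot> e = f))"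

definition preimage :: "'a \<Rightarrow> 'a \<Rightarrow> 'a" where
  "preimage g m = (SOME n. \<exists>h. is_pullback C g m n h)"

lemma img_factorization:
  assumes "f \<in> Arr C"
  obtains e where "regular_epi C e" "Dom C e = Dom C f" "Cod C e = Dom C (img f)" "img f \<cdot> e = f"
    "monic C (img f)" "Cod C (img f) = Cod C f"
proof -
  have "\<exists>m. monic C m \<and> Cod C m = Cod C f \<and>
     (\<exists>e. regular_epi C e \<and> Dom C e = Dom C f \<and> Cod C e = Dom C m \<and> m \<cdot> e = f)"
    using factorization[OF assms] by metis
  then have "monic C (img f) \<and> Cod C (img f) = Cod C f \<and>
     (\<exists>e. regular_epi C e \<and> Dom C e = Dom C f \<and> Cod C e = Dom C (img f) \<and> img f \<cdot> e = f)"
    unfolding img_def by (rule someI_ex)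
  then show ?thesis by (elim conjE exE) (rule that)
qed

lemma img_simps [simp]:
  assumes "f \<in> Arr C" shows "monic C (img f)" "Cod C (img f) = Cod C f"
  by (rule img_factorization[OF assms], simp)+

text \<open>One direction composes with the regular epimorphic part of \<open>f\<close>, the other
  is descent along it. Direct image becomes a left adjoint through this equivalence.\<close>

lemma img_le_iff:
  assumes "f \<in> Arr C" "monic C m" "Cod C m = Cod C f"
  shows "factors_through C (img f) m \<longleftrightarrow> factors_through C f m"
proof -
  obtain e where e: "regular_epi C e" "Dom C e = Dom C f" "Cod C e = Dom C (img f)" "img f \<cdot> e = f"
    by (rule img_factorization[OF assms(1)])
  have "factors_through C (img f \<cdot> e) m" if "factors_through C (img f) m"
    by (rule factors_through_comp[OF that]) (use e assms in simp_all)
  moreover have "factors_through C (img f) m" if "factors_through C (img f \<cdot> e) m"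
    by (rule factors_through_descent[OF that e(1) assms(2)]) (use e assms in simp_all)
  ultimately show ?thesis unfolding e(4) by blast
qed

lemma factors_img: "f \<in> Arr C \<Longrightarrow> factors_through C f (img f)"
  using img_le_iff[of f "img f"] by simp

text \<open>The cover \<open>c\<close> arises by pulling back the regular epimorphic part of
  \<open>f\<close> along the element of the image; the converse is descent along
  \<open>c\<close>.\<close>

lemma factors_img_iff:
  assumes "f \<in> Arr C" "y \<in> Arr C" "Cod C y = Cod C f"
  shows "factors_through C y (img f) \<longleftrightarrow>
    (\<exists>c x. regular_epi C c \<and> Cod C c = Dom C y \<and> x \<in> Arr C \<and> Dom C x = Dom C c \<and> Cod C x = Dom C f \<and> y \<cdot> c = f \<cdot> x)"
proof
  obtain e where e: "regular_epi C e" "Dom C e = Dom C f" "Cod C e = Dom C (img f)" "img f \<cdot> e = f"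
    by (rule img_factorization[OF assms(1)])
  assume "factors_through C y (img f)"
  then obtain h where h: "h \<in> Arr C" "Dom C h = Dom C y" "Cod C h = Dom C (img f)" "img f \<cdot> h = y"
    by (auto elim: factors_throughE)
  obtain c x where c: "regular_epi C c" "Cod C c = Dom C h" "x \<in> Arr C" "Dom C x = Dom C c"
    "Cod C x = Dom C e" "h \<cdot> c = e \<cdot> x"
    by (rule regular_epi_lift[OF e(1) h(1)]) (use h e in simp_all)
  have "y \<cdot> c = img f \<cdot> (h \<cdot> c)" using Comp_eq_assoc[OF h(4), of c] c h assms by simp
  also have "\<dots> = f \<cdot> x" using c e assms by (simp add: Comp_eq_assoc[OF e(4)])
  finally show "\<exists>c x. regular_epi C c \<and> Cod C c = Dom C y \<and> x \<in> Arr C \<and> Dom C x = Dom C c \<and> Cod C x = Dom C f \<and> y \<cdot> c = f \<cdot> x"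
    using c h e by auto
next
  assume "\<exists>c x. regular_epi C c \<and> Cod C c = Dom C y \<and> x \<in> Arr C \<and> Dom C x = Dom C c \<and> Cod C x = Dom C f \<and> y \<cdot> c = f \<cdot> x"
  then obtain c x where c: "regular_epi C c" "Cod C c = Dom C y" "x \<in> Arr C" "Dom C x = Dom C c"
    "Cod C x = Dom C f" "y \<cdot> c = f \<cdot> x" by blast
  have "factors_through C (f \<cdot> x) (img f)"
    by (rule factors_through_comp[OF factors_img]) (use c assms in simp_all)
  then have "factors_through C (y \<cdot> c) (img f)" using c by simp
  then show "factors_through C y (img f)"
    by (rule factors_through_descent[OF _ c(1)]) (use c assms in simp_all)
qed

lemma preimage_pullback:
  assumes "g \<in> Arr C" "m \<in> Arr C" "Cod C g = Cod C m"
  obtains h where "is_pullback C g m (preimage g m) h"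
proof -
  have "\<exists>n h. is_pullback C g m n h" using pullback_exists[OF assms] by metis
  then have "\<exists>h. is_pullback C g m (preimage g m) h" unfolding preimage_def by (rule someI_ex)
  then show ?thesis by (elim exE) (rule that)
qed

lemma preimage_simps [simp]:
  assumes "g \<in> Arr C" "monic C m" "Cod C g = Cod C m"
  shows "monic C (preimage g m)" "Cod C (preimage g m) = Dom C g"
proof -
  obtain h where h: "is_pullback C g m (preimage g m) h"
    by (rule preimage_pullback[of g m]) (use assms in simp_all)
  show "monic C (preimage g m)" "Cod C (preimage g m) = Dom C g"
    using pullback_monic[OF h assms(2)] pullbackD[OF h] by auto
qed

lemma factors_preimage_iff:
  assumes "g \<in> Arr C" "monic C m" "Cod C g = Cod C m" "x \<in> Arr C" "Cod C x = Dom C g"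
  shows "factors_through C x (preimage g m) \<longleftrightarrow> factors_through C (g \<cdot> x) m"
proof -
  obtain h where h: "is_pullback C g m (preimage g m) h"
    by (rule preimage_pullback[of g m]) (use assms in simp_all)
  show ?thesis by (rule pullback_factors_iff[OF h]) (use assms in simp_all)
qed

text \<open>The diagonal of the pullback square of m and n, that is, their intersection:
  \<open>preimage m n\<close> is a subobject of \<open>Dom C m\<close> and still has to be carried
  into the common codomain.\<close>

definition meet_sub :: "'a \<Rightarrow> 'a \<Rightarrow> 'a" where
  "meet_sub m n = m \<cdot> preimage m n"

lemma meet_sub_simps [simp]:
  assumes "monic C m" "monic C n" "Cod C m = Cod C n"
  shows "monic C (meet_sub m n)" "Cod C (meet_sub m n) = Cod C n"
  unfolding meet_sub_def using assms by (auto intro!: monic_Comp)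

lemma factors_meet_sub_iff:
  assumes "monic C m" "monic C n" "Cod C m = Cod C n" "x \<in> Arr C" "Cod C x = Cod C n"
  shows "factors_through C x (meet_sub m n) \<longleftrightarrow> factors_through C x m \<and> factors_through C x n"
proof -
  obtain h where h: "is_pullback C m n (preimage m n) h"
    by (rule preimage_pullback[of m n]) (use assms in simp_all)
  note D = pullbackD[OF h]
  have "factors_through C (meet_sub m n) m"
    unfolding meet_sub_def by (rule factors_throughI[OF refl]) (use assms D in simp_all)
  moreover have "factors_through C (meet_sub m n) n"
    unfolding meet_sub_def by (rule factors_throughI[OF D(9)]) (use assms D in simp_all)
  moreover have "factors_through C x (meet_sub m n)" if xm: "factors_through C x m" and xn: "factors_through C x n"
  proof -
    obtain k where k: "k \<in> Arr C" "Dom C k = Dom C x" "Cod C k = Dom C m" "m \<cdot> k = x"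
      by (rule factors_throughE[OF xm])
    have "factors_through C k (preimage m n)"
      using factors_preimage_iff[of m n k] xn k assms by simp
    then show ?thesis unfolding meet_sub_def
      using factors_through_postcomp[of k "preimage m n" m] k assms by simp
  qed
  ultimately show ?thesis using assms by (meson factors_through_trans monic_Arr)
qed

end


section \<open>Protomodularity\<close>

locale protomodular_regular_cat = regular_cat +
  assumes protomodular: "protomodular C"
begin

text \<open>A point is generated by its section together with any of its fibres: a subobject \<open>j\<close>
  containing both is itself a point, and its inclusion becomes an isomorphism after change of base
  along \<open>f\<close>.\<close>

lemma point_generated:
  assumes p: "p \<in> Arr C" and s: "s \<in> Arr C" "Dom C s = Cod C p" "Cod C s = Dom C p" "p \<cdot> s = Id C (Cod C p)"
    and j: "monic C j" "Cod C j = Dom C p" "factors_through C s j"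
    and f: "f \<in> Arr C" "Cod C f = Cod C p"
    and fibre: "\<And>r w. \<lbrakk>r \<in> Arr C; w \<in> Arr C; Dom C r = Dom C w; Cod C r = Dom C p; Cod C w = Dom C f;
      p \<cdot> r = f \<cdot> w\<rbrakk> \<Longrightarrow> factors_through C r j"
    and x: "x \<in> Arr C" "Cod C x = Dom C p"
  shows "factors_through C x j"
proof -
  obtain s' where s': "s' \<in> Arr C" "Dom C s' = Dom C s" "Cod C s' = Dom C j" "j \<cdot> s' = s"
    by (rule factors_throughE[OF j(3)])
  obtain q g where qg: "is_pullback C f p q g" by (rule pullback_exists[OF f(1) p f(2)])
  note D = pullbackD[OF qg]
  obtain t where t: "t \<in> Arr C" "Dom C t = Dom C f" "Cod C t = Dom C q" "q \<cdot> t = Id C (Dom C f)" "g \<cdot> t = s \<cdot> f"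
  proof (rule pullback_lift[OF qg, of "Id C (Dom C f)" "s \<cdot> f"])
    show "f \<cdot> Id C (Dom C f) = p \<cdot> (s \<cdot> f)"
      using f p s Comp_eq_assoc[OF s(4), of f] by simp
  qed (use f p s in simp_all)
  have "factors_through C g j" by (rule fibre[of g q]) (use D in simp_all)
  then obtain k where k: "k \<in> Arr C" "Dom C k = Dom C g" "Cod C k = Dom C j" "j \<cdot> k = g"
    by (rule factors_throughE)
  have ps': "(p \<cdot> j) \<cdot> s' = Id C (Cod C p)" using s' s p j by simp
  \<comment> \<open>The whole fibre lies in \<open>j\<close>, so it is also the fibre of the smaller
    point \<open>p \<cdot> j\<close>: both points have the same change of base along
    \<open>f\<close>.\<close>
  have pjk: "is_pullback C f (p \<cdot> j) q k"
  proof (rule pullbackI)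
    show "f \<cdot> q = (p \<cdot> j) \<cdot> k" using k p j D by simp
    fix u v assume uv: "u \<in> Arr C" "v \<in> Arr C" "Dom C u = Dom C v" "Cod C u = Dom C f" "Cod C v = Dom C (p \<cdot> j)"
      "f \<cdot> u = (p \<cdot> j) \<cdot> v"
    have fu: "f \<cdot> u = p \<cdot> (j \<cdot> v)" using uv p j by simp
    obtain h where h: "h \<in> Arr C" "Dom C h = Dom C (j \<cdot> v)" "Cod C h = Dom C q" "q \<cdot> h = u" "g \<cdot> h = j \<cdot> v"
      by (rule pullback_lift[OF qg _ _ _ _ _ fu]) (use uv p j in simp_all)
    have "j \<cdot> (k \<cdot> h) = j \<cdot> v" using h k D j p uv Comp_eq_assoc[OF k(4), of h] by simp
    then have "k \<cdot> h = v" by (rule monicD[OF j(1)]) (use h k D j p uv in simp_all)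
    with h show "\<exists>h. h \<in> Arr C \<and> Dom C h = Dom C v \<and> Cod C h = Dom C q \<and> q \<cdot> h = u \<and> k \<cdot> h = v"
      using uv p j by (intro exI[of _ h]) simp
  next
    fix h l assume hl: "h \<in> Arr C" "l \<in> Arr C" "Dom C h = Dom C l" "Cod C h = Dom C q" "Cod C l = Dom C q"
      "q \<cdot> h = q \<cdot> l" "k \<cdot> h = k \<cdot> l"
    have "j \<cdot> (k \<cdot> h) = j \<cdot> (k \<cdot> l)" using hl(7) by simp
    then have gh: "g \<cdot> h = g \<cdot> l" using hl(1-5) k D j Comp_eq_assoc[OF k(4), of h] Comp_eq_assoc[OF k(4), of l] by simp
    show "h = l" by (rule pullback_unique[OF qg hl(1-6) gh])
  qed (use D k p j in simp_all)
  have "j \<cdot> (k \<cdot> t) = j \<cdot> (s' \<cdot> f)"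
    using s' k t D j s f Comp_eq_assoc[OF k(4), of t] Comp_eq_assoc[OF s'(4), of f] by simp
  then have kt: "k \<cdot> t = s' \<cdot> f" by (rule monicD[OF j(1)]) (use s' k t D j s f in simp_all)
  \<comment> \<open>\<open>\<alpha>\<close> is the inclusion \<open>j\<close> as an arrow of points,
    and its change of base \<open>\<beta>\<close> is an identity.\<close>
  define \<alpha> where "\<alpha> = ((p \<cdot> j, s'), j, (p, s))"
  define \<beta> where "\<beta> = ((q, t), Id C (Dom C q), (q, t))"
  have qt: "(q, t) \<in> Obj (Points C (Dom C f))"
    using D t by (simp add: Points_def Let_def)
  have \<beta>: "\<beta> \<in> Arr (Points C (Dom C f))"
    using D t by (simp add: Points_def Let_def \<beta>_def)
  have "is_iso (Points C (Dom C f)) \<beta>"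
    unfolding is_iso_def
  proof (intro conjI bexI[of _ \<beta>])
    show "\<beta> \<in> Arr (Points C (Dom C f))" by (rule \<beta>)
  qed (use D t in \<open>simp_all add: Points_def Let_def \<beta>_def\<close>)
  moreover have "point_arrow_pullback C f \<alpha> \<beta>"
    unfolding point_arrow_pullback_def
  proof (intro conjI exI)
    show "\<alpha> \<in> Arr (Points C (Cod C f))"
      using p s s' j f ps' by (simp add: Points_def Let_def \<alpha>_def)
    show "\<beta> \<in> Arr (Points C (Dom C f))" by (rule \<beta>)
    show "point_pullback C f (fst \<alpha>) (fst \<beta>) k"
      using qt pjk kt p s s' j f ps' by (simp add: point_pullback_def \<alpha>_def \<beta>_def) (simp add: Points_def Let_def)
    show "point_pullback C f (snd (snd \<alpha>)) (snd (snd \<beta>)) g"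
      using qt qg t p s f by (simp add: point_pullback_def \<alpha>_def \<beta>_def) (simp add: Points_def Let_def)
    show "g \<cdot> fst (snd \<beta>) = fst (snd \<alpha>) \<cdot> k"
      using D k by (simp add: \<alpha>_def \<beta>_def)
  qed
  ultimately have "is_iso (Points C (Cod C f)) \<alpha>"
    using protomodular f(1) unfolding protomodular_def by blast
  \<comment> \<open>Of the inverse of \<open>\<alpha>\<close> only the underlying section of
    \<open>j\<close> is kept; it factors every \<open>x\<close> at once.\<close>
  then obtain h where h: "h \<in> Arr C" "Dom C h = Dom C p" "Cod C h = Dom C j" "j \<cdot> h = Id C (Dom C p)"
    using p j by (auto simp: is_iso_def Points_def Let_def \<alpha>_def)
  then have "j \<cdot> (h \<cdot> x) = x" using x j p Comp_eq_assoc[OF h(4), of x] by simp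
  then show ?thesis by (intro factors_throughI[of _ _ "h \<cdot> x"]) (use h x j p in simp_all)
qed

text \<open>On the kernel pair of \<open>g\<close>, restricted to \<open>j\<close> in the second component, the condition that the
  first component lie in \<open>j\<close> holds on the diagonal and on the fibre over \<open>Z\<close>, which is the kernel.\<close>

lemma kernel_saturated:
  assumes Z: "is_initial C Z" and i: "i \<in> Arr C" "Dom C i = Z" "Cod C i = Cod C g"
    and g: "g \<in> Arr C" and j: "monic C j" "Cod C j = Dom C g"
    and ker: "\<And>x w. \<lbrakk>x \<in> Arr C; w \<in> Arr C; Dom C x = Dom C w; Cod C x = Dom C g; Cod C w = Z; g \<cdot> x = i \<cdot> w\<rbrakk>
      \<Longrightarrow> factors_through C x j"
    and s: "factors_through C s j"
    and x: "x \<in> Arr C" "Cod C x = Dom C g" "Dom C x = Dom C s" "g \<cdot> x = g \<cdot> s"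
  shows "factors_through C x j"
proof -
  obtain s' where s': "s' \<in> Arr C" "Dom C s' = Dom C s" "Cod C s' = Dom C j" "j \<cdot> s' = s"
    by (rule factors_throughE[OF s])
  have gj: "g \<cdot> j \<in> Arr C" "Dom C (g \<cdot> j) = Dom C j" "Cod C (g \<cdot> j) = Cod C g" using g j by simp_all
  obtain p q where pq: "is_pullback C g (g \<cdot> j) p q"
    by (rule pullback_exists[OF g gj(1)]) (use gj in simp)
  note D = pullbackD[OF pq]
  obtain \<sigma> where \<sigma>: "\<sigma> \<in> Arr C" "Dom C \<sigma> = Dom C j" "Cod C \<sigma> = Dom C p" "p \<cdot> \<sigma> = j" "q \<cdot> \<sigma> = Id C (Dom C j)"
    by (rule pullback_lift[OF pq, of j "Id C (Dom C j)"]) (use j g in simp_all)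
  obtain i' where i': "i' \<in> Arr C" "Dom C i' = Z" "Cod C i' = Dom C j"
    using Z j unfolding is_initial_def hom_set_def by (auto dest!: bspec[of _ _ "Dom C j"])
  \<comment> \<open>Arrows out of \<open>Z\<close> are unique, so \<open>g\<close> takes the base
    point of \<open>j\<close> to the given \<open>i\<close>. The fibre of \<open>q\<close> over
    \<open>i'\<close> is therefore of the kind that \<open>ker\<close> speaks of.\<close>
  have gji: "g \<cdot> (j \<cdot> i') = i" by (rule initial_unique[OF Z]) (use i i' g j in simp_all)
  have k: "monic C (preimage p j)" "Cod C (preimage p j) = Dom C p" using D j by simp_all
  have all: "factors_through C r (preimage p j)" if "r \<in> Arr C" "Cod C r = Dom C q" for r
  proof (rule point_generated[of q \<sigma> "preimage p j" i' r])
    show "factors_through C \<sigma> (preimage p j)"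
      using factors_preimage_iff[of p j \<sigma>] D j \<sigma> by simp
    fix r w assume r: "r \<in> Arr C" "w \<in> Arr C" "Dom C r = Dom C w" "Cod C r = Dom C q" "Cod C w = Dom C i'"
      "q \<cdot> r = i' \<cdot> w"
    have "g \<cdot> (p \<cdot> r) = (g \<cdot> j) \<cdot> (q \<cdot> r)" by (rule Comp_reassoc[OF D(9)]) (use D r in simp_all)
    also have "\<dots> = (g \<cdot> (j \<cdot> i')) \<cdot> w" unfolding r(6) using g j i' r(1-5) by simp
    also have "\<dots> = i \<cdot> w" unfolding gji ..
    finally have "factors_through C (p \<cdot> r) j" by (intro ker[of _ w]) (use r i' D in simp_all)
    then show "factors_through C r (preimage p j)"
      using factors_preimage_iff[of p j r] D j r by simp
  qed (use that D \<sigma> k i' gj in simp_all)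
  have gx: "g \<cdot> x = (g \<cdot> j) \<cdot> s'" using x s' g j by simp
  obtain h where h: "h \<in> Arr C" "Dom C h = Dom C s'" "Cod C h = Dom C p" "p \<cdot> h = x" "q \<cdot> h = s'"
    by (rule pullback_lift[OF pq _ _ _ _ _ gx]) (use x s' g j in simp_all)
  have "factors_through C h (preimage p j)" by (rule all) (use h D in simp_all)
  then show ?thesis using factors_preimage_iff[of p j h] D j h by simp
qed

text \<open>The kernel pair of \<open>e\<close> is a point over \<open>Dom C e\<close>, with the
  diagonal as section, and the claim is that the equalizer of \<open>g \<cdot> r\<close> and
  \<open>g \<cdot> s\<close> is all of it. The diagonal lies in the equalizer. In the fibre over the
  base point the first component is the base point and the second lies in the kernel of
  \<open>e\<close>, so \<open>ker\<close> gives both the same value under \<open>g\<close>.\<close>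

lemma kernel_determines_equality:
  assumes Z: "is_initial C Z" and e: "e \<in> Arr C" and g: "g \<in> Arr C" "Dom C g = Dom C e"
    and i: "i \<in> Arr C" "Dom C i = Z" "Cod C i = Cod C e"
    and i': "i' \<in> Arr C" "Dom C i' = Z" "Cod C i' = Cod C g"
    and ker: "\<And>x w. \<lbrakk>x \<in> Arr C; w \<in> Arr C; Dom C x = Dom C w; Cod C x = Dom C e; Cod C w = Z; e \<cdot> x = i \<cdot> w\<rbrakk>
      \<Longrightarrow> g \<cdot> x = i' \<cdot> w"
    and x: "x \<in> Arr C" "y \<in> Arr C" "Dom C x = Dom C y" "Cod C x = Dom C e" "Cod C y = Dom C e" "e \<cdot> x = e \<cdot> y"
  shows "g \<cdot> x = g \<cdot> y"
proof -
  obtain r s where rs: "is_pullback C e e r s" by (rule pullback_exists[OF e e refl])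
  note D = pullbackD[OF rs]
  obtain d where d: "d \<in> Arr C" "Dom C d = Dom C e" "Cod C d = Dom C r" "r \<cdot> d = Id C (Dom C e)" "s \<cdot> d = Id C (Dom C e)"
    by (rule pullback_lift[OF rs, of "Id C (Dom C e)" "Id C (Dom C e)"]) (use e in simp_all)
  obtain m where m: "monic C m" "Cod C m = Dom C s"
    and m_iff: "\<And>x. \<lbrakk>x \<in> Arr C; Cod C x = Dom C s\<rbrakk> \<Longrightarrow> factors_through C x m \<longleftrightarrow> (g \<cdot> r) \<cdot> x = (g \<cdot> s) \<cdot> x"
    using equalizer_exists[of "g \<cdot> r" "g \<cdot> s"] D g by auto
  obtain z where z: "z \<in> Arr C" "Dom C z = Z" "Cod C z = Dom C e"
    using Z e unfolding is_initial_def hom_set_def by (auto dest!: bspec[of _ _ "Dom C e"])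
  have ez: "e \<cdot> z = i" by (rule initial_unique[OF Z]) (use i z e in simp_all)
  have gz: "g \<cdot> z = i'" by (rule initial_unique[OF Z]) (use i' z g in simp_all)
  have all: "factors_through C t m" if "t \<in> Arr C" "Cod C t = Dom C r" for t
  proof (rule point_generated[of r d m z t])
    show "factors_through C d m" using m_iff[of d] d D g by simp
    fix t w assume t: "t \<in> Arr C" "w \<in> Arr C" "Dom C t = Dom C w" "Cod C t = Dom C r" "Cod C w = Dom C z"
      "r \<cdot> t = z \<cdot> w"
    have rt: "g \<cdot> (r \<cdot> t) = i' \<cdot> w" unfolding t(6) using Comp_eq_assoc[OF gz, of w] t z g by simp
    have "e \<cdot> (s \<cdot> t) = e \<cdot> (r \<cdot> t)" by (rule Comp_reassoc[OF D(9)[symmetric]]) (use D t in simp_all)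
    also have "\<dots> = i \<cdot> w" unfolding t(6) using Comp_eq_assoc[OF ez, of w] t z e by simp
    finally have "g \<cdot> (s \<cdot> t) = i' \<cdot> w" by (intro ker) (use t z D in simp_all)
    then show "factors_through C t m" using m_iff[of t] t(1-5) D g rt by simp
  qed (use that D d m z in simp_all)
  obtain h where h: "h \<in> Arr C" "Dom C h = Dom C y" "Cod C h = Dom C r" "r \<cdot> h = x" "s \<cdot> h = y"
    by (rule pullback_lift[OF rs x(1,2,3) x(4,5,6)])
  have "factors_through C h m" by (rule all) (use h in simp_all)
  then show ?thesis using m_iff[of h] h D g by simp
qed

text \<open>Protomodular categories are Mal'tsev categories: transitivity is automatic. A pair
  \<open>(x, y), (y, z)\<close> of related elements is a point over \<open>(x, y)\<close>, and the condition that \<open>x\<close> and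
  \<open>z\<close> be related holds on the section \<open>z = y\<close> and on the fibre \<open>x = y\<close>.\<close>

lemma reflexive_symmetric_equivalence:
  assumes rs: "r \<in> Arr C" "s \<in> Arr C" "Dom C s = Dom C r" "Cod C s = Cod C r"
    and jm: "\<And>u v. \<lbrakk>u \<in> Arr C; v \<in> Arr C; Dom C u = Dom C v; Cod C u = Dom C r; Cod C v = Dom C r;
      r \<cdot> u = r \<cdot> v; s \<cdot> u = s \<cdot> v\<rbrakk> \<Longrightarrow> u = v"
    and d: "d \<in> Arr C" "Dom C d = Cod C r" "Cod C d = Dom C r" "r \<cdot> d = Id C (Cod C r)" "s \<cdot> d = Id C (Cod C r)"
    and t: "t \<in> Arr C" "Dom C t = Dom C r" "Cod C t = Dom C r" "r \<cdot> t = s" "s \<cdot> t = r"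
  shows "equivalence_relation C r s"
proof -
  have "\<exists>k\<in>hom_set C (Dom C p) (Dom C r). r \<cdot> k = r \<cdot> p \<and> s \<cdot> k = s \<cdot> q" if pq: "is_pullback C s r p q" for p q
  proof -
    note D = pullbackD[OF pq]
    obtain P a b where P: "is_product C (Cod C r) (Cod C r) P a b"
      by (rule product_exists[of "Cod C r" "Cod C r"]) (use rs in simp_all)
    note PD = productD[OF P]
    obtain m where m: "m \<in> Arr C" "Dom C m = Dom C s" "Cod C m = P" "a \<cdot> m = r" "b \<cdot> m = s"
      by (rule product_lift[OF P rs(1,2)]) (use rs in simp_all)
    have mm: "monic C m"
    proof (rule monicI)
      fix f g assume fg: "f \<in> Arr C" "g \<in> Arr C" "Dom C f = Dom C g" "Cod C f = Dom C m" "Cod C g = Dom C m" "m \<cdot> f = m \<cdot> g"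
      have "a \<cdot> (m \<cdot> f) = a \<cdot> (m \<cdot> g)" "b \<cdot> (m \<cdot> f) = b \<cdot> (m \<cdot> g)" using fg(6) by simp_all
      then have "r \<cdot> f = r \<cdot> g" "s \<cdot> f = s \<cdot> g"
        using Comp_eq_assoc[OF m(4), of f] Comp_eq_assoc[OF m(4), of g]
          Comp_eq_assoc[OF m(5), of f] Comp_eq_assoc[OF m(5), of g] fg(1-5) m PD by simp_all
      then show "f = g" by (intro jm[of f g]) (use fg(1-5) m rs in simp_all)
    qed (use m in simp)
    \<comment> \<open>\<open>m\<close> is the relation as a subobject of the square, and
      \<open>n\<close> takes a composable pair to its outer components; transitivity says that
      \<open>n\<close> factors through \<open>m\<close>.\<close>
    obtain n where n: "n \<in> Arr C" "Dom C n = Dom C p" "Cod C n = P" "a \<cdot> n = r \<cdot> p" "b \<cdot> n = s \<cdot> q"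
      by (rule product_lift[OF P, of "r \<cdot> p" "s \<cdot> q"]) (use rs D in simp_all)
    obtain \<sigma> where \<sigma>: "\<sigma> \<in> Arr C" "Dom C \<sigma> = Dom C r" "Cod C \<sigma> = Dom C p" "p \<cdot> \<sigma> = Id C (Dom C r)" "q \<cdot> \<sigma> = d \<cdot> s"
      by (rule pullback_lift[OF pq, of "Id C (Dom C r)" "d \<cdot> s"])
        (use rs d Comp_eq_assoc[OF d(4), of s] in simp_all)
    have an: "a \<cdot> (n \<cdot> x) = r \<cdot> (p \<cdot> x)" "b \<cdot> (n \<cdot> x) = s \<cdot> (q \<cdot> x)" if "x \<in> Arr C" "Cod C x = Dom C p" for x
      using Comp_eq_assoc[OF n(4), of x] Comp_eq_assoc[OF n(5), of x] that n D rs PD by simp_all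
    have am: "a \<cdot> (m \<cdot> x) = r \<cdot> x" "b \<cdot> (m \<cdot> x) = s \<cdot> x" if "x \<in> Arr C" "Cod C x = Dom C r" for x
      using Comp_eq_assoc[OF m(4), of x] Comp_eq_assoc[OF m(5), of x] that m rs PD by simp_all
    have nP: "Cod C n = Cod C m" using n m by simp
    have "factors_through C (Id C (Dom C p)) (preimage n m)"
    proof (rule point_generated[of p \<sigma> "preimage n m" d])
      have "n \<cdot> \<sigma> = m" 
      proof (rule product_unique[OF P])
        show "a \<cdot> (n \<cdot> \<sigma>) = a \<cdot> m" using an[of \<sigma>] \<sigma> m rs by simp
        show "b \<cdot> (n \<cdot> \<sigma>) = b \<cdot> m" using an[of \<sigma>] \<sigma> m rs d Comp_eq_assoc[OF d(5), of s] by simp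
      qed (use n \<sigma> m rs in simp_all)
      then show "factors_through C \<sigma> (preimage n m)"
        using factors_preimage_iff[OF n(1) mm nP, of \<sigma>] n \<sigma> m by simp
      fix x w assume x: "x \<in> Arr C" "w \<in> Arr C" "Dom C x = Dom C w" "Cod C x = Dom C p" "Cod C w = Dom C d" "p \<cdot> x = d \<cdot> w"
      have "r \<cdot> (p \<cdot> x) = w" unfolding x(6) using Comp_eq_assoc[OF d(4), of w] x(1-5) d rs by simp
      moreover have "s \<cdot> (p \<cdot> x) = w" unfolding x(6) using Comp_eq_assoc[OF d(5), of w] x(1-5) d rs by simp
      moreover have "s \<cdot> (p \<cdot> x) = r \<cdot> (q \<cdot> x)" by (rule Comp_reassoc[OF D(9)]) (use D x in simp_all)
      ultimately have rpx: "r \<cdot> (p \<cdot> x) = r \<cdot> (q \<cdot> x)" by simp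
      have "n \<cdot> x = m \<cdot> (q \<cdot> x)"
      proof (rule product_unique[OF P])
        show "a \<cdot> (n \<cdot> x) = a \<cdot> (m \<cdot> (q \<cdot> x))"
          using an[of x] am[of "q \<cdot> x"] rpx x(1-5) D by simp
        show "b \<cdot> (n \<cdot> x) = b \<cdot> (m \<cdot> (q \<cdot> x))"
          using an[of x] am[of "q \<cdot> x"] x(1-5) D by simp
      qed (use n x(1-5) m D rs in simp_all)
      then have "factors_through C (n \<cdot> x) m"
        by (rule factors_throughI) (use x(1-5) m D rs in simp_all)
      then show "factors_through C x (preimage n m)"
        using factors_preimage_iff[OF n(1) mm nP, of x] n x m by simp
    qed (use D \<sigma> n mm m nP d rs in simp_all)
    then have "factors_through C n m"
      using factors_preimage_iff[OF n(1) mm nP, of "Id C (Dom C p)"] n D by simp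
    then obtain k where k: "k \<in> Arr C" "Dom C k = Dom C n" "Cod C k = Dom C m" "m \<cdot> k = n"
      by (rule factors_throughE)
    then have "r \<cdot> k = r \<cdot> p" "s \<cdot> k = s \<cdot> q" using am[of k] n m rs by simp_all
    with k n m rs show ?thesis by auto
  qed
  then show ?thesis
    unfolding equivalence_relation_def using rs d t jm by (auto simp: hom_set_def)
qed

end

section \<open>Ideally exact categories\<close>

locale ideally_exact_cat =
  fixes C :: "('o, 'a) cat" (structure)
  assumes ideally_exact: "ideally_exact C"

sublocale ideally_exact_cat \<subseteq> protomodular_regular_cat
  using ideally_exact unfolding ideally_exact_def barr_exact_def
  by unfold_locales blast+

context ideally_exact_cat
begin

lemma exact:
  assumes "equivalence_relation C r s"
  obtains q where "is_pullback C q q r s"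
  using ideally_exact assms unfolding ideally_exact_def barr_exact_def by blast

text \<open>Membership of \<open>(y, z)\<close> in the regular image, along \<open>e \<times> e\<close>, of the kernel pair of \<open>f\<close>.\<close>

definition image_related :: "'a \<Rightarrow> 'a \<Rightarrow> 'a \<Rightarrow> 'a \<Rightarrow> bool" where
  "image_related e f y z \<longleftrightarrow> (\<exists>c u v. regular_epi C c \<and> Cod C c = Dom C z \<and> u \<in> Arr C \<and> v \<in> Arr C \<and>
     Dom C u = Dom C c \<and> Dom C v = Dom C c \<and> Cod C u = Dom C e \<and> Cod C v = Dom C e \<and>
     y \<cdot> c = e \<cdot> u \<and> z \<cdot> c = e \<cdot> v \<and> f \<cdot> u = f \<cdot> v)"

text \<open>The image \<open>m\<close> of (e r, e s) in the square of \<open>Cod C e\<close> is the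
  relation that \<open>image_related\<close> describes elementwise. Reflexivity and symmetry pass
  from the kernel pair of \<open>f\<close> to this image, transitivity comes from protomodularity,
  and exactness then presents \<open>m\<close> as a kernel pair.\<close>

lemma quotient_of_image_relation:
  assumes e: "regular_epi C e" and f: "f \<in> Arr C" "Dom C f = Dom C e"
  obtains q where "q \<in> Arr C" "Dom C q = Cod C e"
    "\<And>y z. \<lbrakk>y \<in> Arr C; z \<in> Arr C; Dom C y = Dom C z; Cod C y = Cod C e; Cod C z = Cod C e\<rbrakk> \<Longrightarrow>
       q \<cdot> y = q \<cdot> z \<longleftrightarrow> image_related e f y z"
proof -
  obtain r s where rs: "is_pullback C f f r s" by (rule pullback_exists[OF f(1) f(1) refl])
  note D = pullbackD[OF rs]
  note ea = regular_epi_Arr[OF e]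
  obtain P a b where P: "is_product C (Cod C e) (Cod C e) P a b"
    by (rule product_exists[of "Cod C e" "Cod C e"]) (use e in simp_all)
  note PD = productD[OF P]
  obtain h where h: "h \<in> Arr C" "Dom C h = Dom C (e \<cdot> s)" "Cod C h = P" "a \<cdot> h = e \<cdot> r" "b \<cdot> h = e \<cdot> s"
    by (rule product_lift[OF P, of "e \<cdot> r" "e \<cdot> s"]) (use ea D f in simp_all)
  have hd: "Dom C h = Dom C r" using h(2) ea D f by simp
  obtain k where k: "regular_epi C k" "Dom C k = Dom C h" "Cod C k = Dom C (img h)" "img h \<cdot> k = h"
    by (rule img_factorization[OF h(1)])
  define m where "m = img h"
  have m: "monic C m" "Cod C m = P" using h unfolding m_def by simp_all
  have km: "Cod C k = Dom C m" "m \<cdot> k = h" using k unfolding m_def by simp_all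
  have ah: "a \<cdot> (h \<cdot> x) = e \<cdot> (r \<cdot> x)" "b \<cdot> (h \<cdot> x) = e \<cdot> (s \<cdot> x)" if "x \<in> Arr C" "Cod C x = Dom C r" for x
    using Comp_eq_assoc[OF h(4), of x] Comp_eq_assoc[OF h(5), of x] that h(1,3) hd PD D ea f by simp_all
  have hm: "factors_through C (h \<cdot> x) m" if "x \<in> Arr C" "Cod C x = Dom C r" for x
    unfolding m_def by (rule factors_through_comp[OF factors_img[OF h(1)]]) (use h that hd in simp_all)
  obtain \<delta> where \<delta>: "\<delta> \<in> Arr C" "Dom C \<delta> = Cod C e" "Cod C \<delta> = P" "a \<cdot> \<delta> = Id C (Cod C e)" "b \<cdot> \<delta> = Id C (Cod C e)"
    by (rule product_lift[OF P, of "Id C (Cod C e)" "Id C (Cod C e)"]) (use ea in simp_all)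
  obtain \<delta>' where \<delta>': "\<delta>' \<in> Arr C" "Dom C \<delta>' = Dom C e" "Cod C \<delta>' = Dom C r" "r \<cdot> \<delta>' = Id C (Dom C e)" "s \<cdot> \<delta>' = Id C (Dom C e)"
    by (rule pullback_lift[OF rs, of "Id C (Dom C e)" "Id C (Dom C e)"]) (use ea f in simp_all)
  \<comment> \<open>The diagonal is visibly related only after composition with \<open>e\<close>,
    where it is the value of \<open>h\<close> on the diagonal of the kernel pair; since
    \<open>e\<close> is a cover, it then lies in \<open>m\<close>.\<close>
  have "\<delta> \<cdot> e = h \<cdot> \<delta>'"
  proof (rule product_unique[OF P])
    show "a \<cdot> (\<delta> \<cdot> e) = a \<cdot> (h \<cdot> \<delta>')"
      using Comp_eq_assoc[OF \<delta>(4), of e] ah(1)[of \<delta>'] \<delta> \<delta>' PD ea by simp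
    show "b \<cdot> (\<delta> \<cdot> e) = b \<cdot> (h \<cdot> \<delta>')"
      using Comp_eq_assoc[OF \<delta>(5), of e] ah(2)[of \<delta>'] \<delta> \<delta>' PD ea by simp
  qed (use \<delta> \<delta>' h hd ea in simp_all)
  then have "factors_through C (\<delta> \<cdot> e) m" using hm[of \<delta>'] \<delta>' by simp
  then have "factors_through C \<delta> m"
    by (rule factors_through_descent[OF _ e m(1)]) (use \<delta> m in simp_all)
  then obtain d where d: "d \<in> Arr C" "Dom C d = Dom C \<delta>" "Cod C d = Dom C m" "m \<cdot> d = \<delta>"
    by (rule factors_throughE)
  obtain w where w: "w \<in> Arr C" "Dom C w = Dom C (a \<cdot> m)" "Cod C w = P" "a \<cdot> w = b \<cdot> m" "b \<cdot> w = a \<cdot> m"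
    by (rule product_lift[OF P, of "b \<cdot> m" "a \<cdot> m"]) (use PD m in simp_all)
  have wd: "Dom C w = Dom C m" using w(2) PD m by simp
  obtain \<tau> where \<tau>: "\<tau> \<in> Arr C" "Dom C \<tau> = Dom C r" "Cod C \<tau> = Dom C r" "r \<cdot> \<tau> = s" "s \<cdot> \<tau> = r"
    by (rule pullback_lift[OF rs, of s r]) (use D in simp_all)
  \<comment> \<open>Symmetry by the same device, with the cover \<open>k\<close> of the image:
    exchanging components after \<open>h\<close> amounts to exchanging them in the kernel pair
    before \<open>h\<close>.\<close>
  have "w \<cdot> k = h \<cdot> \<tau>"
  proof (rule product_unique[OF P])
    show "a \<cdot> (w \<cdot> k) = a \<cdot> (h \<cdot> \<tau>)"
      using Comp_eq_assoc[OF w(4), of k] ah(1)[of \<tau>] w(1,3) wd \<tau> PD m km k(1) h(5) by simp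
    show "b \<cdot> (w \<cdot> k) = b \<cdot> (h \<cdot> \<tau>)"
      using Comp_eq_assoc[OF w(5), of k] ah(2)[of \<tau>] w(1,3) wd \<tau> PD m km k(1) h(4) by simp
  qed (use w wd k km \<tau> h(1,3) hd in simp_all)
  then have "factors_through C (w \<cdot> k) m" using hm[of \<tau>] \<tau> by simp
  then have "factors_through C w m"
    by (rule factors_through_descent[OF _ k(1) m(1)]) (use w wd m km in simp_all)
  then obtain t where t: "t \<in> Arr C" "Dom C t = Dom C w" "Cod C t = Dom C m" "m \<cdot> t = w"
    by (rule factors_throughE)
  have "equivalence_relation C (a \<cdot> m) (b \<cdot> m)"
  proof (rule reflexive_symmetric_equivalence[of "a \<cdot> m" "b \<cdot> m" d t])
    fix u v assume uv: "u \<in> Arr C" "v \<in> Arr C" "Dom C u = Dom C v" "Cod C u = Dom C (a \<cdot> m)" "Cod C v = Dom C (a \<cdot> m)"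
      "(a \<cdot> m) \<cdot> u = (a \<cdot> m) \<cdot> v" "(b \<cdot> m) \<cdot> u = (b \<cdot> m) \<cdot> v"
    have "m \<cdot> u = m \<cdot> v" by (rule product_unique[OF P]) (use uv m PD in simp_all)
    then show "u = v" by (rule monicD[OF m(1)]) (use uv(1-5) m PD in simp_all)
  qed (use d t m PD \<delta> w wd in simp_all)
  \<comment> \<open>Here equivalence relations are required to be effective. Nothing is asked of
    \<open>q\<close> itself beyond its kernel pair, so it need not be a regular epimorphism.\<close>
  then obtain q where q: "is_pullback C q q (a \<cdot> m) (b \<cdot> m)" by (rule exact)
  note Q = pullbackD[OF q]
  show ?thesis
  proof (rule that[of q])
    show "q \<in> Arr C" by (rule Q)
    show qd: "Dom C q = Cod C e" using Q m PD by simp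
    fix y z assume yz: "y \<in> Arr C" "z \<in> Arr C" "Dom C y = Dom C z" "Cod C y = Cod C e" "Cod C z = Cod C e"
    obtain x where x: "x \<in> Arr C" "Dom C x = Dom C z" "Cod C x = P" "a \<cdot> x = y" "b \<cdot> x = z"
      by (rule product_lift[OF P yz])
    have "q \<cdot> y = q \<cdot> z \<longleftrightarrow> factors_through C x m"
    proof
      assume eq: "q \<cdot> y = q \<cdot> z"
      obtain l where l: "l \<in> Arr C" "Dom C l = Dom C z" "Cod C l = Dom C (a \<cdot> m)" "(a \<cdot> m) \<cdot> l = y" "(b \<cdot> m) \<cdot> l = z"
        by (rule pullback_lift[OF q _ _ _ _ _ eq]) (use yz qd in simp_all)
      have "m \<cdot> l = x" by (rule product_unique[OF P]) (use l x m PD in simp_all)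
      then show "factors_through C x m"
        by (intro factors_throughI[of _ _ l]) (use l m PD in simp_all)
    next
      assume "factors_through C x m"
      then obtain l where l: "l \<in> Arr C" "Dom C l = Dom C x" "Cod C l = Dom C m" "m \<cdot> l = x"
        by (rule factors_throughE)
      have "q \<cdot> ((a \<cdot> m) \<cdot> l) = q \<cdot> ((b \<cdot> m) \<cdot> l)"
        by (rule Comp_reassoc[OF Q(9)]) (use Q l m PD in simp_all)
      then show "q \<cdot> y = q \<cdot> z" using l m PD x by simp
    qed
    also have "\<dots> \<longleftrightarrow> (\<exists>c p. regular_epi C c \<and> Cod C c = Dom C x \<and> p \<in> Arr C \<and> Dom C p = Dom C c \<and> Cod C p = Dom C h \<and> x \<cdot> c = h \<cdot> p)"
      unfolding m_def by (rule factors_img_iff) (use h x in simp_all)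
    also have "\<dots> \<longleftrightarrow> image_related e f y z"
    proof
      assume "\<exists>c p. regular_epi C c \<and> Cod C c = Dom C x \<and> p \<in> Arr C \<and> Dom C p = Dom C c \<and> Cod C p = Dom C h \<and> x \<cdot> c = h \<cdot> p"
      then obtain c p where c: "regular_epi C c" "Cod C c = Dom C x" "p \<in> Arr C" "Dom C p = Dom C c" "Cod C p = Dom C h" "x \<cdot> c = h \<cdot> p"
        by blast
      have "a \<cdot> (x \<cdot> c) = e \<cdot> (r \<cdot> p)" "b \<cdot> (x \<cdot> c) = e \<cdot> (s \<cdot> p)" unfolding c(6) using ah[of p] c(3,5) hd by simp_all
      then have "y \<cdot> c = e \<cdot> (r \<cdot> p)" "z \<cdot> c = e \<cdot> (s \<cdot> p)"
        using Comp_eq_assoc[OF x(4), of c] Comp_eq_assoc[OF x(5), of c] x(1-3) c(1,2) PD by simp_all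
      moreover have "f \<cdot> (r \<cdot> p) = f \<cdot> (s \<cdot> p)" by (rule Comp_reassoc[OF D(9)]) (use D c hd in simp_all)
      ultimately show "image_related e f y z"
        unfolding image_related_def by (intro exI[of _ c] exI[of _ "r \<cdot> p"] exI[of _ "s \<cdot> p"]) (use c(1-5) hd D x f in simp_all)
    next
      assume "image_related e f y z"
      then obtain c u v where c: "regular_epi C c" "Cod C c = Dom C z" "u \<in> Arr C" "v \<in> Arr C"
         "Dom C u = Dom C c" "Dom C v = Dom C c" "Cod C u = Dom C e" "Cod C v = Dom C e"
         "y \<cdot> c = e \<cdot> u" "z \<cdot> c = e \<cdot> v" "f \<cdot> u = f \<cdot> v" unfolding image_related_def by blast
      obtain p where p: "p \<in> Arr C" "Dom C p = Dom C v" "Cod C p = Dom C r" "r \<cdot> p = u" "s \<cdot> p = v"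
        by (rule pullback_lift[OF rs c(3,4) _ _ _ c(11)]) (use c f in simp_all)
      have "x \<cdot> c = h \<cdot> p"
      proof (rule product_unique[OF P])
        show "a \<cdot> (x \<cdot> c) = a \<cdot> (h \<cdot> p)"
          using Comp_eq_assoc[OF x(4), of c] ah(1)[of p] x(1-3) p c PD by simp
        show "b \<cdot> (x \<cdot> c) = b \<cdot> (h \<cdot> p)"
          using Comp_eq_assoc[OF x(5), of c] ah(2)[of p] x(1-3) p c PD by simp
      qed (use x c p h(1,3) hd in simp_all)
      then show "\<exists>c p. regular_epi C c \<and> Cod C c = Dom C x \<and> p \<in> Arr C \<and> Dom C p = Dom C c \<and> Cod C p = Dom C h \<and> x \<cdot> c = h \<cdot> p"
        by (intro exI[of _ c] exI[of _ p]) (use c p x hd in simp_all)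
    qed
    finally show "q \<cdot> y = q \<cdot> z \<longleftrightarrow> image_related e f y z" .
  qed
qed

text \<open>The join is the image of the arrow \<open>u\<close> out of the coproduct that is induced
  by \<open>m\<close> and \<open>n\<close>: an arrow out of a coproduct factors through the
  monomorphism \<open>k\<close> as soon as both components do.\<close>

lemma join_exists:
  assumes "monic C m" "monic C n" "Cod C m = Cod C n"
  obtains j where "monic C j" "Cod C j = Cod C n" "factors_through C m j" "factors_through C n j"
    "\<And>k. \<lbrakk>monic C k; Cod C k = Cod C n; factors_through C m k; factors_through C n k\<rbrakk> \<Longrightarrow> factors_through C j k"
proof -
  obtain S i i' where S: "is_coproduct C (Dom C m) (Dom C n) S i i'"
    using ideally_exact assms unfolding ideally_exact_def has_finite_coproducts_def by (meson Dom_closed monic_Arr)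
  then have i: "i \<in> Arr C" "i' \<in> Arr C" "Dom C i = Dom C m" "Dom C i' = Dom C n" "Cod C i = S" "Cod C i' = S"
    unfolding is_coproduct_def by simp_all
  have ex1: "\<exists>!h. h \<in> hom_set C S (Cod C v) \<and> h \<cdot> i = u \<and> h \<cdot> i' = v"
    if "u \<in> Arr C" "v \<in> Arr C" "Dom C u = Dom C m" "Dom C v = Dom C n" "Cod C u = Cod C v" for u v
  proof -
    have "u \<in> hom_set C (Dom C m) (Cod C v)" "v \<in> hom_set C (Dom C n) (Cod C v)" "Cod C v \<in> Obj C"
      using that by simp_all
    then show ?thesis using S unfolding is_coproduct_def by blast
  qed
  obtain u where u: "u \<in> Arr C" "Dom C u = S" "Cod C u = Cod C n" "u \<cdot> i = m" "u \<cdot> i' = n"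
    using ex1[of m n] assms by auto
  have um: "factors_through C m u" "factors_through C n u"
    using u i by (auto intro: factors_throughI)
  show ?thesis
  proof (rule that[of "img u"])
    show "factors_through C m (img u)" "factors_through C n (img u)"
      using um factors_img[OF u(1)] img_simps[OF u(1)] by (meson factors_through_trans monic_Arr)+
    fix k assume k: "monic C k" "Cod C k = Cod C n" "factors_through C m k" "factors_through C n k"
    obtain f where f: "f \<in> Arr C" "Dom C f = Dom C m" "Cod C f = Dom C k" "k \<cdot> f = m"
      by (rule factors_throughE[OF k(3)])
    obtain g where g: "g \<in> Arr C" "Dom C g = Dom C n" "Cod C g = Dom C k" "k \<cdot> g = n"
      by (rule factors_throughE[OF k(4)])
    obtain v where v: "v \<in> Arr C" "Dom C v = S" "Cod C v = Dom C k" "v \<cdot> i = f" "v \<cdot> i' = g"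
      using ex1[of f g] f g by auto
    have "k \<cdot> v \<in> hom_set C S (Cod C n) \<and> (k \<cdot> v) \<cdot> i = m \<and> (k \<cdot> v) \<cdot> i' = n"
      using v f g k i by simp
    moreover have "u \<in> hom_set C S (Cod C n) \<and> u \<cdot> i = m \<and> u \<cdot> i' = n" using u by simp
    ultimately have "u = k \<cdot> v" using ex1[of m n] assms by (metis monic_Arr)
    then have "factors_through C u k" by (rule factors_throughI) (use v k in simp_all)
    then show "factors_through C (img u) k" using img_le_iff[of u k] u k by simp
  qed (use u in simp_all)
qed

end


section \<open>Subobjects in a slice\<close>

lemma slice_simps [simp]:
  "a \<in> Obj (slice C B) \<longleftrightarrow> a \<in> Arr C \<and> Cod C a = B"
  "(a, h, b) \<in> Arr (slice C B) \<longleftrightarrow> a \<in> Arr C \<and> Cod C a = B \<and> b \<in> Arr C \<and> Cod C b = B \<and>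
     h \<in> hom_set C (Dom C a) (Dom C b) \<and> b \<cdot>\<^bsub>C\<^esub> h = a"
  "Dom (slice C B) (a, h, b) = a"
  "Cod (slice C B) (a, h, b) = b"
  "Id (slice C B) a = (a, Id C (Dom C a), a)"
  "(b, k, c) \<cdot>\<^bsub>slice C B\<^esub> (a, h, b') = (a, k \<cdot>\<^bsub>C\<^esub> h, c)"
  by (simp_all add: slice_def)

context category
begin

lemma slice_category: "category (slice C B)"
proof
  fix x assume "x \<in> Arr (slice C B)"
  then show "Dom (slice C B) x \<in> Obj (slice C B)" "Cod (slice C B) x \<in> Obj (slice C B)"
    by (cases x; simp)+
next
  fix x f a b assume "f \<in> hom_set (slice C B) a b"
  then show "f \<cdot>\<^bsub>slice C B\<^esub> Id (slice C B) a = f" "Id (slice C B) b \<cdot>\<^bsub>slice C B\<^esub> f = f"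
    by (cases f; simp)+
next
  fix f g a b c assume "f \<in> hom_set (slice C B) a b" "g \<in> hom_set (slice C B) b c"
  then show "g \<cdot>\<^bsub>slice C B\<^esub> f \<in> hom_set (slice C B) a c"
    by (cases f; cases g) (auto simp flip: Comp_assoc_simp)
next
  fix f g h w x y z assume "f \<in> hom_set (slice C B) w x" "g \<in> hom_set (slice C B) x y" "h \<in> hom_set (slice C B) y z"
  then show "h \<cdot>\<^bsub>slice C B\<^esub> g \<cdot>\<^bsub>slice C B\<^esub> f = h \<cdot>\<^bsub>slice C B\<^esub> (g \<cdot>\<^bsub>slice C B\<^esub> f)"
    by (cases f; cases g; cases h) simp
qed simp

text \<open>Two arrows \<open>u\<close>, \<open>v\<close> of C with h u = h v are automatically
  arrows over B with the same domain, since a u = b h u = b h v = a v. They can hence be tested in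
  the slice.\<close>

lemma slice_monic_iff:
  assumes "(a, h, b) \<in> Arr (slice C B)"
  shows "monic (slice C B) (a, h, b) \<longleftrightarrow> monic C h"
proof -
  interpret S: category "slice C B" by (rule slice_category)
  have A: "a \<in> Arr C" "b \<in> Arr C" "Cod C a = B" "Cod C b = B" "h \<in> Arr C" "Dom C h = Dom C a" "Cod C h = Dom C b" "b \<cdot> h = a"
    using assms by simp_all
  show ?thesis
  proof
    assume m: "monic (slice C B) (a, h, b)"
    show "monic C h"
    proof (rule monicI)
      fix u v assume uv: "u \<in> Arr C" "v \<in> Arr C" "Dom C u = Dom C v" "Cod C u = Dom C h" "Cod C v = Dom C h" "h \<cdot> u = h \<cdot> v"
      have "b \<cdot> (h \<cdot> u) = b \<cdot> (h \<cdot> v)" using uv(6) by simp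
      then have av: "a \<cdot> u = a \<cdot> v"
        using Comp_eq_assoc[OF A(8), of u] Comp_eq_assoc[OF A(8), of v] uv(1-5) A(1-7) by simp
      have "(a \<cdot> v, u, a) = (a \<cdot> v, v, a)"
        by (rule S.monicD[OF m]) (use av uv A in simp_all)
      then show "u = v" by simp
    qed (use A in simp)
  next
    assume m: "monic C h"
    show "monic (slice C B) (a, h, b)"
    proof (rule S.monicI)
      fix x y assume xy: "x \<in> Arr (slice C B)" "y \<in> Arr (slice C B)" "Dom (slice C B) x = Dom (slice C B) y"
        "Cod (slice C B) x = Dom (slice C B) (a, h, b)" "Cod (slice C B) y = Dom (slice C B) (a, h, b)"
        "(a, h, b) \<cdot>\<^bsub>slice C B\<^esub> x = (a, h, b) \<cdot>\<^bsub>slice C B\<^esub> y"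
      obtain u v c c' d d' where uv: "x = (c, u, d)" "y = (c', v, d')" by (metis prod_cases3)
      have "u = v" by (rule monicD[OF m]) (use xy uv A in simp_all)
      then show "x = y" using uv xy by simp
    qed (rule assms)
  qed
qed

text \<open>The structure map of the domain is forced to be \<open>b \<cdot> m\<close>, so
  monomorphisms into \<open>b\<close> in the slice amount to monomorphisms into
  \<open>Dom C b\<close> in C.\<close>

lemma slice_monos_into:
  assumes "b \<in> Arr C" "Cod C b = B"
  shows "monos_into (slice C B) b = (\<lambda>m. (b \<cdot> m, m, b)) ` monos_into C (Dom C b)"
proof (intro equalityI subsetI)
  fix x assume "x \<in> monos_into (slice C B) b"
  then have x: "monic (slice C B) x" "Cod (slice C B) x = b" unfolding monos_into_def by blast+
  obtain a m b' where abm: "x = (a, m, b')" by (metis prod_cases3)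
  have am: "(a, m, b) \<in> Arr (slice C B)" "b' = b"
    using category.monic_Arr[OF slice_category x(1)] x(2) unfolding abm by simp_all
  moreover have "monic C m" using slice_monic_iff[OF am(1)] x(1) am(2) unfolding abm by blast
  ultimately show "x \<in> (\<lambda>m. (b \<cdot> m, m, b)) ` monos_into C (Dom C b)"
    unfolding abm by (intro image_eqI[of _ _ m]) (simp_all add: monos_into_def)
next
  fix x assume "x \<in> (\<lambda>m. (b \<cdot> m, m, b)) ` monos_into C (Dom C b)"
  then obtain m where m: "monic C m" "Cod C m = Dom C b" "x = (b \<cdot> m, m, b)" by (auto simp: monos_into_def)
  then show "x \<in> monos_into (slice C B) b"
    using slice_monic_iff[of "b \<cdot> m" m b B] assms by (simp add: monos_into_def)
qed

lemma slice_factors_through_iff: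
  assumes "b \<in> Arr C" "Cod C b = B" "m \<in> Arr C" "n \<in> Arr C" "Cod C m = Dom C b" "Cod C n = Dom C b"
  shows "factors_through (slice C B) (b \<cdot> m, m, b) (b \<cdot> n, n, b) \<longleftrightarrow> factors_through C m n"
proof
  assume "factors_through (slice C B) (b \<cdot> m, m, b) (b \<cdot> n, n, b)"
  then obtain x where x: "x \<in> hom_set (slice C B) (Dom (slice C B) (b \<cdot> m, m, b)) (Dom (slice C B) (b \<cdot> n, n, b))"
    "(b \<cdot> m, m, b) = (b \<cdot> n, n, b) \<cdot>\<^bsub>slice C B\<^esub> x"
    unfolding factors_through_def by blast
  obtain a h c where ahc: "x = (a, h, c)" by (metis prod_cases3)
  have "m = n \<cdot> h" using x(2) unfolding ahc by simp
  then show "factors_through C m n"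
    by (rule factors_throughI) (use x(1) assms in \<open>simp_all add: ahc\<close>)
next
  assume "factors_through C m n"
  then obtain h where h: "h \<in> Arr C" "Dom C h = Dom C m" "Cod C h = Dom C n" "n \<cdot> h = m"
    by (rule factors_throughE)
  have "(b \<cdot> m, h, b \<cdot> n) \<in> hom_set (slice C B) (b \<cdot> m) (b \<cdot> n)"
    using h assms by simp
  moreover have "(b \<cdot> m, m, b) = (b \<cdot> n, n, b) \<cdot>\<^bsub>slice C B\<^esub> (b \<cdot> m, h, b \<cdot> n)"
    using h by simp
  ultimately show "factors_through (slice C B) (b \<cdot> m, m, b) (b \<cdot> n, n, b)"
    unfolding factors_through_def by auto
qed

text \<open>The class of \<open>m\<close> in the slice, written with monomorphisms of C only, so
  that later arguments need not unfold the slice.\<close>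

definition slice_sub :: "'a \<Rightarrow> 'a \<Rightarrow> ('a \<times> 'a \<times> 'a) set" where
  "slice_sub b m = {(b \<cdot> n, n, b) |n. monic C n \<and> Cod C n = Dom C b \<and> factors_through C m n \<and> factors_through C n m}"

lemma slice_subI:
  assumes "monic C n" "Cod C n = Dom C b" "factors_through C m n" "factors_through C n m"
  shows "(b \<cdot> n, n, b) \<in> slice_sub b m"
  unfolding slice_sub_def using assms by blast

lemma slice_sub_self: "monic C m \<Longrightarrow> Cod C m = Dom C b \<Longrightarrow> (b \<cdot> m, m, b) \<in> slice_sub b m"
  by (rule slice_subI) simp_all

lemma slice_sub_eqI:
  assumes "monic C m" "monic C n" "factors_through C m n" "factors_through C n m"
  shows "slice_sub b m = slice_sub b n"
  unfolding slice_sub_def using assms by (auto intro: factors_through_trans monic_Arr)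

lemma slice_sub_equiv_class:
  assumes "b \<in> Arr C" "Cod C b = B" "monic C m" "Cod C m = Dom C b"
  shows "subobject_equiv (slice C B) b `` {(b \<cdot> m, m, b)} = slice_sub b m"
    and "slice_sub b m = (\<lambda>n. (b \<cdot> n, n, b)) ` (subobject_equiv C (Dom C b) `` {m})"
proof -
  show "slice_sub b m = (\<lambda>n. (b \<cdot> n, n, b)) ` (subobject_equiv C (Dom C b) `` {m})"
    using assms by (auto simp: slice_sub_def subobject_equiv_def monos_into_def)
  show "subobject_equiv (slice C B) b `` {(b \<cdot> m, m, b)} = slice_sub b m"
  proof (intro equalityI subsetI)
    fix x assume "x \<in> subobject_equiv (slice C B) b `` {(b \<cdot> m, m, b)}"
    then have x: "x \<in> monos_into (slice C B) b" "factors_through (slice C B) (b \<cdot> m, m, b) x"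
      "factors_through (slice C B) x (b \<cdot> m, m, b)"
      by (auto simp: subobject_equiv_def)
    obtain n where n: "monic C n" "Cod C n = Dom C b" "x = (b \<cdot> n, n, b)"
      using x(1) slice_monos_into[OF assms(1,2)] by (auto simp: monos_into_def)
    then show "x \<in> slice_sub b m"
      using x(2,3) assms slice_factors_through_iff[of b B m n] slice_factors_through_iff[of b B n m]
      by (auto intro!: slice_subI)
  next
    fix x assume "x \<in> slice_sub b m"
    then obtain n where n: "monic C n" "Cod C n = Dom C b" "x = (b \<cdot> n, n, b)"
      "factors_through C m n" "factors_through C n m"
      unfolding slice_sub_def by auto
    have "(b \<cdot> m, m, b) \<in> monos_into (slice C B) b" "x \<in> monos_into (slice C B) b"
      unfolding slice_monos_into[OF assms(1,2)] using n assms by (auto simp: monos_into_def)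
    then show "x \<in> subobject_equiv (slice C B) b `` {(b \<cdot> m, m, b)}"
      using n assms slice_factors_through_iff[of b B m n] slice_factors_through_iff[of b B n m]
      by (simp add: subobject_equiv_def)
  qed
qed

lemma carrier_slice_Sub:
  assumes "b \<in> Arr C" "Cod C b = B"
  shows "carrier (Sub (slice C B) b) = slice_sub b ` {m. monic C m \<and> Cod C m = Dom C b}"
proof -
  have "carrier (Sub (slice C B) b) = (\<lambda>m. subobject_equiv (slice C B) b `` {(b \<cdot> m, m, b)}) ` {m. monic C m \<and> Cod C m = Dom C b}"
    unfolding Sub_def quotient_def slice_monos_into[OF assms] by (auto simp: monos_into_def)
  also have "\<dots> = slice_sub b ` {m. monic C m \<and> Cod C m = Dom C b}"
    using slice_sub_equiv_class(1)[OF assms] by (intro image_cong) auto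
  finally show ?thesis .
qed

text \<open>Presents the subobjects in the slice as an image of those in C. Their number is thereby
  bounded, which is how well-poweredness of C makes the fibres set-sized.\<close>

lemma carrier_slice_Sub_as_image:
  assumes "b \<in> Arr C" "Cod C b = B"
  shows "carrier (Sub (slice C B) b) = image (\<lambda>n. (b \<cdot> n, n, b)) ` carrier (Sub C (Dom C b))"
proof -
  have "carrier (Sub C (Dom C b)) = (\<lambda>m. subobject_equiv C (Dom C b) `` {m}) ` {m. monic C m \<and> Cod C m = Dom C b}"
    by (auto simp: Sub_def quotient_def monos_into_def)
  then show ?thesis
    unfolding carrier_slice_Sub[OF assms] image_image
    using slice_sub_equiv_class(2)[OF assms] by (auto intro!: image_cong)
qed

lemma set_sized_slice_Sub:
  assumes "b \<in> Arr C" "Cod C b = B" "set_sized \<kappa> (carrier (Sub C (Dom C b)))"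
  shows "set_sized \<kappa> (carrier (Sub (slice C B) b))"
  using assms(3) unfolding set_sized_def carrier_slice_Sub_as_image[OF assms(1,2)]
  using card_of_image ordLeq_ordLess_trans by blast

lemma le_slice_Sub:
  assumes "b \<in> Arr C" "Cod C b = B" "monic C m" "monic C n" "Cod C m = Dom C b" "Cod C n = Dom C b"
  shows "slice_sub b m \<sqsubseteq>\<^bsub>Sub (slice C B) b\<^esub> slice_sub b n \<longleftrightarrow> factors_through C m n"
proof
  assume "factors_through C m n"
  then have "factors_through (slice C B) (b \<cdot> m, m, b) (b \<cdot> n, n, b)"
    using slice_factors_through_iff[of b B m n] assms by simp
  then show "slice_sub b m \<sqsubseteq>\<^bsub>Sub (slice C B) b\<^esub> slice_sub b n"
    unfolding Sub_def using slice_sub_self assms by auto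
next
  assume "slice_sub b m \<sqsubseteq>\<^bsub>Sub (slice C B) b\<^esub> slice_sub b n"
  then obtain m' n' where mn: "monic C m'" "monic C n'" "Cod C m' = Dom C b" "Cod C n' = Dom C b"
      "factors_through C m m'" "factors_through C n' n"
      "factors_through (slice C B) (b \<cdot> m', m', b) (b \<cdot> n', n', b)"
    unfolding Sub_def slice_sub_def by auto
  then have "factors_through C m' n'"
    using slice_factors_through_iff[of b B m' n'] assms by simp
  with mn show "factors_through C m n" using assms by (meson factors_through_trans monic_Arr)
qed

text \<open>A cone u, v in C over \<open>g\<close> and \<open>m\<close> has a definite structure map
  to B, namely a u = b m v, so cones in C and cones in the slice correspond.\<close>

lemma slice_pullback_iff:
  assumes "a \<in> Arr C" "b \<in> Arr C" "Cod C a = B" "Cod C b = B" "g \<in> Arr C" "Dom C g = Dom C a" "Cod C g = Dom C b" "b \<cdot> g = a"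
    and "m \<in> Arr C" "n \<in> Arr C" "Cod C m = Dom C b" "Cod C n = Dom C a"
  shows "is_pullback (slice C B) (a, g, b) (b \<cdot> m, m, b) (a \<cdot> n, n, a) x \<longleftrightarrow>
    (\<exists>h. x = (a \<cdot> n, h, b \<cdot> m) \<and> is_pullback C g m n h)"
proof -
  interpret S: category "slice C B" by (rule slice_category)
  have bgx: "b \<cdot> (g \<cdot> x) = a \<cdot> x" if "x \<in> Arr C" "Cod C x = Dom C a" for x
    using Comp_eq_assoc[OF assms(8), of x] that assms by simp
  show ?thesis
  proof (intro iffI; (elim exE conjE)?)
    assume p: "is_pullback (slice C B) (a, g, b) (b \<cdot> m, m, b) (a \<cdot> n, n, a) x"
    note D = S.pullbackD[OF p]
    obtain c h d where x: "x = (c, h, d)" by (metis prod_cases3)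
    have x': "x = (a \<cdot> n, h, b \<cdot> m)" "h \<in> Arr C" "Dom C h = Dom C n" "Cod C h = Dom C m" "g \<cdot> n = m \<cdot> h"
      using D assms by (simp_all add: x)
    have "is_pullback C g m n h"
    proof (rule pullbackI)
      fix u v assume uv: "u \<in> Arr C" "v \<in> Arr C" "Dom C u = Dom C v" "Cod C u = Dom C g" "Cod C v = Dom C m" "g \<cdot> u = m \<cdot> v"
      have bu: "b \<cdot> (m \<cdot> v) = a \<cdot> u" using bgx[of u] uv assms by simp
      obtain y where y: "y \<in> Arr (slice C B)" "Dom (slice C B) y = a \<cdot> u" "Cod (slice C B) y = a \<cdot> n"
        "(a \<cdot> n, n, a) \<cdot>\<^bsub>slice C B\<^esub> y = (a \<cdot> u, u, a)" "x \<cdot>\<^bsub>slice C B\<^esub> y = (a \<cdot> u, v, b \<cdot> m)"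
        by (rule S.pullback_lift[OF p, of "(a \<cdot> u, u, a)" "(a \<cdot> u, v, b \<cdot> m)"])
          (use uv assms bu in simp_all)
      obtain c' k d' where "y = (c', k, d')" by (metis prod_cases3)
      with y show "\<exists>k. k \<in> Arr C \<and> Dom C k = Dom C v \<and> Cod C k = Dom C n \<and> n \<cdot> k = u \<and> h \<cdot> k = v"
        using uv assms x' by (intro exI[of _ k]) simp
    next
      fix k l assume kl: "k \<in> Arr C" "l \<in> Arr C" "Dom C k = Dom C l" "Cod C k = Dom C n" "Cod C l = Dom C n"
        "n \<cdot> k = n \<cdot> l" "h \<cdot> k = h \<cdot> l"
      have "(a \<cdot> (n \<cdot> l), k, a \<cdot> n) = (a \<cdot> (n \<cdot> l), l, a \<cdot> n)"
        by (rule S.pullback_unique[OF p]) (use kl assms x' in simp_all)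
      then show "k = l" by simp
    qed (use x' assms in simp_all)
    with x' show "\<exists>h. x = (a \<cdot> n, h, b \<cdot> m) \<and> is_pullback C g m n h" by blast
  next
    fix h assume x: "x = (a \<cdot> n, h, b \<cdot> m)" and p: "is_pullback C g m n h"
    note D = pullbackD[OF p]
    have bm: "b \<cdot> (m \<cdot> h) = a \<cdot> n" using bgx[of n] D assms by simp
    show "is_pullback (slice C B) (a, g, b) (b \<cdot> m, m, b) (a \<cdot> n, n, a) x"
    proof (rule S.pullbackI)
      fix u v assume uv: "u \<in> Arr (slice C B)" "v \<in> Arr (slice C B)" "Dom (slice C B) u = Dom (slice C B) v"
        "Cod (slice C B) u = Dom (slice C B) (a, g, b)" "Cod (slice C B) v = Dom (slice C B) (b \<cdot> m, m, b)"
        "(a, g, b) \<cdot>\<^bsub>slice C B\<^esub> u = (b \<cdot> m, m, b) \<cdot>\<^bsub>slice C B\<^esub> v"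
      obtain c u' d where u': "u = (c, u', d)" by (metis prod_cases3)
      obtain c' v' d' where v': "v = (c', v', d')" by (metis prod_cases3)
      have e: "d = a" "d' = b \<cdot> m" "c' = c" using uv u' v' by simp_all
      have U: "u' \<in> Arr C" "v' \<in> Arr C" "Dom C u' = Dom C c" "Dom C v' = Dom C c" "Cod C u' = Dom C a" "Cod C v' = Dom C m"
        "a \<cdot> u' = c" "c \<in> Arr C" "Cod C c = B" "g \<cdot> u' = m \<cdot> v'"
        using uv u' v' e assms by simp_all
      obtain k where k: "k \<in> Arr C" "Dom C k = Dom C v'" "Cod C k = Dom C n" "n \<cdot> k = u'" "h \<cdot> k = v'"
        by (rule pullback_lift[OF p _ _ _ _ _ U(10)]) (use U assms in simp_all)
      show "\<exists>y. y \<in> Arr (slice C B) \<and> Dom (slice C B) y = Dom (slice C B) v \<and> Cod (slice C B) y = Dom (slice C B) (a \<cdot> n, n, a) \<and>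
        (a \<cdot> n, n, a) \<cdot>\<^bsub>slice C B\<^esub> y = u \<and> x \<cdot>\<^bsub>slice C B\<^esub> y = v"
        by (rule exI[of _ "(c, k, a \<cdot> n)"]) (use k U(1-9) assms in \<open>simp add: u' v' e x\<close>)
    next
      fix u v assume uv: "u \<in> Arr (slice C B)" "v \<in> Arr (slice C B)" "Dom (slice C B) u = Dom (slice C B) v"
        "Cod (slice C B) u = Dom (slice C B) (a \<cdot> n, n, a)" "Cod (slice C B) v = Dom (slice C B) (a \<cdot> n, n, a)"
        "(a \<cdot> n, n, a) \<cdot>\<^bsub>slice C B\<^esub> u = (a \<cdot> n, n, a) \<cdot>\<^bsub>slice C B\<^esub> v" "x \<cdot>\<^bsub>slice C B\<^esub> u = x \<cdot>\<^bsub>slice C B\<^esub> v"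
      obtain c u' d where u': "u = (c, u', d)" by (metis prod_cases3)
      obtain c' v' d' where v': "v = (c', v', d')" by (metis prod_cases3)
      have "u' = v'" by (rule pullback_unique[OF p]) (use uv u' v' x assms D in simp_all)
      then show "u = v" using uv u' v' by simp
    qed (use assms D bm in \<open>simp_all add: x\<close>)
  qed
qed

text \<open>For monomorphisms the membership criterion determines the pullback. This is used to see
  that every representative of an inverse image, not only the chosen one, is a pullback.\<close>

lemma pullback_of_factors:
  assumes "g \<in> Arr C" "monic C m" "monic C n" "Cod C m = Cod C g" "Cod C n = Dom C g"
    and iff: "\<And>x. \<lbrakk>x \<in> Arr C; Cod C x = Dom C g\<rbrakk> \<Longrightarrow> factors_through C x n \<longleftrightarrow> factors_through C (g \<cdot> x) m"
  obtains h where "is_pullback C g m n h"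
proof -
  have "factors_through C (g \<cdot> n) m" using iff[of n] assms by simp
  then obtain h where h: "h \<in> Arr C" "Dom C h = Dom C (g \<cdot> n)" "Cod C h = Dom C m" "m \<cdot> h = g \<cdot> n"
    by (rule factors_throughE)
  have "is_pullback C g m n h"
  proof (rule pullbackI)
    fix u v assume uv: "u \<in> Arr C" "v \<in> Arr C" "Dom C u = Dom C v" "Cod C u = Dom C g" "Cod C v = Dom C m" "g \<cdot> u = m \<cdot> v"
    have "factors_through C (g \<cdot> u) m" by (rule factors_throughI[OF uv(6)]) (use uv assms in simp_all)
    then have "factors_through C u n" using iff[of u] uv by simp
    then obtain k where k: "k \<in> Arr C" "Dom C k = Dom C u" "Cod C k = Dom C n" "n \<cdot> k = u"
      by (rule factors_throughE)
    have "m \<cdot> (h \<cdot> k) = (g \<cdot> n) \<cdot> k" by (rule Comp_eq_assoc[OF h(4)]) (use h k assms in simp_all)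
    also have "\<dots> = m \<cdot> v" using k uv(6) assms by simp
    finally have "h \<cdot> k = v" by (rule monicD[OF assms(2)]) (use h k uv assms in simp_all)
    with k uv show "\<exists>k. k \<in> Arr C \<and> Dom C k = Dom C v \<and> Cod C k = Dom C n \<and> n \<cdot> k = u \<and> h \<cdot> k = v"
      by (intro exI[of _ k]) simp
  next
    fix k l assume "k \<in> Arr C" "l \<in> Arr C" "Dom C k = Dom C l" "Cod C k = Dom C n" "Cod C l = Dom C n"
       "n \<cdot> k = n \<cdot> l"
    then show "k = l" using monicD[OF assms(3), of k l] by simp
  qed (use h assms in simp_all)
  then show ?thesis by (rule that)
qed

end

section \<open>Regular epimorphisms and transports in the slice\<close>

context regular_cat
begin

text \<open>The forgetful functor from the slice preserves coequalizers because it has a right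
  adjoint, W \<mapsto> (B \<times> W \<rightarrow> B); the adjunction is carried out by hand on test
  arrows. Conversely, a pair coequalized by \<open>h\<close> lifts to the slice.\<close>

lemma slice_regular_epi_iff:
  assumes "(a, h, b) \<in> Arr (slice C B)"
  shows "regular_epi (slice C B) (a, h, b) \<longleftrightarrow> regular_epi C h"
proof -
  interpret S: category "slice C B" by (rule slice_category)
  have A: "a \<in> Arr C" "b \<in> Arr C" "Cod C a = B" "Cod C b = B" "h \<in> Arr C" "Dom C h = Dom C a" "Cod C h = Dom C b" "b \<cdot> h = a"
    using assms by simp_all
  have B: "B \<in> Obj C" using Cod_closed[OF A(1)] unfolding A(3) .
  show ?thesis
  proof
    assume "regular_epi (slice C B) (a, h, b)"
    then obtain x y where xy: "is_coequalizer (slice C B) x y (a, h, b)" unfolding regular_epi_def by blast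
    note D = S.coequalizerD[OF xy]
    obtain c f d where x: "x = (c, f, d)" by (metis prod_cases3)
    obtain c' g d' where y: "y = (c', g, d')" by (metis prod_cases3)
    have xy': "x = (c, f, a)" "y = (c, g, a)" using D x y by simp_all
    have X: "f \<in> Arr C" "g \<in> Arr C" "Dom C f = Dom C c" "Dom C g = Dom C c" "Cod C f = Dom C a" "Cod C g = Dom C a"
      "a \<cdot> f = c" "a \<cdot> g = c" "h \<cdot> f = h \<cdot> g" "c \<in> Arr C"
      using D xy' by simp_all
    have "is_coequalizer C f g h"
    proof (rule coequalizerI)
      show "epic C h"
        unfolding epic_def
      proof (intro conjI ballI impI)
        fix W u v assume W: "W \<in> Obj C" "u \<in> hom_set C (Cod C h) W" "v \<in> hom_set C (Cod C h) W" "u \<cdot> h = v \<cdot> h"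
        \<comment> \<open>A test object W of C is replaced by the projection B \<times> W
          \<rightarrow> B, and a test arrow u by (b, u), which is an arrow over B.\<close>
        obtain P p q where P: "is_product C B W P p q" by (rule product_exists[OF B W(1)])
        note PD = productD[OF P]
        obtain u' where u': "u' \<in> Arr C" "Dom C u' = Dom C u" "Cod C u' = P" "p \<cdot> u' = b" "q \<cdot> u' = u"
          by (rule product_lift[OF P, of b u]) (use A W in simp_all)
        obtain v' where v': "v' \<in> Arr C" "Dom C v' = Dom C v" "Cod C v' = P" "p \<cdot> v' = b" "q \<cdot> v' = v"
          by (rule product_lift[OF P, of b v]) (use A W in simp_all)
        have "u' \<cdot> h = v' \<cdot> h"
        proof (rule product_unique[OF P])
          show "p \<cdot> (u' \<cdot> h) = p \<cdot> (v' \<cdot> h)"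
            using Comp_eq_assoc[OF u'(4), of h] Comp_eq_assoc[OF v'(4), of h] u'(1-3) v'(1-3) PD A W by simp
          show "q \<cdot> (u' \<cdot> h) = q \<cdot> (v' \<cdot> h)"
            using Comp_eq_assoc[OF u'(5), of h] Comp_eq_assoc[OF v'(5), of h] u'(1-3) v'(1-3) PD A W by simp
        qed (use u' v' A W in simp_all)
        then have "(b, u', p) = (b, v', p)"
          by (intro S.epicD[OF S.coequalizer_epic[OF xy], of "(b, u', p)" "(b, v', p)"]) (use u' v' A PD W in simp_all)
        then show "u = v" using u' v' by simp
      qed (rule A)
      fix u assume u: "u \<in> Arr C" "Dom C u = Cod C f" "u \<cdot> f = u \<cdot> g"
      obtain P p q where P: "is_product C B (Cod C u) P p q" by (rule product_exists[OF B Cod_closed[OF u(1)]])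
      note PD = productD[OF P]
      obtain v where v: "v \<in> Arr C" "Dom C v = Dom C u" "Cod C v = P" "p \<cdot> v = a" "q \<cdot> v = u"
        by (rule product_lift[OF P, of a u]) (use A u X in simp_all)
      have "v \<cdot> f = v \<cdot> g"
      proof (rule product_unique[OF P])
        show "p \<cdot> (v \<cdot> f) = p \<cdot> (v \<cdot> g)"
          using Comp_eq_assoc[OF v(4), of f] Comp_eq_assoc[OF v(4), of g] v(1-3) PD A X u(1,2) by simp
        show "q \<cdot> (v \<cdot> f) = q \<cdot> (v \<cdot> g)"
          using Comp_eq_assoc[OF v(5), of f] Comp_eq_assoc[OF v(5), of g] v(1-3) PD A X u by simp
      qed (use v X u in simp_all)
      then have "(a, v, p) \<cdot>\<^bsub>slice C B\<^esub> x = (a, v, p) \<cdot>\<^bsub>slice C B\<^esub> y" by (simp add: xy')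
      moreover have "(a, v, p) \<in> Arr (slice C B)" using v A PD u X by simp
      ultimately obtain z where z: "z \<in> Arr (slice C B)" "Dom (slice C B) z = b" "Cod (slice C B) z = p" "z \<cdot>\<^bsub>slice C B\<^esub> (a, h, b) = (a, v, p)"
        using S.coequalizer_lift[OF xy, of "(a, v, p)"] by (auto simp: xy')
      obtain c k d where "z = (c, k, d)" by (metis prod_cases3)
      then have k: "k \<in> Arr C" "Dom C k = Dom C b" "Cod C k = P" "k \<cdot> h = v" using z PD by simp_all
      then show "\<exists>k. k \<in> Arr C \<and> Dom C k = Cod C h \<and> Cod C k = Cod C u \<and> k \<cdot> h = u"
        by (intro exI[of _ "q \<cdot> k"]) (use v PD A in simp)
    qed (use X A in simp_all)
    then show "regular_epi C h" unfolding regular_epi_def by blast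
  next
    assume r: "regular_epi C h"
    then obtain f g where fg: "is_coequalizer C f g h" unfolding regular_epi_def by blast
    note D = coequalizerD[OF fg]
    note ep = coequalizer_epic[OF fg]
    have "b \<cdot> (h \<cdot> f) = b \<cdot> (h \<cdot> g)" using D by simp
    \<comment> \<open>Both arrows of the pair have the same structure map, so they form a parallel
      pair of the slice.\<close>
    then have af: "a \<cdot> f = a \<cdot> g"
      using Comp_eq_assoc[OF A(8), of f] Comp_eq_assoc[OF A(8), of g] D(1-6) A by simp
    have "is_coequalizer (slice C B) (a \<cdot> f, f, a) (a \<cdot> f, g, a) (a, h, b)"
    proof (rule S.coequalizerI)
      show "epic (slice C B) (a, h, b)"
        unfolding epic_def
      proof (intro conjI ballI impI)
        fix w u v assume uv: "u \<in> hom_set (slice C B) (Cod (slice C B) (a, h, b)) w" "v \<in> hom_set (slice C B) (Cod (slice C B) (a, h, b)) w"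
          "u \<cdot>\<^bsub>slice C B\<^esub> (a, h, b) = v \<cdot>\<^bsub>slice C B\<^esub> (a, h, b)"
        obtain c u' d where u': "u = (c, u', d)" by (metis prod_cases3)
        obtain c' v' d' where v': "v = (c', v', d')" by (metis prod_cases3)
        have "u' = v'" by (rule epicD[OF ep]) (use uv u' v' A in simp_all)
        then show "u = v" using uv u' v' by simp
      qed (rule assms)
      fix u assume u: "u \<in> Arr (slice C B)" "Dom (slice C B) u = Cod (slice C B) (a \<cdot> f, f, a)"
        "u \<cdot>\<^bsub>slice C B\<^esub> (a \<cdot> f, f, a) = u \<cdot>\<^bsub>slice C B\<^esub> (a \<cdot> f, g, a)"
      obtain c u' d where u': "u = (c, u', d)" by (metis prod_cases3)
      have U: "u' \<in> Arr C" "Dom C u' = Dom C a" "Cod C u' = Dom C d" "d \<cdot> u' = a" "d \<in> Arr C" "Cod C d = B" "c = a" "u' \<cdot> f = u' \<cdot> g"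
        using u u' by simp_all
      obtain k where k: "k \<in> Arr C" "Dom C k = Cod C h" "Cod C k = Cod C u'" "k \<cdot> h = u'"
        by (rule coequalizer_lift[OF fg U(1) _ U(8)]) (use U A D in simp_all)
      have dk: "d \<cdot> k = b"
        by (rule epicD[OF ep]) (use k U A in simp_all)
      show "\<exists>z. z \<in> Arr (slice C B) \<and> Dom (slice C B) z = Cod (slice C B) (a, h, b) \<and> Cod (slice C B) z = Cod (slice C B) u \<and> z \<cdot>\<^bsub>slice C B\<^esub> (a, h, b) = u"
        by (rule exI[of _ "(b, k, d)"]) (use k U A dk u' in simp)
    qed (use D A af in simp_all)
    then show "regular_epi (slice C B) (a, h, b)" unfolding regular_epi_def by blast
  qed
qed

text \<open>Factorizations are unique up to isomorphism: the monomorphic part of any factorization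
  of a composite of \<open>g\<close> with a representative is equivalent to \<open>k\<close>.
  Conversely, if \<open>n\<close> is equivalent to \<open>k\<close>, the comparison \<open>l\<close>
  is invertible and \<open>l \<cdot> e\<close> is the regular epimorphic part belonging to
  \<open>n\<close>.\<close>

lemma sub_direct_image_slice:
  assumes a: "a \<in> Arr C" "b \<in> Arr C" "Cod C a = B" "Cod C b = B" "g \<in> Arr C" "Dom C g = Dom C a" "Cod C g = Dom C b" "b \<cdot> g = a"
    and m: "monic C m" "Cod C m = Dom C a"
  shows "sub_direct_image (slice C B) (a, g, b) (slice_sub a m) = slice_sub b (img (g \<cdot> m))"
proof -
  have bgx: "b \<cdot> (g \<cdot> x) = a \<cdot> x" if "x \<in> Arr C" "Cod C x = Dom C a" for x
    using Comp_eq_assoc[OF a(8), of x] that a by simp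
  have gm: "g \<cdot> m \<in> Arr C" "Cod C (g \<cdot> m) = Dom C b" "Dom C (g \<cdot> m) = Dom C m" using a m by simp_all
  obtain e where e: "regular_epi C e" "Dom C e = Dom C (g \<cdot> m)" "Cod C e = Dom C (img (g \<cdot> m))" "img (g \<cdot> m) \<cdot> e = g \<cdot> m"
    by (rule img_factorization[OF gm(1)])
  define k where "k = img (g \<cdot> m)"
  have k: "monic C k" "Cod C k = Dom C b" "Cod C e = Dom C k" "k \<cdot> e = g \<cdot> m" "Dom C e = Dom C m"
    unfolding k_def using gm e by simp_all
  have kle: "factors_through C k n \<longleftrightarrow> factors_through C (g \<cdot> m) n" if "monic C n" "Cod C n = Dom C b" for n
    unfolding k_def by (rule img_le_iff) (use gm that in simp_all)
  show ?thesis
    unfolding k_def[symmetric]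
  proof (intro equalityI subsetI)
    fix x assume "x \<in> sub_direct_image (slice C B) (a, g, b) (slice_sub a m)"
    then obtain y z where x: "x \<in> monos_into (slice C B) b" and y: "y \<in> slice_sub a m"
      and z: "z \<in> hom_set (slice C B) (Dom (slice C B) y) (Dom (slice C B) x)" "regular_epi (slice C B) z"
        "(a, g, b) \<cdot>\<^bsub>slice C B\<^esub> y = x \<cdot>\<^bsub>slice C B\<^esub> z"
      unfolding sub_direct_image_def by auto
    obtain n where n: "monic C n" "Cod C n = Dom C b" "x = (b \<cdot> n, n, b)"
      using x slice_monos_into[OF a(2,4)] by (auto simp: monos_into_def)
    obtain m' where m': "monic C m'" "Cod C m' = Dom C a" "y = (a \<cdot> m', m', a)" "factors_through C m m'" "factors_through C m' m"
      using y unfolding slice_sub_def by auto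
    obtain c e' d where z': "z = (c, e', d)" by (metis prod_cases3)
    have arr: "(c, e', d) \<in> Arr (slice C B)" using z(1) unfolding z' hom_set_def by blast
    have "regular_epi C e'" using slice_regular_epi_iff[OF arr] z(2) unfolding z' by blast
    moreover have "Dom C e' = Dom C m'" "Cod C e' = Dom C n" "g \<cdot> m' = n \<cdot> e'"
      using z z' n m' a by simp_all
    ultimately have e': "regular_epi C e'" "e' \<in> Arr C" "Dom C e' = Dom C m'" "Cod C e' = Dom C n" "g \<cdot> m' = n \<cdot> e'"
      by simp_all
    have "factors_through C (g \<cdot> m) (g \<cdot> m')" "factors_through C (g \<cdot> m') (g \<cdot> m)"
      by (rule factors_through_postcomp; use m m' a in simp)+
    moreover have "factors_through C (g \<cdot> m') n" by (rule factors_throughI[OF e'(5)]) (use e' n in simp_all)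
    ultimately have "factors_through C (g \<cdot> m) n" using n by (meson factors_through_trans monic_Arr)
    then have kn: "factors_through C k n" using kle n by simp
    have "factors_through C (g \<cdot> m) k" by (rule factors_throughI[OF k(4)[symmetric]]) (use e k in simp_all)
    then have "factors_through C (n \<cdot> e') k" using \<open>factors_through C (g \<cdot> m') (g \<cdot> m)\<close> k e'(5)
      by (metis factors_through_trans monic_Arr)
    then have "factors_through C n k"
      by (rule factors_through_descent[OF _ e'(1)]) (use e' n k in simp_all)
    with kn n show "x \<in> slice_sub b k" by (auto intro: slice_subI)
  next
    fix x assume "x \<in> slice_sub b k"
    then obtain n where n: "monic C n" "Cod C n = Dom C b" "x = (b \<cdot> n, n, b)" "factors_through C k n" "factors_through C n k"
      unfolding slice_sub_def by auto
    obtain l where l: "l \<in> Arr C" "Dom C l = Dom C k" "Cod C l = Dom C n" "n \<cdot> l = k"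
      by (rule factors_throughE[OF n(4)])
    obtain l' where l': "l' \<in> Arr C" "Dom C l' = Dom C n" "Cod C l' = Dom C k" "k \<cdot> l' = n"
      by (rule factors_throughE[OF n(5)])
    have nll: "n \<cdot> (l \<cdot> l') = n \<cdot> Id C (Dom C n)" using Comp_eq_assoc[OF l(4), of l'] l' l n k by simp
    have "l \<cdot> l' = Id C (Dom C n)" by (rule monicD[OF n(1) nll]) (use l l' n in simp_all)
    moreover have "monic C l" by (rule monic_factor[of n l]) (use l n k in simp_all)
    ultimately have "is_iso C l" by (intro monic_split_epi_is_iso[of l l']) (use l l' in simp_all)
    then have le: "regular_epi C (l \<cdot> e)" by (intro iso_comp_regular_epi) (use e l k in simp_all)
    have "n \<cdot> (l \<cdot> e) = k \<cdot> e" by (rule Comp_eq_assoc[OF l(4)]) (use l n e k in simp_all)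
    then have nle: "n \<cdot> (l \<cdot> e) = g \<cdot> m" using k by simp
    have arr: "(a \<cdot> m, l \<cdot> e, b \<cdot> n) \<in> Arr (slice C B)"
      using nle bgx[of m] l e k n m a by simp
    show "x \<in> sub_direct_image (slice C B) (a, g, b) (slice_sub a m)"
      unfolding sub_direct_image_def
    proof (rule CollectI, intro conjI bexI)
      show "x \<in> monos_into (slice C B) (Cod (slice C B) (a, g, b))"
        using n slice_monos_into[OF a(2,4)] by (simp add: monos_into_def)
      show "(a \<cdot> m, m, a) \<in> slice_sub a m" by (rule slice_sub_self) (use m in simp_all)
      show "(a \<cdot> m, l \<cdot> e, b \<cdot> n) \<in> hom_set (slice C B) (Dom (slice C B) (a \<cdot> m, m, a)) (Dom (slice C B) x)"
        using arr n by simp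
      show "regular_epi (slice C B) (a \<cdot> m, l \<cdot> e, b \<cdot> n)" using slice_regular_epi_iff[OF arr] le by simp
      show "(a, g, b) \<cdot>\<^bsub>slice C B\<^esub> (a \<cdot> m, m, a) = x \<cdot>\<^bsub>slice C B\<^esub> (a \<cdot> m, l \<cdot> e, b \<cdot> n)"
        using nle n by simp
    qed
  qed
qed

text \<open>A monomorphism is a pullback of a representative exactly when it has the same members as
  \<open>k\<close>, and equivalent monomorphisms have the same members.\<close>

lemma sub_inverse_image_slice:
  assumes a: "a \<in> Arr C" "b \<in> Arr C" "Cod C a = B" "Cod C b = B" "g \<in> Arr C" "Dom C g = Dom C a" "Cod C g = Dom C b" "b \<cdot> g = a"
    and m: "monic C m" "Cod C m = Dom C b"
  shows "sub_inverse_image (slice C B) (a, g, b) (slice_sub b m) = slice_sub a (preimage g m)"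
proof -
  define k where "k = preimage g m"
  have k: "monic C k" "Cod C k = Dom C a" unfolding k_def using a m by simp_all
  have kiff: "factors_through C x k \<longleftrightarrow> factors_through C (g \<cdot> x) m" if "x \<in> Arr C" "Cod C x = Dom C g" for x
    unfolding k_def by (rule factors_preimage_iff) (use a m that in simp_all)
  show ?thesis
    unfolding k_def[symmetric]
  proof (intro equalityI subsetI)
    fix x assume "x \<in> sub_inverse_image (slice C B) (a, g, b) (slice_sub b m)"
    then obtain y z where x: "x \<in> monos_into (slice C B) a" and y: "y \<in> slice_sub b m"
      and z: "is_pullback (slice C B) (a, g, b) y x z"
      unfolding sub_inverse_image_def by auto
    obtain n where n: "monic C n" "Cod C n = Dom C a" "x = (a \<cdot> n, n, a)"
      using x slice_monos_into[OF a(1,3)] by (auto simp: monos_into_def)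
    obtain m' where m': "monic C m'" "Cod C m' = Dom C b" "y = (b \<cdot> m', m', b)" "factors_through C m m'" "factors_through C m' m"
      using y unfolding slice_sub_def by auto
    obtain h where h: "is_pullback C g m' n h"
      using slice_pullback_iff[OF a, of m' n z] z n m' by auto
    have eq: "factors_through C t n \<longleftrightarrow> factors_through C t k" if "t \<in> Arr C" "Cod C t = Dom C g" for t
      using pullback_factors_iff[OF h that] kiff[OF that] m m' by (meson factors_through_trans monic_Arr)
    show "x \<in> slice_sub a k"
      unfolding n(3) by (rule slice_subI) (use n k eq[of n] eq[of k] a in simp_all)
  next
    fix x assume "x \<in> slice_sub a k"
    then obtain n where n: "monic C n" "Cod C n = Dom C a" "x = (a \<cdot> n, n, a)" "factors_through C k n" "factors_through C n k"
      unfolding slice_sub_def by auto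
    obtain h where h: "is_pullback C g m n h"
    proof (rule pullback_of_factors[OF a(5) m(1) n(1)])
      show "factors_through C t n \<longleftrightarrow> factors_through C (g \<cdot> t) m" if "t \<in> Arr C" "Cod C t = Dom C g" for t
        using kiff[OF that] n k by (meson factors_through_trans monic_Arr)
    qed (use a m n in simp_all)
    show "x \<in> sub_inverse_image (slice C B) (a, g, b) (slice_sub b m)"
      unfolding sub_inverse_image_def
    proof (rule CollectI, intro conjI bexI exI)
      show "x \<in> monos_into (slice C B) (Dom (slice C B) (a, g, b))"
        using n slice_monos_into[OF a(1,3)] by (simp add: monos_into_def)
      show "(b \<cdot> m, m, b) \<in> slice_sub b m" by (rule slice_sub_self) (use m in simp_all)
      show "is_pullback (slice C B) (a, g, b) (b \<cdot> m, m, b) x (a \<cdot> n, h, b \<cdot> m)"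
        unfolding n(3) using slice_pullback_iff[OF a, of m n] h m n by simp
    qed
  qed
qed

end


section \<open>The canonical form\<close>

context ideally_exact_cat
begin

text \<open>The arrow 0 \<rightarrow> X factors through every monomorphism into X, but it need not
  be monic; its image is the least subobject.\<close>

lemma least_subobject_exists:
  assumes "X \<in> Obj C"
  obtains n where "monic C n" "Cod C n = X" "\<And>m. \<lbrakk>monic C m; Cod C m = X\<rbrakk> \<Longrightarrow> factors_through C n m"
proof -
  obtain Z where Z: "is_initial C Z"
    using ideally_exact unfolding ideally_exact_def has_finite_coproducts_def by blast
  have arrow: "\<exists>i. i \<in> Arr C \<and> Dom C i = Z \<and> Cod C i = Y" if "Y \<in> Obj C" for Y
  proof -
    have "\<exists>!i. i \<in> hom_set C Z Y" using Z that unfolding is_initial_def by blast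
    then show ?thesis by auto
  qed
  obtain i where i: "i \<in> Arr C" "Dom C i = Z" "Cod C i = X" using arrow[OF assms] by blast
  show ?thesis
  proof (rule that[of "img i"])
    fix m assume m: "monic C m" "Cod C m = X"
    obtain k where k: "k \<in> Arr C" "Dom C k = Z" "Cod C k = Dom C m" using arrow[of "Dom C m"] m by auto
    have "i = m \<cdot> k" by (rule initial_unique[OF Z]) (use i k m in simp_all)
    then have "factors_through C i m" by (rule factors_throughI) (use k m in simp_all)
    then show "factors_through C (img i) m" using img_le_iff[of i m] i m by simp
  qed (use i in simp_all)
qed

lemma slice_Sub_bounded_lattice:
  assumes b: "b \<in> Arr C" "Cod C b = B"
  shows "bounded_lattice (Sub (slice C B) b)"
proof -
  define L where "L = Sub (slice C B) b"
  have eq: "x .=\<^bsub>L\<^esub> y \<longleftrightarrow> x = y" for x y by (simp add: L_def Sub_def)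
  have carE: "\<exists>m. monic C m \<and> Cod C m = Dom C b \<and> x = slice_sub b m" if "x \<in> carrier L" for x
    using that unfolding L_def carrier_slice_Sub[OF b] by auto
  have car: "slice_sub b m \<in> carrier L" if "monic C m" "Cod C m = Dom C b" for m
    using that unfolding L_def carrier_slice_Sub[OF b] by auto
  have le: "slice_sub b m \<sqsubseteq>\<^bsub>L\<^esub> slice_sub b n \<longleftrightarrow> factors_through C m n"
    if "monic C m" "monic C n" "Cod C m = Dom C b" "Cod C n = Dom C b" for m n
    unfolding L_def by (rule le_slice_Sub[OF b that])
  interpret L: partial_order L
  proof
    fix x y z assume *: "x \<in> carrier L" "y \<in> carrier L" "z \<in> carrier L" "x \<sqsubseteq>\<^bsub>L\<^esub> y" "y \<sqsubseteq>\<^bsub>L\<^esub> z"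
    obtain k m n where "monic C k" "Cod C k = Dom C b" "x = slice_sub b k" "monic C m" "Cod C m = Dom C b" "y = slice_sub b m"
      "monic C n" "Cod C n = Dom C b" "z = slice_sub b n"
      using carE[OF *(1)] carE[OF *(2)] carE[OF *(3)] by blast
    then show "x \<sqsubseteq>\<^bsub>L\<^esub> z" using *(4,5) le factors_through_trans[of k m n] by simp
  next
    fix x y assume *: "x \<sqsubseteq>\<^bsub>L\<^esub> y" "y \<sqsubseteq>\<^bsub>L\<^esub> x" "x \<in> carrier L" "y \<in> carrier L"
    obtain m n where "monic C m" "Cod C m = Dom C b" "x = slice_sub b m" "monic C n" "Cod C n = Dom C b" "y = slice_sub b n"
      using carE[OF *(3)] carE[OF *(4)] by blast
    then show "x .=\<^bsub>L\<^esub> y" using *(1,2) le slice_sub_eqI[of m n] unfolding eq by simp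
  next
    fix x assume "x \<in> carrier L"
    then show "x \<sqsubseteq>\<^bsub>L\<^esub> x" by (auto dest!: carE simp: le)
  next
    show "(.=\<^bsub>L\<^esub>) = (=)" using eq by blast
  qed (simp_all add: eq)
  have "bounded_lattice L"
  proof
    fix x y assume xy: "x \<in> carrier L" "y \<in> carrier L"
    obtain m n where m: "monic C m" "Cod C m = Dom C b" "x = slice_sub b m"
      and n: "monic C n" "Cod C n = Dom C b" "y = slice_sub b n"
      using xy by (blast dest: carE)
    have mn: "Cod C m = Cod C n" using m n by simp
    obtain j where j: "monic C j" "Cod C j = Cod C n" "factors_through C m j" "factors_through C n j"
      "\<And>k. \<lbrakk>monic C k; Cod C k = Cod C n; factors_through C m k; factors_through C n k\<rbrakk> \<Longrightarrow> factors_through C j k"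
      by (rule join_exists[OF m(1) n(1) mn]) blast
    have "least L (slice_sub b j) (Upper L {x, y})"
    proof (rule least_UpperI)
      fix z assume "z \<in> Upper L {x, y}"
      then have z: "z \<in> carrier L" "x \<sqsubseteq>\<^bsub>L\<^esub> z" "y \<sqsubseteq>\<^bsub>L\<^esub> z" using xy by (auto simp: Upper_def)
      obtain k where k: "monic C k" "Cod C k = Dom C b" "z = slice_sub b k" using carE[OF z(1)] by blast
      show "slice_sub b j \<sqsubseteq>\<^bsub>L\<^esub> z" using z k m n j(1,2) j(5)[of k] by (simp add: le)
    qed (use m n j xy car in \<open>auto simp: le\<close>)
    then show "\<exists>s. least L s (Upper L {x, y})" by blast
    have "greatest L (slice_sub b (meet_sub m n)) (Lower L {x, y})"
    proof (rule greatest_LowerI)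
      fix z assume "z \<in> Lower L {x, y}"
      then have z: "z \<in> carrier L" "z \<sqsubseteq>\<^bsub>L\<^esub> x" "z \<sqsubseteq>\<^bsub>L\<^esub> y" using xy by (auto simp: Lower_def)
      obtain k where k: "monic C k" "Cod C k = Dom C b" "z = slice_sub b k" using carE[OF z(1)] by blast
      show "z \<sqsubseteq>\<^bsub>L\<^esub> slice_sub b (meet_sub m n)"
        using z k m n by (simp add: le factors_meet_sub_iff)
    next
      have "factors_through C (meet_sub m n) m" "factors_through C (meet_sub m n) n"
        using factors_meet_sub_iff[OF m(1) n(1) mn, of "meet_sub m n"] m n by simp_all
      then show "slice_sub b (meet_sub m n) \<sqsubseteq>\<^bsub>L\<^esub> z" if "z \<in> {x, y}" for z
        using that m n by (auto simp: le)
    qed (use m n xy car in auto)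
    then show "\<exists>s. greatest L s (Lower L {x, y})" by blast
  next
    have I: "monic C (Id C (Dom C b))" "Cod C (Id C (Dom C b)) = Dom C b" using b by (simp_all add: monic_Id)
    have "greatest L (slice_sub b (Id C (Dom C b))) (carrier L)"
      unfolding greatest_def
    proof (intro conjI ballI)
      fix x assume "x \<in> carrier L"
      then obtain m where "monic C m" "Cod C m = Dom C b" "x = slice_sub b m" using carE by blast
      then show "x \<sqsubseteq>\<^bsub>L\<^esub> slice_sub b (Id C (Dom C b))" by (simp add: le I factors_through_Id)
    qed (use car[OF I] in auto)
    then show "\<exists>x. greatest L x (carrier L)" by blast
    obtain n where n: "monic C n" "Cod C n = Dom C b" "\<And>m. \<lbrakk>monic C m; Cod C m = Dom C b\<rbrakk> \<Longrightarrow> factors_through C n m"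
      using least_subobject_exists[of "Dom C b"] b by auto
    have "least L (slice_sub b n) (carrier L)"
      unfolding least_def
    proof (intro conjI ballI)
      fix x assume "x \<in> carrier L"
      then obtain m where "monic C m" "Cod C m = Dom C b" "x = slice_sub b m" using carE by blast
      then show "slice_sub b n \<sqsubseteq>\<^bsub>L\<^esub> x" by (simp add: le n)
    qed (use car[OF n(1,2)] in auto)
    then show "\<exists>x. least L x (carrier L)" by blast
  qed
  then show ?thesis unfolding L_def .
qed

text \<open>The join operation picks some least upper bound, so it is represented by an unknown
  \<open>k\<close> and then identified with \<open>j\<close> by antisymmetry.\<close>

lemma slice_sub_join:
  assumes b: "b \<in> Arr C" "Cod C b = B"
    and mn: "monic C m" "monic C n" "Cod C m = Dom C b" "Cod C n = Dom C b"
    and j: "monic C j" "Cod C j = Dom C b" "factors_through C m j" "factors_through C n j"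
      "\<And>k. \<lbrakk>monic C k; Cod C k = Dom C b; factors_through C m k; factors_through C n k\<rbrakk> \<Longrightarrow> factors_through C j k"
  shows "slice_sub b m \<squnion>\<^bsub>Sub (slice C B) b\<^esub> slice_sub b n = slice_sub b j"
proof -
  interpret L: bounded_lattice "Sub (slice C B) b" by (rule slice_Sub_bounded_lattice[OF b])
  let ?L = "Sub (slice C B) b"
  have car: "slice_sub b k \<in> carrier ?L" if "monic C k" "Cod C k = Dom C b" for k
    using that unfolding carrier_slice_Sub[OF b] by auto
  note le = le_slice_Sub[OF b]
  note cm = car[OF mn(1,3)] and cn = car[OF mn(2,4)]
  have c: "slice_sub b m \<squnion>\<^bsub>?L\<^esub> slice_sub b n \<in> carrier ?L" by (rule L.join_closed[OF cm cn])
  then obtain k where k: "monic C k" "Cod C k = Dom C b" "slice_sub b m \<squnion>\<^bsub>?L\<^esub> slice_sub b n = slice_sub b k"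
    unfolding carrier_slice_Sub[OF b] by auto
  have "slice_sub b m \<sqsubseteq>\<^bsub>?L\<^esub> slice_sub b k" "slice_sub b n \<sqsubseteq>\<^bsub>?L\<^esub> slice_sub b k"
    using L.join_left[OF cm cn] L.join_right[OF cm cn] unfolding k(3) by simp_all
  then have "factors_through C j k" using le mn k j by simp
  then have "slice_sub b j \<sqsubseteq>\<^bsub>?L\<^esub> slice_sub b k" using le j k by simp
  moreover have "slice_sub b m \<squnion>\<^bsub>?L\<^esub> slice_sub b n \<sqsubseteq>\<^bsub>?L\<^esub> slice_sub b j"
    by (rule L.join_le) (use le mn j car in simp_all)
  ultimately show ?thesis unfolding k(3) by (intro L.le_antisym car k j)
qed

lemma slice_sub_meet:
  assumes b: "b \<in> Arr C" "Cod C b = B"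
    and mn: "monic C m" "monic C n" "Cod C m = Dom C b" "Cod C n = Dom C b"
  shows "slice_sub b m \<sqinter>\<^bsub>Sub (slice C B) b\<^esub> slice_sub b n = slice_sub b (meet_sub m n)"
proof -
  interpret L: bounded_lattice "Sub (slice C B) b" by (rule slice_Sub_bounded_lattice[OF b])
  let ?L = "Sub (slice C B) b"
  have car: "slice_sub b k \<in> carrier ?L" if "monic C k" "Cod C k = Dom C b" for k
    using that unfolding carrier_slice_Sub[OF b] by auto
  note le = le_slice_Sub[OF b]
  have M: "monic C (meet_sub m n)" "Cod C (meet_sub m n) = Dom C b" using mn by simp_all
  have Mf: "factors_through C x (meet_sub m n) \<longleftrightarrow> factors_through C x m \<and> factors_through C x n"
    if "x \<in> Arr C" "Cod C x = Dom C b" for x using factors_meet_sub_iff[of m n x] mn that by simp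
  note cm = car[OF mn(1,3)] and cn = car[OF mn(2,4)]
  have c: "slice_sub b m \<sqinter>\<^bsub>?L\<^esub> slice_sub b n \<in> carrier ?L" by (rule L.meet_closed[OF cm cn])
  then obtain k where k: "monic C k" "Cod C k = Dom C b" "slice_sub b m \<sqinter>\<^bsub>?L\<^esub> slice_sub b n = slice_sub b k"
    unfolding carrier_slice_Sub[OF b] by auto
  have "slice_sub b k \<sqsubseteq>\<^bsub>?L\<^esub> slice_sub b m" "slice_sub b k \<sqsubseteq>\<^bsub>?L\<^esub> slice_sub b n"
    using L.meet_left[OF cm cn] L.meet_right[OF cm cn] unfolding k(3) by simp_all
  then have "factors_through C k (meet_sub m n)" using le mn k Mf[of k] by simp
  then have "slice_sub b k \<sqsubseteq>\<^bsub>?L\<^esub> slice_sub b (meet_sub m n)" using le M k by simp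
  moreover have "slice_sub b (meet_sub m n) \<sqsubseteq>\<^bsub>?L\<^esub> slice_sub b m \<sqinter>\<^bsub>?L\<^esub> slice_sub b n"
    by (rule L.meet_le) (use le mn M Mf[of "meet_sub m n"] car in simp_all)
  ultimately show ?thesis unfolding k(3) by (intro L.le_antisym car k M)
qed

end

section \<open>The functor 0 \<times> - and the least cluster\<close>

locale canonical_form_setup = ideally_exact_cat C
  for C :: "('o, 'a) cat" (structure) +
  fixes Z :: 'o and P :: "'o \<Rightarrow> 'o" and \<pi>\<^sub>1 \<pi>\<^sub>2 :: "'o \<Rightarrow> 'a"
  assumes initial: "is_initial C Z" and products: "product_choice C Z P \<pi>\<^sub>1 \<pi>\<^sub>2"
begin

definition ini :: "'o \<Rightarrow> 'a" where
  "ini X = (THE f. f \<in> hom_set C Z X)"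

lemma Z_Obj [simp]: "Z \<in> Obj C"
  using initial unfolding is_initial_def by blast

lemma ini_simps [simp]:
  assumes "X \<in> Obj C" shows "ini X \<in> Arr C" "Dom C (ini X) = Z" "Cod C (ini X) = X"
proof -
  have "\<exists>!f. f \<in> hom_set C Z X" using initial assms unfolding is_initial_def by blast
  then have "ini X \<in> hom_set C Z X" unfolding ini_def by (rule theI')
  then show "ini X \<in> Arr C" "Dom C (ini X) = Z" "Cod C (ini X) = X" by simp_all
qed

text \<open>Every composite that starts with an initial arrow is collapsed to an initial arrow, so
  kernel conditions f x = ! z keep their shape under further composition.\<close>

lemma Comp_ini [simp]: "f \<in> Arr C \<Longrightarrow> Dom C f = X \<Longrightarrow> f \<cdot> ini X = ini (Cod C f)"
  by (rule initial_unique[OF initial]) auto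

lemma Comp_ini_Comp [simp]:
  assumes "f \<in> Arr C" "Dom C f = X" "w \<in> Arr C" "Cod C w = Z"
  shows "f \<cdot> (ini X \<cdot> w) = ini (Cod C f) \<cdot> w"
proof -
  have "X \<in> Obj C" using assms by auto
  then show ?thesis using Comp_eq_assoc[OF Comp_ini[OF assms(1,2)], of w] assms by simp
qed

lemma product: "X \<in> Obj C \<Longrightarrow> is_product C Z X (P X) (\<pi>\<^sub>1 X) (\<pi>\<^sub>2 X)"
  using products unfolding product_choice_def by blast

lemma proj_simps [simp]:
  assumes "X \<in> Obj C"
  shows "\<pi>\<^sub>1 X \<in> Arr C" "\<pi>\<^sub>2 X \<in> Arr C" "Dom C (\<pi>\<^sub>1 X) = P X" "Dom C (\<pi>\<^sub>2 X) = P X"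
    "Cod C (\<pi>\<^sub>1 X) = Z" "Cod C (\<pi>\<^sub>2 X) = X"
  using productD[OF product[OF assms]] by simp_all

lemma P_Obj [simp]: "X \<in> Obj C \<Longrightarrow> P X \<in> Obj C"
  using Dom_closed[of "\<pi>\<^sub>1 X"] by simp

abbreviation lift :: "'a \<Rightarrow> 'a" where
  "lift \<equiv> id_times C Z P \<pi>\<^sub>1 \<pi>\<^sub>2"

lemma lift_simps:
  assumes "f \<in> Arr C" "Dom C f = X" "Cod C f = Y"
  shows "lift f \<in> Arr C" "Dom C (lift f) = P X" "Cod C (lift f) = P Y"
    "\<pi>\<^sub>1 Y \<cdot> lift f = \<pi>\<^sub>1 X" "\<pi>\<^sub>2 Y \<cdot> lift f = f \<cdot> \<pi>\<^sub>2 X"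
proof -
  have XY: "X \<in> Obj C" "Y \<in> Obj C" using assms by auto
  have "\<exists>!h. h \<in> hom_set C (Dom C (f \<cdot> \<pi>\<^sub>2 X)) (P Y) \<and> \<pi>\<^sub>1 Y \<cdot> h = Id C Z \<cdot> \<pi>\<^sub>1 X \<and> \<pi>\<^sub>2 Y \<cdot> h = f \<cdot> \<pi>\<^sub>2 X"
    by (rule product_ex1[OF product[OF XY(2)]]) (use assms XY in simp_all)
  then have "\<exists>!h. h \<in> hom_set C (P (Dom C f)) (P (Cod C f)) \<and>
     \<pi>\<^sub>1 (Cod C f) \<cdot> h = Id C Z \<cdot> \<pi>\<^sub>1 (Dom C f) \<and> \<pi>\<^sub>2 (Cod C f) \<cdot> h = f \<cdot> \<pi>\<^sub>2 (Dom C f)"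
    using assms XY by simp
  from theI'[OF this] show "lift f \<in> Arr C" "Dom C (lift f) = P X" "Cod C (lift f) = P Y"
    "\<pi>\<^sub>1 Y \<cdot> lift f = \<pi>\<^sub>1 X" "\<pi>\<^sub>2 Y \<cdot> lift f = f \<cdot> \<pi>\<^sub>2 X"
    unfolding id_times_def[symmetric] using assms XY by simp_all
qed

lemma lift_Arr [simp]:
  assumes "f \<in> Arr C"
  shows "lift f \<in> Arr C" "Dom C (lift f) = P (Dom C f)" "Cod C (lift f) = P (Cod C f)"
  using lift_simps[OF assms refl refl] by simp_all

lemma proj_lift [simp]:
  assumes "f \<in> Arr C" "Cod C f = Y" "x \<in> Arr C" "Cod C x = P (Dom C f)"
  shows "\<pi>\<^sub>1 Y \<cdot> (lift f \<cdot> x) = \<pi>\<^sub>1 (Dom C f) \<cdot> x" "\<pi>\<^sub>2 Y \<cdot> (lift f \<cdot> x) = f \<cdot> (\<pi>\<^sub>2 (Dom C f) \<cdot> x)"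
proof -
  have Y: "Y \<in> Obj C" using assms by auto
  note T = lift_simps[OF assms(1) refl assms(2)]
  show "\<pi>\<^sub>1 Y \<cdot> (lift f \<cdot> x) = \<pi>\<^sub>1 (Dom C f) \<cdot> x"
    using Comp_eq_assoc[OF T(4), of x] assms Y T by simp
  show "\<pi>\<^sub>2 Y \<cdot> (lift f \<cdot> x) = f \<cdot> (\<pi>\<^sub>2 (Dom C f) \<cdot> x)"
    using Comp_eq_assoc[OF T(5), of x] assms Y T by simp
qed

lemma pair_eqI:
  assumes "x \<in> Arr C" "y \<in> Arr C" "Dom C x = Dom C y" "Cod C x = P X" "Cod C y = P X" "X \<in> Obj C"
    "\<pi>\<^sub>1 X \<cdot> x = \<pi>\<^sub>1 X \<cdot> y" "\<pi>\<^sub>2 X \<cdot> x = \<pi>\<^sub>2 X \<cdot> y"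
  shows "x = y"
  by (rule product_unique[OF product[OF assms(6)]]) (use assms in simp_all)

lemma lift_Comp:
  assumes "f \<in> Arr C" "g \<in> Arr C" "Cod C f = Dom C g"
  shows "lift (g \<cdot> f) = lift g \<cdot> lift f"
proof (rule pair_eqI)
  show "\<pi>\<^sub>1 (Cod C g) \<cdot> lift (g \<cdot> f) = \<pi>\<^sub>1 (Cod C g) \<cdot> (lift g \<cdot> lift f)"
    using lift_simps[of "g \<cdot> f" "Dom C f" "Cod C g"] lift_simps[of f "Dom C f" "Dom C g"] assms by simp
  show "\<pi>\<^sub>2 (Cod C g) \<cdot> lift (g \<cdot> f) = \<pi>\<^sub>2 (Cod C g) \<cdot> (lift g \<cdot> lift f)"
    using lift_simps[of "g \<cdot> f" "Dom C f" "Cod C g"] lift_simps[of f "Dom C f" "Dom C g"] assms by simp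
qed (use assms in simp_all)

lemma lift_Id:
  assumes "X \<in> Obj C" shows "lift (Id C X) = Id C (P X)"
  by (rule pair_eqI[of _ _ X]) (use assms lift_simps[of "Id C X" X X] in simp_all)

text \<open>1 \<times> e is the pullback of e along the second projection.\<close>

lemma lift_regular_epi:
  assumes "regular_epi C e" shows "regular_epi C (lift e)"
proof -
  have e: "e \<in> Arr C" using assms by simp
  note T = lift_simps[OF e refl refl]
  have "is_pullback C (\<pi>\<^sub>2 (Cod C e)) e (lift e) (\<pi>\<^sub>2 (Dom C e))"
  proof (rule pullbackI)
    fix u v assume uv: "u \<in> Arr C" "v \<in> Arr C" "Dom C u = Dom C v" "Cod C u = Dom C (\<pi>\<^sub>2 (Cod C e))" "Cod C v = Dom C e"
      "\<pi>\<^sub>2 (Cod C e) \<cdot> u = e \<cdot> v"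
    obtain h where h: "h \<in> Arr C" "Dom C h = Dom C v" "Cod C h = P (Dom C e)" "\<pi>\<^sub>1 (Dom C e) \<cdot> h = \<pi>\<^sub>1 (Cod C e) \<cdot> u" "\<pi>\<^sub>2 (Dom C e) \<cdot> h = v"
      by (rule product_lift[OF product, of "Dom C e" "\<pi>\<^sub>1 (Cod C e) \<cdot> u" v]) (use e uv in simp_all)
    have "lift e \<cdot> h = u" by (rule pair_eqI[of _ _ "Cod C e"]) (use e uv h in simp_all)
    with h show "\<exists>h. h \<in> Arr C \<and> Dom C h = Dom C v \<and> Cod C h = Dom C (lift e) \<and> lift e \<cdot> h = u \<and> \<pi>\<^sub>2 (Dom C e) \<cdot> h = v"
      using e by (intro exI[of _ h]) simp
  next
    fix h k assume hk: "h \<in> Arr C" "k \<in> Arr C" "Dom C h = Dom C k" "Cod C h = Dom C (lift e)" "Cod C k = Dom C (lift e)"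
      "lift e \<cdot> h = lift e \<cdot> k" "\<pi>\<^sub>2 (Dom C e) \<cdot> h = \<pi>\<^sub>2 (Dom C e) \<cdot> k"
    have "\<pi>\<^sub>1 (Cod C e) \<cdot> (lift e \<cdot> h) = \<pi>\<^sub>1 (Cod C e) \<cdot> (lift e \<cdot> k)" using hk(6) by simp
    then have "\<pi>\<^sub>1 (Dom C e) \<cdot> h = \<pi>\<^sub>1 (Dom C e) \<cdot> k" using hk(1-5) e by simp
    then show "h = k" by (intro pair_eqI[of h k "Dom C e"]) (use hk e in simp_all)
  qed (use e T in simp_all)
  from regular_epi_pullback[OF this assms] show ?thesis .
qed

lemma lift_monic:
  assumes "monic C m" shows "monic C (lift m)"
proof (rule monicI)
  have m: "m \<in> Arr C" using assms by simp
  show "lift m \<in> Arr C" using m by simp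
  fix h k assume hk: "h \<in> Arr C" "k \<in> Arr C" "Dom C h = Dom C k" "Cod C h = Dom C (lift m)" "Cod C k = Dom C (lift m)"
      "lift m \<cdot> h = lift m \<cdot> k"
  have 1: "\<pi>\<^sub>1 (Cod C m) \<cdot> (lift m \<cdot> h) = \<pi>\<^sub>1 (Cod C m) \<cdot> (lift m \<cdot> k)"
    "\<pi>\<^sub>2 (Cod C m) \<cdot> (lift m \<cdot> h) = \<pi>\<^sub>2 (Cod C m) \<cdot> (lift m \<cdot> k)" using hk(6) by simp_all
  then have "m \<cdot> (\<pi>\<^sub>2 (Dom C m) \<cdot> h) = m \<cdot> (\<pi>\<^sub>2 (Dom C m) \<cdot> k)" using hk(1-5) m by simp
  then have 2: "\<pi>\<^sub>2 (Dom C m) \<cdot> h = \<pi>\<^sub>2 (Dom C m) \<cdot> k" by (rule monicD[OF assms]) (use hk(1-5) m in simp_all)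
  show "h = k" by (rule pair_eqI[of h k "Dom C m"]) (use hk(1-5) m 1 2 in simp_all)
qed

text \<open>The first component of an element of 0 \<times> X is not constrained by 1 \<times> m, so
  only the second one is tested.\<close>

lemma factors_lift_iff:
  assumes "m \<in> Arr C" "Cod C m = X" "w \<in> Arr C" "Cod C w = P X"
  shows "factors_through C w (lift m) \<longleftrightarrow> factors_through C (\<pi>\<^sub>2 X \<cdot> w) m"
proof
  have X: "X \<in> Obj C" using assms by auto
  {
    assume "factors_through C w (lift m)"
    then obtain h where h: "h \<in> Arr C" "Dom C h = Dom C w" "Cod C h = Dom C (lift m)" "lift m \<cdot> h = w"
      by (rule factors_throughE)
    have "\<pi>\<^sub>2 X \<cdot> w = m \<cdot> (\<pi>\<^sub>2 (Dom C m) \<cdot> h)" unfolding h(4)[symmetric] using h(1-3) assms(1,2) by simp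
    then show "factors_through C (\<pi>\<^sub>2 X \<cdot> w) m"
      by (rule factors_throughI) (use h(1-3) assms(1) in simp_all)
  next
    assume "factors_through C (\<pi>\<^sub>2 X \<cdot> w) m"
    then obtain k where k: "k \<in> Arr C" "Dom C k = Dom C (\<pi>\<^sub>2 X \<cdot> w)" "Cod C k = Dom C m" "m \<cdot> k = \<pi>\<^sub>2 X \<cdot> w"
      by (rule factors_throughE)
    obtain h where h: "h \<in> Arr C" "Dom C h = Dom C k" "Cod C h = P (Dom C m)" "\<pi>\<^sub>1 (Dom C m) \<cdot> h = \<pi>\<^sub>1 X \<cdot> w" "\<pi>\<^sub>2 (Dom C m) \<cdot> h = k"
      by (rule product_lift[OF product, of "Dom C m" "\<pi>\<^sub>1 X \<cdot> w" k]) (use assms X k in simp_all)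
    have "lift m \<cdot> h = w" by (rule pair_eqI[of _ _ X]) (use assms X k h in simp_all)
    then show "factors_through C w (lift m)"
      by (intro factors_throughI[of _ _ h]) (use h assms in simp_all)
  }
qed

lemma ini_Z [simp]: "ini Z = Id C Z"
  by (rule initial_unique[OF initial]) simp_all

text \<open>The first projection splits it. Over 0 the initial arrow is thus itself the least
  subobject, with no image to be taken.\<close>

lemma ini_P: "X \<in> Obj C \<Longrightarrow> monic C (ini (P X))"
  by (rule split_monic[of "\<pi>\<^sub>1 X"]) simp_all

text \<open>As a subobject of 0 \<times> X, the arrow from 0 is the graph of 0 \<rightarrow> X; the
  first component of an element is its only possible factor.\<close>

lemma factors_ini_iff:
  assumes "w \<in> Arr C" "Cod C w = P X" "X \<in> Obj C"
  shows "factors_through C w (ini (P X)) \<longleftrightarrow> \<pi>\<^sub>2 X \<cdot> w = ini X \<cdot> (\<pi>\<^sub>1 X \<cdot> w)"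
proof
  {
    assume "factors_through C w (ini (P X))"
    then obtain h where h: "h \<in> Arr C" "Dom C h = Dom C w" "Cod C h = Dom C (ini (P X))" "ini (P X) \<cdot> h = w"
      by (rule factors_throughE)
    then have "h \<in> Arr C" "Cod C h = Z" using assms by simp_all
    then show "\<pi>\<^sub>2 X \<cdot> w = ini X \<cdot> (\<pi>\<^sub>1 X \<cdot> w)" unfolding h(4)[symmetric] using assms(3) by simp
  next
    assume eq: "\<pi>\<^sub>2 X \<cdot> w = ini X \<cdot> (\<pi>\<^sub>1 X \<cdot> w)"
    have "w = ini (P X) \<cdot> (\<pi>\<^sub>1 X \<cdot> w)"
      by (rule pair_eqI[of _ _ X]) (use assms eq in simp_all)
    then show "factors_through C w (ini (P X))"
      by (rule factors_throughI) (use assms in simp_all)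
  }
qed

lemma ini_least:
  assumes "m \<in> Arr C" "Cod C m = P X" "X \<in> Obj C" shows "factors_through C (ini (P X)) m"
proof (rule factors_throughI[of _ _ "ini (Dom C m)"])
  show "ini (P X) = m \<cdot> ini (Dom C m)" using assms by simp
qed (use assms in simp_all)

text \<open>The product 0 \<times> X is a pullback over 1, and its second projection is the pullback
  of 0 \<rightarrow> 1 along X \<rightarrow> 1.\<close>

lemma snd_regular_epi:
  assumes "X \<in> Obj C" shows "regular_epi C (\<pi>\<^sub>2 X)"
proof -
  obtain T where T: "is_terminal C T" by (rule terminal_exists)
  obtain p x where px: "p \<in> hom_set C Z T" "x \<in> hom_set C X T"
    using T assms Z_Obj unfolding is_terminal_def by blast
  have p: "regular_epi C p" using ideally_exact initial T px unfolding ideally_exact_def by blast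
  have "is_pullback C x p (\<pi>\<^sub>2 X) (\<pi>\<^sub>1 X)"
  proof (rule pullbackI)
    show "x \<cdot> \<pi>\<^sub>2 X = p \<cdot> \<pi>\<^sub>1 X" by (rule terminal_unique[OF T]) (use px assms in simp_all)
    fix u v assume uv: "u \<in> Arr C" "v \<in> Arr C" "Dom C u = Dom C v" "Cod C u = Dom C x" "Cod C v = Dom C p"
    obtain h where "h \<in> Arr C" "Dom C h = Dom C u" "Cod C h = P X" "\<pi>\<^sub>1 X \<cdot> h = v" "\<pi>\<^sub>2 X \<cdot> h = u"
      by (rule product_lift[OF product[OF assms], of v u]) (use uv px in simp_all)
    then show "\<exists>h. h \<in> Arr C \<and> Dom C h = Dom C v \<and> Cod C h = Dom C (\<pi>\<^sub>2 X) \<and> \<pi>\<^sub>2 X \<cdot> h = u \<and> \<pi>\<^sub>1 X \<cdot> h = v"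
      using uv assms by (intro exI[of _ h]) simp
  next
    fix h k assume "h \<in> Arr C" "k \<in> Arr C" "Dom C h = Dom C k" "Cod C h = Dom C (\<pi>\<^sub>2 X)" "Cod C k = Dom C (\<pi>\<^sub>2 X)"
      "\<pi>\<^sub>2 X \<cdot> h = \<pi>\<^sub>2 X \<cdot> k" "\<pi>\<^sub>1 X \<cdot> h = \<pi>\<^sub>1 X \<cdot> k"
    then show "h = k" using assms pair_eqI[of h k X] by simp
  qed (use px assms in simp_all)
  from regular_epi_pullback[OF this p] show ?thesis .
qed

section \<open>Clusters and lattice operations on representatives\<close>

abbreviation F :: "('o, 'a, ('a \<times> 'a \<times> 'a) set) form" where
  "F \<equiv> canonical_form C Z P \<pi>\<^sub>1 \<pi>\<^sub>2"

definition cl :: "'o \<Rightarrow> 'a \<Rightarrow> ('a \<times> 'a \<times> 'a) set" where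
  "cl X m = slice_sub (\<pi>\<^sub>1 X) m"

lemma fibre_F: "fibre F X = Sub (slice C Z) (\<pi>\<^sub>1 X)"
  by (simp add: canonical_form_def)

lemma bounded_lattice_fibre: "X \<in> Obj C \<Longrightarrow> bounded_lattice (fibre F X)"
  unfolding fibre_F by (rule slice_Sub_bounded_lattice) simp_all

lemma carrier_fibre: "X \<in> Obj C \<Longrightarrow> carrier (fibre F X) = cl X ` {m. monic C m \<and> Cod C m = P X}"
  unfolding fibre_F cl_def using carrier_slice_Sub[of "\<pi>\<^sub>1 X" Z] by simp

lemma carrier_fibreE:
  assumes "S \<in> carrier (fibre F X)" "X \<in> Obj C"
  obtains m where "monic C m" "Cod C m = P X" "S = cl X m"
  using assms by (auto simp: carrier_fibre)

lemma cl_carrier: "\<lbrakk>X \<in> Obj C; monic C m; Cod C m = P X\<rbrakk> \<Longrightarrow> cl X m \<in> carrier (fibre F X)"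
  by (simp add: carrier_fibre)

lemma le_cl:
  assumes "X \<in> Obj C" "monic C m" "monic C n" "Cod C m = P X" "Cod C n = P X"
  shows "cl X m \<sqsubseteq>\<^bsub>fibre F X\<^esub> cl X n \<longleftrightarrow> factors_through C m n"
  unfolding fibre_F cl_def using le_slice_Sub[of "\<pi>\<^sub>1 X" Z m n] assms by simp

lemma cl_eqI:
  assumes "monic C m" "monic C n" "factors_through C m n" "factors_through C n m"
  shows "cl X m = cl X n"
  unfolding cl_def by (rule slice_sub_eqI[OF assms])

lemma join_cl:
  assumes "X \<in> Obj C" "monic C m" "monic C n" "Cod C m = P X" "Cod C n = P X"
    "monic C j" "Cod C j = P X" "factors_through C m j" "factors_through C n j"
      "\<And>k. \<lbrakk>monic C k; Cod C k = P X; factors_through C m k; factors_through C n k\<rbrakk> \<Longrightarrow> factors_through C j k"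
  shows "cl X m \<squnion>\<^bsub>fibre F X\<^esub> cl X n = cl X j"
  unfolding fibre_F cl_def by (rule slice_sub_join) (use assms in simp_all)

lemma meet_cl:
  assumes "X \<in> Obj C" "monic C m" "monic C n" "Cod C m = P X" "Cod C n = P X"
  shows "cl X m \<sqinter>\<^bsub>fibre F X\<^esub> cl X n = cl X (meet_sub m n)"
  unfolding fibre_F cl_def by (rule slice_sub_meet) (use assms in simp_all)

lemma top_cl:
  assumes "X \<in> Obj C" shows "\<top>\<^bsub>fibre F X\<^esub> = cl X (Id C (P X))"
proof -
  interpret L: bounded_lattice "fibre F X" by (rule bounded_lattice_fibre[OF assms])
  have "cl X (Id C (P X)) = \<top>\<^bsub>fibre F X\<^esub>"
  proof (rule L.top_eq)
    show "cl X (Id C (P X)) \<in> carrier (fibre F X)" using assms by (simp add: cl_carrier monic_Id)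
    fix S assume "S \<in> carrier (fibre F X)"
    then obtain m where "monic C m" "Cod C m = P X" "S = cl X m" using assms by (rule carrier_fibreE)
    then show "S \<sqsubseteq>\<^bsub>fibre F X\<^esub> cl X (Id C (P X))"
      using assms by (simp add: le_cl monic_Id factors_through_Id)
  qed
  then show ?thesis by simp
qed

lemma bottom_cl:
  assumes "X \<in> Obj C" shows "\<bottom>\<^bsub>fibre F X\<^esub> = cl X (ini (P X))"
proof -
  interpret L: bounded_lattice "fibre F X" by (rule bounded_lattice_fibre[OF assms])
  have "cl X (ini (P X)) = \<bottom>\<^bsub>fibre F X\<^esub>"
  proof (rule L.bottom_eq)
    show "cl X (ini (P X)) \<in> carrier (fibre F X)" using assms by (simp add: cl_carrier ini_P)
    fix S assume "S \<in> carrier (fibre F X)"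
    then obtain m where "monic C m" "Cod C m = P X" "S = cl X m" using assms by (rule carrier_fibreE)
    then show "cl X (ini (P X)) \<sqsubseteq>\<^bsub>fibre F X\<^esub> S"
      using assms by (simp add: le_cl ini_P ini_least)
  qed
  then show ?thesis by simp
qed

text \<open>With its counterpart for inverse images this removes the slice from the transports: they
  become \<open>img\<close> and \<open>preimage\<close> along 1 \<times> f, computed in C.\<close>

lemma dirim_cl:
  assumes "f \<in> Arr C" "Dom C f = X" "Cod C f = Y" "monic C m" "Cod C m = P X"
  shows "dirim F f (cl X m) = cl Y (img (lift f \<cdot> m))"
proof -
  have XY: "X \<in> Obj C" "Y \<in> Obj C" using assms by auto
  note T = lift_simps[OF assms(1-3)]
  show ?thesis
    using sub_direct_image_slice[of "\<pi>\<^sub>1 X" "\<pi>\<^sub>1 Y" Z "lift f" m] T XY assms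
    by (simp add: canonical_form_def base_change_def cl_def)
qed

lemma invim_cl:
  assumes "f \<in> Arr C" "Dom C f = X" "Cod C f = Y" "monic C m" "Cod C m = P Y"
  shows "invim F f (cl Y m) = cl X (preimage (lift f) m)"
proof -
  have XY: "X \<in> Obj C" "Y \<in> Obj C" using assms by auto
  note T = lift_simps[OF assms(1-3)]
  show ?thesis
    using sub_inverse_image_slice[of "\<pi>\<^sub>1 X" "\<pi>\<^sub>1 Y" Z "lift f" m] T XY assms
    by (simp add: canonical_form_def base_change_def cl_def)
qed

end


section \<open>The axioms of an orean form\<close>

context canonical_form_setup
begin

lemma adjunction:
  assumes f: "f \<in> Arr C" and m: "monic C m" "Cod C m = P (Dom C f)" and n: "monic C n" "Cod C n = P (Cod C f)"
  shows "factors_through C (img (lift f \<cdot> m)) n \<longleftrightarrow> factors_through C m (preimage (lift f) n)"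
  using img_le_iff[of "lift f \<cdot> m" n] factors_preimage_iff[of "lift f" n m] assms by simp

lemma img_mono:
  assumes "f \<in> Arr C" "monic C m" "Cod C m = P (Dom C f)" "monic C n" "Cod C n = P (Dom C f)" "factors_through C m n"
  shows "factors_through C (img (lift f \<cdot> m)) (img (lift f \<cdot> n))"
proof -
  have "factors_through C (lift f \<cdot> m) (lift f \<cdot> n)"
    by (rule factors_through_postcomp) (use assms in simp_all)
  moreover have "factors_through C (lift f \<cdot> n) (img (lift f \<cdot> n))"
    by (rule factors_img) (use assms in simp)
  ultimately have "factors_through C (lift f \<cdot> m) (img (lift f \<cdot> n))"
    by (rule factors_through_trans) (use assms in simp)
  then show ?thesis using img_le_iff[of "lift f \<cdot> m" "img (lift f \<cdot> n)"] assms by simp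
qed

lemma preimage_mono:
  assumes "f \<in> Arr C" "monic C m" "Cod C m = P (Cod C f)" "monic C n" "Cod C n = P (Cod C f)" "factors_through C m n"
  shows "factors_through C (preimage (lift f) m) (preimage (lift f) n)"
proof -
  have "factors_through C (lift f \<cdot> preimage (lift f) m) m"
    using factors_preimage_iff[of "lift f" m "preimage (lift f) m"] assms by simp
  then have "factors_through C (lift f \<cdot> preimage (lift f) m) n"
    by (rule factors_through_trans) (use assms in simp_all)
  then show ?thesis
    using factors_preimage_iff[of "lift f" n "preimage (lift f) m"] assms by simp
qed

text \<open>Left adjoints compose because right adjoints do: both sides have the same upper bounds
  \<open>n\<close>, hence lie below each other.\<close>

lemma img_img:
  assumes f: "f \<in> Arr C" and g: "g \<in> Arr C" "Cod C f = Dom C g" and m: "monic C m" "Cod C m = P (Dom C f)"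
  shows "cl X (img (lift (g \<cdot> f) \<cdot> m)) = cl X (img (lift g \<cdot> img (lift f \<cdot> m)))"
proof (rule cl_eqI)
  have fm: "lift f \<cdot> m \<in> Arr C" "Cod C (lift f \<cdot> m) = P (Dom C g)" using assms by simp_all
  have i: "monic C (img (lift f \<cdot> m))" "Cod C (img (lift f \<cdot> m)) = P (Dom C g)" using fm by simp_all
  have T: "lift (g \<cdot> f) \<cdot> m = lift g \<cdot> (lift f \<cdot> m)" using assms by (simp add: lift_Comp)
  show M: "monic C (img (lift (g \<cdot> f) \<cdot> m))" "monic C (img (lift g \<cdot> img (lift f \<cdot> m)))"
    using assms by simp_all
  have *: "factors_through C (img (lift (g \<cdot> f) \<cdot> m)) n \<longleftrightarrow> factors_through C (img (lift g \<cdot> img (lift f \<cdot> m))) n"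
    if n: "monic C n" "Cod C n = P (Cod C g)" for n
  proof -
    have "factors_through C (img (lift (g \<cdot> f) \<cdot> m)) n \<longleftrightarrow> factors_through C (lift g \<cdot> (lift f \<cdot> m)) n"
      unfolding T by (rule img_le_iff) (use fm n g in simp_all)
    also have "\<dots> \<longleftrightarrow> factors_through C (lift f \<cdot> m) (preimage (lift g) n)"
      by (rule factors_preimage_iff[symmetric]) (use fm n g in simp_all)
    also have "\<dots> \<longleftrightarrow> factors_through C (img (lift f \<cdot> m)) (preimage (lift g) n)"
      by (rule img_le_iff[symmetric]) (use fm n g in simp_all)
    also have "\<dots> \<longleftrightarrow> factors_through C (img (lift g \<cdot> img (lift f \<cdot> m))) n"
      by (rule adjunction[symmetric]) (use i n g in simp_all)
    finally show ?thesis .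
  qed
  have C: "Cod C (img (lift (g \<cdot> f) \<cdot> m)) = P (Cod C g)" "Cod C (img (lift g \<cdot> img (lift f \<cdot> m))) = P (Cod C g)"
    using assms by simp_all
  show "factors_through C (img (lift (g \<cdot> f) \<cdot> m)) (img (lift g \<cdot> img (lift f \<cdot> m)))"
    using *[OF M(2) C(2)] M by simp
  show "factors_through C (img (lift g \<cdot> img (lift f \<cdot> m))) (img (lift (g \<cdot> f) \<cdot> m))"
    using *[OF M(1) C(1)] M by simp
qed

lemma preimage_preimage:
  assumes f: "f \<in> Arr C" and g: "g \<in> Arr C" "Cod C f = Dom C g" and m: "monic C m" "Cod C m = P (Cod C g)"
  shows "cl X (preimage (lift (g \<cdot> f)) m) = cl X (preimage (lift f) (preimage (lift g) m))"
proof (rule cl_eqI)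
  let ?a = "preimage (lift (g \<cdot> f)) m" and ?b = "preimage (lift f) (preimage (lift g) m)"
  show M: "monic C ?a" "monic C ?b" using assms by simp_all
  have C: "Cod C ?a = P (Dom C f)" "Cod C ?b = P (Dom C f)" using assms by simp_all
  have *: "factors_through C x ?a \<longleftrightarrow> factors_through C x ?b" if x: "x \<in> Arr C" "Cod C x = P (Dom C f)" for x
  proof -
    have "factors_through C x ?a \<longleftrightarrow> factors_through C (lift (g \<cdot> f) \<cdot> x) m"
      by (rule factors_preimage_iff) (use x assms in simp_all)
    also have "\<dots> \<longleftrightarrow> factors_through C (lift g \<cdot> (lift f \<cdot> x)) m"
      using x assms by (simp add: lift_Comp)
    also have "\<dots> \<longleftrightarrow> factors_through C (lift f \<cdot> x) (preimage (lift g) m)"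
      by (rule factors_preimage_iff[symmetric]) (use x assms in simp_all)
    also have "\<dots> \<longleftrightarrow> factors_through C x ?b"
      by (rule factors_preimage_iff[symmetric]) (use x assms in simp_all)
    finally show ?thesis .
  qed
  show "factors_through C ?a ?b" using *[of ?a] M C by simp
  show "factors_through C ?b ?a" using *[of ?b] M C by simp
qed

lemma img_lift_Id:
  assumes "X \<in> Obj C" "monic C m" "Cod C m = P X"
  shows "cl X (img (lift (Id C X) \<cdot> m)) = cl X m"
proof -
  have "lift (Id C X) \<cdot> m = m" using assms by (simp add: lift_Id)
  then show ?thesis using assms factors_img[of m] img_le_iff[of m m] by (intro cl_eqI) simp_all
qed

lemma preimage_lift_Id:
  assumes "X \<in> Obj C" "monic C m" "Cod C m = P X"
  shows "cl X (preimage (lift (Id C X)) m) = cl X m"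
proof -
  have "factors_through C x (preimage (lift (Id C X)) m) \<longleftrightarrow> factors_through C x m" if "x \<in> Arr C" "Cod C x = P X" for x
    using factors_preimage_iff[of "Id C (P X)" m x] assms that by (simp add: lift_Id)
  from this[of m] this[of "preimage (lift (Id C X)) m"] show ?thesis
    using assms by (intro cl_eqI) simp_all
qed

lemma canonical_form_orean:
  assumes "well_powered \<kappa> C"
  shows "orean_form \<kappa> C F"
  unfolding orean_form_def
proof (intro conjI allI ballI)
  fix X assume X: "X \<in> Obj C"
  show "bounded_lattice (fibre F X)" by (rule bounded_lattice_fibre[OF X])
  show "set_sized \<kappa> (carrier (fibre F X))"
    unfolding fibre_F
    using assms X by (intro set_sized_slice_Sub) (simp_all add: well_powered_def)
next
  fix X Y f assume "f \<in> hom_set C X Y"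
  then have f: "f \<in> Arr C" "Dom C f = X" "Cod C f = Y" by simp_all
  then have X: "X \<in> Obj C" and Y: "Y \<in> Obj C" by auto
  interpret LX: bounded_lattice "fibre F X" by (rule bounded_lattice_fibre[OF X])
  interpret LY: bounded_lattice "fibre F Y" by (rule bounded_lattice_fibre[OF Y])
  show d: "dirim F f \<in> carrier (fibre F X) \<rightarrow> carrier (fibre F Y)"
  proof
    fix S assume "S \<in> carrier (fibre F X)"
    then obtain m where m: "monic C m" "Cod C m = P X" "S = cl X m" using X by (rule carrier_fibreE)
    show "dirim F f S \<in> carrier (fibre F Y)"
      unfolding m(3) dirim_cl[OF f m(1,2)] by (rule cl_carrier[OF Y]) (use f m in simp_all)
  qed
  show i: "invim F f \<in> carrier (fibre F Y) \<rightarrow> carrier (fibre F X)"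
  proof
    fix S assume "S \<in> carrier (fibre F Y)"
    then obtain m where m: "monic C m" "Cod C m = P Y" "S = cl Y m" using Y by (rule carrier_fibreE)
    show "invim F f S \<in> carrier (fibre F X)"
      unfolding m(3) invim_cl[OF f m(1,2)] by (rule cl_carrier[OF X]) (use f m in simp_all)
  qed
  show "isotone (fibre F X) (fibre F Y) (dirim F f)"
  proof (rule isotoneI)
    fix S T assume S: "S \<in> carrier (fibre F X)" "T \<in> carrier (fibre F X)" and ST: "S \<sqsubseteq>\<^bsub>fibre F X\<^esub> T"
    obtain m where m: "monic C m" "Cod C m = P X" "S = cl X m" using S(1) X by (rule carrier_fibreE)
    obtain n where n: "monic C n" "Cod C n = P X" "T = cl X n" using S(2) X by (rule carrier_fibreE)
    have "factors_through C m n" using ST le_cl[OF X m(1) n(1) m(2) n(2)] m n by simp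
    then show "dirim F f S \<sqsubseteq>\<^bsub>fibre F Y\<^esub> dirim F f T"
      unfolding m(3) n(3) dirim_cl[OF f m(1,2)] dirim_cl[OF f n(1,2)]
      using img_mono[of f m n] le_cl[OF Y, of "img (lift f \<cdot> m)" "img (lift f \<cdot> n)"] m n f by simp
  qed (unfold_locales)
  show "isotone (fibre F Y) (fibre F X) (invim F f)"
  proof (rule isotoneI)
    fix S T assume S: "S \<in> carrier (fibre F Y)" "T \<in> carrier (fibre F Y)" and ST: "S \<sqsubseteq>\<^bsub>fibre F Y\<^esub> T"
    obtain m where m: "monic C m" "Cod C m = P Y" "S = cl Y m" using S(1) Y by (rule carrier_fibreE)
    obtain n where n: "monic C n" "Cod C n = P Y" "T = cl Y n" using S(2) Y by (rule carrier_fibreE)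
    have "factors_through C m n" using ST le_cl[OF Y m(1) n(1) m(2) n(2)] m n by simp
    then show "invim F f S \<sqsubseteq>\<^bsub>fibre F X\<^esub> invim F f T"
      unfolding m(3) n(3) invim_cl[OF f m(1,2)] invim_cl[OF f n(1,2)]
      using preimage_mono[of f m n] le_cl[OF X, of "preimage (lift f) m" "preimage (lift f) n"] m n f by simp
  qed (unfold_locales)
  fix S T assume S: "S \<in> carrier (fibre F X)" and T: "T \<in> carrier (fibre F Y)"
  obtain m where m: "monic C m" "Cod C m = P X" "S = cl X m" using S X by (rule carrier_fibreE)
  obtain n where n: "monic C n" "Cod C n = P Y" "T = cl Y n" using T Y by (rule carrier_fibreE)
  show "(dirim F f S \<sqsubseteq>\<^bsub>fibre F Y\<^esub> T) = (S \<sqsubseteq>\<^bsub>fibre F X\<^esub> invim F f T)"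
    unfolding m(3) n(3) dirim_cl[OF f m(1,2)] invim_cl[OF f n(1,2)]
    using adjunction[of f m n] le_cl[OF Y, of "img (lift f \<cdot> m)" n] le_cl[OF X, of m "preimage (lift f) n"] m n f
    by simp
next
  fix X Y Z' f g S assume "f \<in> hom_set C X Y" "g \<in> hom_set C Y Z'" and S: "S \<in> carrier (fibre F X)"
  then have f: "f \<in> Arr C" "Dom C f = X" "Cod C f = Y" and g: "g \<in> Arr C" "Dom C g = Y" "Cod C g = Z'" by simp_all
  then have X: "X \<in> Obj C" by auto
  have gf: "g \<cdot> f \<in> Arr C" "Dom C (g \<cdot> f) = X" "Cod C (g \<cdot> f) = Z'" using f g by simp_all
  obtain m where m: "monic C m" "Cod C m = P X" "S = cl X m" using S X by (rule carrier_fibreE)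
  have fm: "monic C (img (lift f \<cdot> m))" "Cod C (img (lift f \<cdot> m)) = P Y" using f m by simp_all
  show "dirim F (g \<cdot> f) S = dirim F g (dirim F f S)"
    unfolding m(3) dirim_cl[OF f m(1,2)] dirim_cl[OF g fm] dirim_cl[OF gf m(1,2)]
    by (rule img_img) (use f g m in simp_all)
next
  fix X Y Z' f g S assume "f \<in> hom_set C X Y" "g \<in> hom_set C Y Z'" and S: "S \<in> carrier (fibre F Z')"
  then have f: "f \<in> Arr C" "Dom C f = X" "Cod C f = Y" and g: "g \<in> Arr C" "Dom C g = Y" "Cod C g = Z'" by simp_all
  then have Z': "Z' \<in> Obj C" by auto
  have gf: "g \<cdot> f \<in> Arr C" "Dom C (g \<cdot> f) = X" "Cod C (g \<cdot> f) = Z'" using f g by simp_all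
  obtain m where m: "monic C m" "Cod C m = P Z'" "S = cl Z' m" using S Z' by (rule carrier_fibreE)
  have gm: "monic C (preimage (lift g) m)" "Cod C (preimage (lift g) m) = P Y" using g m by simp_all
  show "invim F (g \<cdot> f) S = invim F f (invim F g S)"
    unfolding m(3) invim_cl[OF g m(1,2)] invim_cl[OF f gm] invim_cl[OF gf m(1,2)]
    by (rule preimage_preimage) (use f g m in simp_all)
next
  fix X S assume X: "X \<in> Obj C" and S: "S \<in> carrier (fibre F X)"
  obtain m where m: "monic C m" "Cod C m = P X" "S = cl X m" using S X by (rule carrier_fibreE)
  show "dirim F (Id C X) S = S" "invim F (Id C X) S = S"
    unfolding m(3) using dirim_cl[of "Id C X" X X m] invim_cl[of "Id C X" X X m] img_lift_Id preimage_lift_Id X m by simp_all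
qed

section \<open>Kernels, images and the axiom (N1)\<close>

definition ker :: "'a \<Rightarrow> 'a" where
  "ker f = preimage (lift f) (ini (P (Cod C f)))"

lemma ker_simps [simp]:
  assumes "f \<in> Arr C" shows "monic C (ker f)" "Cod C (ker f) = P (Dom C f)"
  unfolding ker_def using assms by (simp_all add: ini_P)

lemma factors_ker_iff:
  assumes "f \<in> Arr C" "w \<in> Arr C" "Cod C w = P (Dom C f)"
  shows "factors_through C w (ker f) \<longleftrightarrow> f \<cdot> (\<pi>\<^sub>2 (Dom C f) \<cdot> w) = ini (Cod C f) \<cdot> (\<pi>\<^sub>1 (Dom C f) \<cdot> w)"
proof -
  have "factors_through C w (ker f) \<longleftrightarrow> factors_through C (lift f \<cdot> w) (ini (P (Cod C f)))"
    unfolding ker_def by (rule factors_preimage_iff) (use assms in \<open>simp_all add: ini_P\<close>)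
  also have "\<dots> \<longleftrightarrow> \<pi>\<^sub>2 (Cod C f) \<cdot> (lift f \<cdot> w) = ini (Cod C f) \<cdot> (\<pi>\<^sub>1 (Cod C f) \<cdot> (lift f \<cdot> w))"
    by (rule factors_ini_iff) (use assms in simp_all)
  also have "\<dots> \<longleftrightarrow> f \<cdot> (\<pi>\<^sub>2 (Dom C f) \<cdot> w) = ini (Cod C f) \<cdot> (\<pi>\<^sub>1 (Dom C f) \<cdot> w)"
    using assms by simp
  finally show ?thesis .
qed

lemma Ker_cl_eq:
  assumes "f \<in> Arr C" "Dom C f = X" shows "Ker_cl C F f = cl X (ker f)"
proof -
  have Y: "Cod C f \<in> Obj C" using assms by simp
  show ?thesis
    unfolding Ker_cl_def bottom_cl[OF Y] ker_def
    by (rule invim_cl) (use assms Y in \<open>simp_all add: ini_P\<close>)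
qed

lemma Im_cl_eq:
  assumes "f \<in> Arr C" "Cod C f = Y" shows "Im_cl C F f = cl Y (img (lift f))"
proof -
  have X: "Dom C f \<in> Obj C" using assms by simp
  have "dirim F f (cl (Dom C f) (Id C (P (Dom C f)))) = cl Y (img (lift f \<cdot> Id C (P (Dom C f))))"
    by (rule dirim_cl) (use assms X in \<open>simp_all add: monic_Id\<close>)
  also have "lift f \<cdot> Id C (P (Dom C f)) = lift f" using assms by simp
  finally show ?thesis unfolding Im_cl_def top_cl[OF X] .
qed

text \<open>1 \<times> m is again monic and so represents its own image.\<close>

lemma Im_cl_monic:
  assumes "monic C m" "Cod C m = Y" shows "Im_cl C F m = cl Y (lift m)"
proof -
  have m: "m \<in> Arr C" "lift m \<in> Arr C" using assms by simp_all
  have "cl Y (img (lift m)) = cl Y (lift m)"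
    by (rule cl_eqI) (use m lift_monic[OF assms(1)] factors_img[OF m(2)] img_le_iff[OF m(2) lift_monic[OF assms(1)]] in simp_all)
  then show ?thesis using Im_cl_eq[OF m(1) assms(2)] by simp
qed

text \<open>1 \<times> e is again a regular epimorphism, so 1 \<times> m factors through the image
  of 1 \<times> (m e) by descent.\<close>

lemma Im_cl_comp_regular_epi:
  assumes "monic C m" "regular_epi C e" "Cod C e = Dom C m" "Cod C m = Y"
  shows "Im_cl C F (m \<cdot> e) = Im_cl C F m"
proof -
  have e: "e \<in> Arr C" and m: "m \<in> Arr C" using assms by simp_all
  have me: "m \<cdot> e \<in> Arr C" "Cod C (m \<cdot> e) = Y" using e m assms by simp_all
  have T: "lift (m \<cdot> e) = lift m \<cdot> lift e" using lift_Comp[of e m] e m assms by simp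
  have l: "lift (m \<cdot> e) \<in> Arr C" "Cod C (lift (m \<cdot> e)) = P Y" using me by simp_all
  have "factors_through C (lift m \<cdot> lift e) (img (lift (m \<cdot> e)))" using factors_img[OF l(1)] T by simp
  then have "factors_through C (lift m) (img (lift (m \<cdot> e)))"
    by (rule factors_through_descent[OF _ lift_regular_epi[OF assms(2)]]) (use e m assms l in simp_all)
  moreover have "factors_through C (lift (m \<cdot> e)) (lift m)"
    by (rule factors_throughI[OF T]) (use e m assms in simp_all)
  then have "factors_through C (img (lift (m \<cdot> e))) (lift m)"
    using img_le_iff[OF l(1) lift_monic[OF assms(1)]] l m assms by simp
  ultimately have "cl Y (img (lift (m \<cdot> e))) = cl Y (lift m)"
    by (intro cl_eqI) (use l lift_monic[OF assms(1)] in simp_all)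
  then show ?thesis unfolding Im_cl_eq[OF me] Im_cl_monic[OF assms(1,4)] .
qed

text \<open>The initial arrow into \<open>Cod C m\<close> is \<open>m\<close> after the one into
  \<open>Dom C m\<close>, so \<open>m\<close> cancels from the kernel condition.\<close>

lemma Ker_cl_comp_monic:
  assumes "monic C m" "e \<in> Arr C" "Cod C e = Dom C m"
  shows "Ker_cl C F (m \<cdot> e) = Ker_cl C F e"
proof -
  have m: "m \<in> Arr C" using assms by simp
  have me: "m \<cdot> e \<in> Arr C" "Dom C (m \<cdot> e) = Dom C e" "Cod C (m \<cdot> e) = Cod C m" using m assms by simp_all
  have eq: "factors_through C w (ker (m \<cdot> e)) \<longleftrightarrow> factors_through C w (ker e)" if w: "w \<in> Arr C" "Cod C w = P (Dom C e)" for w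
  proof -
    have "factors_through C w (ker (m \<cdot> e)) \<longleftrightarrow> m \<cdot> (e \<cdot> (\<pi>\<^sub>2 (Dom C e) \<cdot> w)) = m \<cdot> (ini (Dom C m) \<cdot> (\<pi>\<^sub>1 (Dom C e) \<cdot> w))"
      using factors_ker_iff[OF me(1), of w] me w m assms by simp
    also have "\<dots> \<longleftrightarrow> e \<cdot> (\<pi>\<^sub>2 (Dom C e) \<cdot> w) = ini (Dom C m) \<cdot> (\<pi>\<^sub>1 (Dom C e) \<cdot> w)"
    proof
      assume "m \<cdot> (e \<cdot> (\<pi>\<^sub>2 (Dom C e) \<cdot> w)) = m \<cdot> (ini (Dom C m) \<cdot> (\<pi>\<^sub>1 (Dom C e) \<cdot> w))"
      then show "e \<cdot> (\<pi>\<^sub>2 (Dom C e) \<cdot> w) = ini (Dom C m) \<cdot> (\<pi>\<^sub>1 (Dom C e) \<cdot> w)"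
        by (rule monicD[OF assms(1)]) (use w m assms in simp_all)
    qed (simp only:)
    also have "\<dots> \<longleftrightarrow> factors_through C w (ker e)"
      using factors_ker_iff[OF assms(2) w] assms by simp
    finally show ?thesis .
  qed
  have "cl (Dom C e) (ker (m \<cdot> e)) = cl (Dom C e) (ker e)"
    by (rule cl_eqI) (use eq[of "ker e"] eq[of "ker (m \<cdot> e)"] me assms in simp_all)
  then show ?thesis unfolding Ker_cl_eq[OF me(1,2)] Ker_cl_eq[OF assms(2) refl] .
qed

text \<open>The equations \<open>eq\<close> say that 1 \<times> f identifies \<open>x\<close> and
  \<open>s\<close>. This is saturation for 1 \<times> f in C, whose fibre over the arrow from 0 is
  \<open>ker f\<close>.\<close>

lemma saturated:
  assumes f: "f \<in> Arr C" and j: "monic C j" "Cod C j = P (Dom C f)" "factors_through C (ker f) j"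
    and s: "factors_through C s j" and x: "x \<in> Arr C" "Cod C x = P (Dom C f)" "Dom C x = Dom C s"
    and eq: "\<pi>\<^sub>1 (Dom C f) \<cdot> x = \<pi>\<^sub>1 (Dom C f) \<cdot> s" "f \<cdot> (\<pi>\<^sub>2 (Dom C f) \<cdot> x) = f \<cdot> (\<pi>\<^sub>2 (Dom C f) \<cdot> s)"
  shows "factors_through C x j"
proof (rule kernel_saturated[OF initial, of "ini (P (Cod C f))" "lift f" j s])
  have sa: "s \<in> Arr C" "Cod C s = P (Dom C f)" using factors_through_Cod[OF s] j by simp_all
  show "lift f \<cdot> x = lift f \<cdot> s"
    by (rule pair_eqI[of _ _ "Cod C f"]) (use f x sa eq in simp_all)
  fix y w assume y: "y \<in> Arr C" "w \<in> Arr C" "Dom C y = Dom C w" "Cod C y = Dom C (lift f)" "Cod C w = Z"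
    "lift f \<cdot> y = ini (P (Cod C f)) \<cdot> w"
  have "factors_through C (lift f \<cdot> y) (ini (P (Cod C f)))"
    by (rule factors_throughI[OF y(6)]) (use y(1-5) f in simp_all)
  then have "factors_through C y (ker f)"
    unfolding ker_def using factors_preimage_iff[of "lift f" "ini (P (Cod C f))" y] f y(1-5) by (simp add: ini_P)
  then show "factors_through C y j" by (rule factors_through_trans[OF _ j(3)]) (use j in simp)
qed (use assms in simp_all)

lemma invim_dirim:
  assumes f: "f \<in> Arr C" "Dom C f = X" "Cod C f = Y" and m: "monic C m" "Cod C m = P X"
  shows "invim F f (dirim F f (cl X m)) = cl X m \<squnion>\<^bsub>fibre F X\<^esub> Ker_cl C F f"
proof -
  have X: "X \<in> Obj C" and Y: "Y \<in> Obj C" using f by auto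
  have k: "monic C (ker f)" "Cod C (ker f) = P X" using f by simp_all
  have mk: "Cod C m = Cod C (ker f)" using k m by simp
  obtain j where j: "monic C j" "Cod C j = Cod C (ker f)" "factors_through C m j" "factors_through C (ker f) j"
      "\<And>i. \<lbrakk>monic C i; Cod C i = Cod C (ker f); factors_through C m i; factors_through C (ker f) i\<rbrakk> \<Longrightarrow> factors_through C j i"
    by (rule join_exists[OF m(1) k(1) mk]) blast
  have jP: "Cod C j = P X" using j k by simp
  define n where "n = img (lift f \<cdot> m)"
  have fm: "lift f \<cdot> m \<in> Arr C" using f m by simp
  have n: "monic C n" "Cod C n = P Y" unfolding n_def using f m by simp_all
  define p where "p = preimage (lift f) n"
  have p: "monic C p" "Cod C p = P X" unfolding p_def using f n by simp_all
  have p_iff: "factors_through C x p \<longleftrightarrow> factors_through C (lift f \<cdot> x) n" if "x \<in> Arr C" "Cod C x = P X" for x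
    unfolding p_def by (rule factors_preimage_iff) (use f n that in simp_all)
  have "factors_through C m p" using p_iff[of m] factors_img[OF fm] m unfolding n_def by simp
  moreover have "factors_through C (ker f) p"
  proof -
    have "factors_through C (lift f \<cdot> ker f) (ini (P Y))"
      using factors_preimage_iff[of "lift f" "ini (P Y)" "ker f"] f k Y unfolding ker_def by (simp add: ini_P)
    then have "factors_through C (lift f \<cdot> ker f) n"
      by (rule factors_through_trans[OF _ ini_least]) (use n Y in simp_all)
    then show ?thesis using p_iff[of "ker f"] k by simp
  qed
  ultimately have jp: "factors_through C j p" using j(5)[of p] p k by simp
  have "factors_through C (lift f \<cdot> p) n" using p_iff[of p] p by simp
  \<comment> \<open>Locally, a member of the inverse image of the direct image has the same value
    under 1 \<times> f as a member \<open>m \<cdot> t\<close> of \<open>m\<close>; saturation of the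
    join \<open>j\<close> then applies.\<close>
  then obtain c t where c: "regular_epi C c" "Cod C c = Dom C (lift f \<cdot> p)" "t \<in> Arr C" "Dom C t = Dom C c"
    "Cod C t = Dom C (lift f \<cdot> m)" "(lift f \<cdot> p) \<cdot> c = (lift f \<cdot> m) \<cdot> t"
    unfolding n_def using factors_img_iff[of "lift f \<cdot> m" "lift f \<cdot> p"] fm f p m by auto
  have c': "c \<in> Arr C" "Cod C c = Dom C p" "Cod C t = Dom C m" using c f p m by simp_all
  have T: "lift f \<cdot> (p \<cdot> c) = lift f \<cdot> (m \<cdot> t)" using c(6) c(3) c' f p m by simp
  have "\<pi>\<^sub>1 Y \<cdot> (lift f \<cdot> (p \<cdot> c)) = \<pi>\<^sub>1 Y \<cdot> (lift f \<cdot> (m \<cdot> t))"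
    "\<pi>\<^sub>2 Y \<cdot> (lift f \<cdot> (p \<cdot> c)) = \<pi>\<^sub>2 Y \<cdot> (lift f \<cdot> (m \<cdot> t))" unfolding T by simp_all
  then have eqs: "\<pi>\<^sub>1 X \<cdot> (p \<cdot> c) = \<pi>\<^sub>1 X \<cdot> (m \<cdot> t)" "f \<cdot> (\<pi>\<^sub>2 X \<cdot> (p \<cdot> c)) = f \<cdot> (\<pi>\<^sub>2 X \<cdot> (m \<cdot> t))"
    using c(3) c' f p m by simp_all
  have "factors_through C (p \<cdot> c) j"
  proof (rule saturated[OF f(1) j(1), of "m \<cdot> t"])
    show "factors_through C (m \<cdot> t) j" by (rule factors_through_comp[OF j(3)]) (use j c c' in simp_all)
  qed (use c(3,4) c' f p m j(4) jP eqs in simp_all)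
  then have "factors_through C p j"
    by (rule factors_through_descent[OF _ c(1) j(1)]) (use c' p jP in simp_all)
  then have "cl X p = cl X j" by (intro cl_eqI p j jp)
  moreover have "cl X m \<squnion>\<^bsub>fibre F X\<^esub> cl X (ker f) = cl X j"
    by (rule join_cl) (use X m k j jP in simp_all)
  ultimately show ?thesis
    unfolding dirim_cl[OF f m] Ker_cl_eq[OF f(1,2)] n_def[symmetric] invim_cl[OF f n] p_def[symmetric] by simp
qed

text \<open>A common member of \<open>m\<close> and of the image of \<open>f\<close> has a preimage
  locally, and that preimage lies in \<open>p\<close> because its value lies in
  \<open>m\<close>.\<close>

lemma dirim_invim:
  assumes f: "f \<in> Arr C" "Dom C f = X" "Cod C f = Y" and m: "monic C m" "Cod C m = P Y"
  shows "dirim F f (invim F f (cl Y m)) = cl Y m \<sqinter>\<^bsub>fibre F Y\<^esub> Im_cl C F f"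
proof -
  have X: "X \<in> Obj C" and Y: "Y \<in> Obj C" using f by auto
  define p where "p = preimage (lift f) m"
  have p: "monic C p" "Cod C p = P X" unfolding p_def using f m by simp_all
  have p_iff: "factors_through C x p \<longleftrightarrow> factors_through C (lift f \<cdot> x) m" if "x \<in> Arr C" "Cod C x = P X" for x
    unfolding p_def by (rule factors_preimage_iff) (use f m that in simp_all)
  define i where "i = img (lift f)"
  have i: "monic C i" "Cod C i = P Y" unfolding i_def using f by simp_all
  define n where "n = meet_sub m i"
  have n: "monic C n" "Cod C n = P Y" unfolding n_def using m i by simp_all
  have n_iff: "factors_through C x n \<longleftrightarrow> factors_through C x m \<and> factors_through C x i"
    if "x \<in> Arr C" "Cod C x = P Y" for x
    unfolding n_def by (rule factors_meet_sub_iff) (use m i that in simp_all)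
  have fp: "lift f \<cdot> p \<in> Arr C" "Cod C (lift f \<cdot> p) = P Y" using f p by simp_all
  have q: "monic C (img (lift f \<cdot> p))" "Cod C (img (lift f \<cdot> p)) = P Y" using fp by simp_all
  have "factors_through C (lift f \<cdot> p) i"
    unfolding i_def by (rule factors_through_comp[OF factors_img]) (use f p in simp_all)
  then have "factors_through C (lift f \<cdot> p) n" using n_iff[OF fp] p_iff[of p] p by simp
  then have 1: "factors_through C (img (lift f \<cdot> p)) n" using img_le_iff[OF fp(1) n(1)] fp n by simp
  have nn: "factors_through C n m" "factors_through C n i" using n_iff[of n] n by simp_all
  obtain c x where c: "regular_epi C c" "Cod C c = Dom C n" "x \<in> Arr C" "Dom C x = Dom C c"
    "Cod C x = P X" "n \<cdot> c = lift f \<cdot> x"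
    using nn(2) factors_img_iff[of "lift f" n] f n unfolding i_def by auto
  have "factors_through C (n \<cdot> c) m" by (rule factors_through_comp[OF nn(1)]) (use m c in simp_all)
  then have "factors_through C x p" using p_iff[of x] c by simp
  then have "factors_through C (lift f \<cdot> x) (lift f \<cdot> p)"
    by (rule factors_through_postcomp) (use f p in simp_all)
  then have "factors_through C (n \<cdot> c) (img (lift f \<cdot> p))"
    unfolding c(6) by (rule factors_through_trans[OF _ factors_img[OF fp(1)]]) (use q in simp)
  then have "factors_through C n (img (lift f \<cdot> p))"
    by (rule factors_through_descent[OF _ c(1) q(1)]) (use c n q in simp_all)
  then have "cl Y (img (lift f \<cdot> p)) = cl Y n" by (intro cl_eqI q n 1)
  then show ?thesis
    unfolding invim_cl[OF f m] p_def[symmetric] dirim_cl[OF f p] Im_cl_eq[OF f(1,3)] i_def[symmetric]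
      meet_cl[OF Y m(1) i(1) m(2) i(2)] n_def[symmetric] .
qed

section \<open>Quotients, embeddings and the axiom (N2)\<close>

lemma normal_Ker: "f \<in> Arr C \<Longrightarrow> Dom C f = X \<Longrightarrow> normal C F X (Ker_cl C F f)"
  unfolding normal_def using Ker_cl_eq[of f X] cl_carrier[of X "ker f"] by auto

lemma conormal_Im: "f \<in> Arr C \<Longrightarrow> Cod C f = Y \<Longrightarrow> conormal C F Y (Im_cl C F f)"
  unfolding conormal_def using Im_cl_eq[of f Y] cl_carrier[of Y "img (lift f)"] by auto

text \<open>\<open>e\<close> is the coequalizer of its kernel pair, so \<open>g\<close> factors
  through it once \<open>g\<close> agrees on that pair; by \<open>kernel_determines_equality\<close>
  this need only be known on the kernel.\<close>

lemma regular_epi_quotient: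
  assumes "regular_epi C e" "Dom C e = X"
  shows "quotient_of C F X (Ker_cl C F e) e"
  unfolding quotient_of_def
proof (intro conjI ballI impI)
  have e: "e \<in> Arr C" using assms by simp
  then have X: "X \<in> Obj C" using assms by auto
  show "normal C F X (Ker_cl C F e)" by (rule normal_Ker[OF e assms(2)])
  fix g assume g: "g \<in> Arr C" "Dom C g = X \<and> Ker_cl C F e \<sqsubseteq>\<^bsub>fibre F X\<^esub> Ker_cl C F g"
  then have gX: "Dom C g = X" by simp
  have k: "factors_through C (ker e) (ker g)"
    using g(2) le_cl[OF X, of "ker e" "ker g"] e g(1) gX assms
    unfolding Ker_cl_eq[OF g(1) gX] Ker_cl_eq[OF e assms(2)] by simp
  obtain r s where rs: "is_pullback C e e r s" by (rule pullback_exists[OF e e refl])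
  note D = pullbackD[OF rs]
  have "g \<cdot> r = g \<cdot> s"
  proof (rule kernel_determines_equality[OF initial e g(1)])
    fix x w assume x: "x \<in> Arr C" "w \<in> Arr C" "Dom C x = Dom C w" "Cod C x = Dom C e" "Cod C w = Z"
      "e \<cdot> x = ini (Cod C e) \<cdot> w"
    \<comment> \<open>Pairing \<open>w\<close> with \<open>x\<close> turns the equation e x = ! w
      into membership of one element in \<open>ker e\<close>, to which the inclusion of kernels
      applies.\<close>
    obtain y where y: "y \<in> Arr C" "Dom C y = Dom C x" "Cod C y = P X" "\<pi>\<^sub>1 X \<cdot> y = w" "\<pi>\<^sub>2 X \<cdot> y = x"
      by (rule product_lift[OF product[OF X], of w x]) (use x assms in simp_all)
    have "factors_through C y (ker e)" using factors_ker_iff[OF e, of y] y x(6) assms by simp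
    then have "factors_through C y (ker g)" by (rule factors_through_trans[OF _ k]) (use g in simp)
    then show "g \<cdot> x = ini (Cod C g) \<cdot> w" using factors_ker_iff[OF g(1), of y] y gX by simp
  qed (use D e g gX assms in simp_all)
  then obtain h where h: "h \<in> Arr C" "Dom C h = Cod C e" "Cod C h = Cod C g" "h \<cdot> e = g"
    using coequalizer_lift[OF kernel_pair_coequalizer[OF assms(1) rs], of g] g gX D assms by auto
  show "\<exists>!h. h \<in> hom_set C (Cod C e) (Cod C g) \<and> g = h \<cdot> e"
  proof (rule ex1I[of _ h])
    fix k assume k: "k \<in> hom_set C (Cod C e) (Cod C g) \<and> g = k \<cdot> e"
    then have "k \<cdot> e = h \<cdot> e" using h by simp
    then show "k = h" by (rule epicD[OF regular_epi_epic[OF assms(1)]]) (use h(1-3) k[THEN conjunct1] in simp_all)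
  qed (use h in simp)
qed (use assms in simp_all)

text \<open>This is where regularity of \<open>0 \<rightarrow> 1\<close> enters: it makes the projection \<open>0 \<times> X \<rightarrow> X\<close> a regular
  epimorphism, so that a factorization after applying \<open>0 \<times> -\<close> descends.\<close>

lemma monic_embedding:
  assumes "monic C m" "Cod C m = Y"
  shows "embedding_of C F Y (Im_cl C F m) m"
  unfolding embedding_of_def
proof (intro conjI ballI impI)
  have m: "m \<in> Arr C" using assms by simp
  then have Y: "Y \<in> Obj C" using assms by auto
  show "conormal C F Y (Im_cl C F m)" by (rule conormal_Im[OF m assms(2)])
  fix f assume f: "f \<in> Arr C" "Cod C f = Y \<and> Im_cl C F f \<sqsubseteq>\<^bsub>fibre F Y\<^esub> Im_cl C F m"
  then have fY: "Cod C f = Y" by simp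
  have lf: "lift f \<in> Arr C" "Cod C (lift f) = P Y" "Dom C (lift f) = P (Dom C f)" using f(1) fY by simp_all
  have lm: "monic C (lift m)" "Cod C (lift m) = P Y" using lift_monic[OF assms(1)] m assms by simp_all
  have "factors_through C (img (lift f)) (lift m)"
    using f(2) le_cl[OF Y, of "img (lift f)" "lift m"] lf lm
    unfolding Im_cl_eq[OF f(1) fY] Im_cl_monic[OF assms] by simp
  then have "factors_through C (lift f) (lift m)" using img_le_iff[OF lf(1) lm(1)] lf lm by simp
  then have "factors_through C (\<pi>\<^sub>2 Y \<cdot> lift f) m" using factors_lift_iff[OF m assms(2) lf(1,2)] by simp
  then have "factors_through C (f \<cdot> \<pi>\<^sub>2 (Dom C f)) m" using lift_simps[OF f(1) refl fY] by simp
  then have "factors_through C f m"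
    by (rule factors_through_descent[OF _ snd_regular_epi assms(1)]) (use f fY assms in simp_all)
  then obtain h where h: "h \<in> Arr C" "Dom C h = Dom C f" "Cod C h = Dom C m" "m \<cdot> h = f"
    by (rule factors_throughE)
  show "\<exists>!h. h \<in> hom_set C (Dom C f) (Dom C m) \<and> f = m \<cdot> h"
  proof (rule ex1I[of _ h])
    fix k assume k: "k \<in> hom_set C (Dom C f) (Dom C m) \<and> f = m \<cdot> k"
    then have "m \<cdot> k = m \<cdot> h" using h by simp
    then show "k = h" by (rule monicD[OF assms(1)]) (use h(1-3) k[THEN conjunct1] in simp_all)
  qed (use h in simp)
qed (use assms in simp_all)

text \<open>The regular-epi--mono factorization serves: composing with the monomorphism leaves the
  kernel unchanged, and composing with the regular epimorphism leaves the image unchanged.\<close>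

lemma quotient_embedding_factorization:
  assumes "f \<in> Arr C" "Dom C f = X" "Cod C f = Y"
  obtains e m where "regular_epi C e" "monic C m" "Cod C e = Dom C m" "m \<cdot> e = f"
    "quotient_of C F X (Ker_cl C F f) e" "embedding_of C F Y (Im_cl C F f) m"
    "Ker_cl C F e = Ker_cl C F f" "Im_cl C F m = Im_cl C F f"
proof -
  obtain e m where em: "regular_epi C e" "monic C m" "Dom C e = Dom C f" "Cod C e = Dom C m"
    "Cod C m = Cod C f" "m \<cdot> e = f" by (rule factorization[OF assms(1)])
  have K: "Ker_cl C F e = Ker_cl C F f" using Ker_cl_comp_monic[OF em(2) _ em(4)] em(1,6) by simp
  have I: "Im_cl C F m = Im_cl C F f" using Im_cl_comp_regular_epi[OF em(2,1,4) refl] em(6) by simp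
  show ?thesis
    by (rule that[OF em(1,2,4,6) _ _ K I])
      (use regular_epi_quotient[OF em(1), of X] monic_embedding[OF em(2), of Y] K I em assms in simp_all)
qed

section \<open>Meets of conormal and joins of normal clusters: the axiom (N3)\<close>

lemma conormal_meet:
  assumes "X \<in> Obj C" "conormal C F X S" "conormal C F X T"
  shows "conormal C F X (S \<sqinter>\<^bsub>fibre F X\<^esub> T)"
proof -
  \<comment> \<open>Conormal clusters are those represented by 1 \<times> m with m monic, as an
    arrow has the image of its monomorphic part; it remains that 0 \<times> - preserves
    intersections.\<close>
  have "\<exists>m. monic C m \<and> Cod C m = X \<and> S = cl X (lift m)" if S: "conormal C F X S" for S
  proof -
    obtain f where f: "f \<in> Arr C" "Cod C f = X" "S = Im_cl C F f" using S unfolding conormal_def by blast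
    obtain e m where "monic C m" "Cod C e = Dom C m" "m \<cdot> e = f" "regular_epi C e" "Im_cl C F m = Im_cl C F f"
      by (rule quotient_embedding_factorization[OF f(1) refl f(2)])
    moreover from this have "Cod C m = X" using f Comp_simps(3)[of e m] by simp
    ultimately show ?thesis using Im_cl_monic f by metis
  qed
  then obtain m n where m: "monic C m" "Cod C m = X" "S = cl X (lift m)" and n: "monic C n" "Cod C n = X" "T = cl X (lift n)"
    using assms(2,3) by blast
  have ml: "monic C (lift m)" "monic C (lift n)" "Cod C (lift m) = P X" "Cod C (lift n) = P X"
    using m n lift_monic by simp_all
  define k where "k = meet_sub m n"
  have k: "monic C k" "Cod C k = X" unfolding k_def using m n by simp_all
  have kl: "monic C (lift k)" "Cod C (lift k) = P X" using k lift_monic by simp_all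
  have M: "monic C (meet_sub (lift m) (lift n))" "Cod C (meet_sub (lift m) (lift n)) = P X" using ml by simp_all
  have eq: "factors_through C w (lift k) \<longleftrightarrow> factors_through C w (meet_sub (lift m) (lift n))"
    if w: "w \<in> Arr C" "Cod C w = P X" for w
  proof -
    have "factors_through C w (lift k) \<longleftrightarrow> factors_through C (\<pi>\<^sub>2 X \<cdot> w) (meet_sub m n)"
      unfolding k_def[symmetric] by (rule factors_lift_iff) (use k w in simp_all)
    also have "\<dots> \<longleftrightarrow> factors_through C (\<pi>\<^sub>2 X \<cdot> w) m \<and> factors_through C (\<pi>\<^sub>2 X \<cdot> w) n"
      by (rule factors_meet_sub_iff) (use m n w assms in simp_all)
    also have "\<dots> \<longleftrightarrow> factors_through C w (lift m) \<and> factors_through C w (lift n)"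
      using factors_lift_iff[of m X w] factors_lift_iff[of n X w] m n w by simp
    also have "\<dots> \<longleftrightarrow> factors_through C w (meet_sub (lift m) (lift n))"
      by (rule factors_meet_sub_iff[symmetric]) (use ml w in simp_all)
    finally show ?thesis .
  qed
  have "cl X (meet_sub (lift m) (lift n)) = cl X (lift k)"
    by (rule cl_eqI[OF M(1) kl(1)])
      (use eq[of "lift k"] eq[of "meet_sub (lift m) (lift n)"] M kl in simp_all)
  then have "S \<sqinter>\<^bsub>fibre F X\<^esub> T = Im_cl C F k"
    unfolding m(3) n(3) meet_cl[OF assms(1) ml] Im_cl_monic[OF k] .
  then show ?thesis using conormal_Im[of k X] k by simp
qed

text \<open>With \<open>q\<close> the quotient by the image along \<open>e\<close> of the kernel pair of \<open>f\<close>, the join of \<open>Ker e\<close>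
  and \<open>Ker f\<close> is \<open>Ker (q e)\<close>: an element \<open>(z, y)\<close> of the latter is, locally, linked to the bottom
  cluster by steps \<open>(z, u), (z, v), (z, y)\<close> identified alternately by \<open>e\<close> and \<open>f\<close>.\<close>

lemma normal_join:
  assumes X: "X \<in> Obj C" and K: "normal C F X K" and L: "normal C F X L"
  shows "normal C F X (K \<squnion>\<^bsub>fibre F X\<^esub> L)"
proof -
  obtain f' where f': "f' \<in> Arr C" "Dom C f' = X" "Ker_cl C F f' = K" using K unfolding normal_def by blast
  \<comment> \<open>\<open>f'\<close> is replaced by its regular epimorphic part, which has the same
    kernel: the image of a relation is to be taken along a regular epimorphism.\<close>
  obtain e m where em: "regular_epi C e" "monic C m" "Cod C e = Dom C m" "m \<cdot> e = f'" "Ker_cl C F e = Ker_cl C F f'"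
    by (rule quotient_embedding_factorization[OF f'(1,2) refl])
  have e: "e \<in> Arr C" "Dom C e = X" using em f' Comp_simps(2)[of e m] by simp_all
  obtain f where f: "f \<in> Arr C" "Dom C f = X" "Ker_cl C F f = L" using L unfolding normal_def by blast
  have fe: "Dom C f = Dom C e" using e f by simp
  obtain q where q: "q \<in> Arr C" "Dom C q = Cod C e"
    and q_iff: "\<And>y z. \<lbrakk>y \<in> Arr C; z \<in> Arr C; Dom C y = Dom C z; Cod C y = Cod C e; Cod C z = Cod C e\<rbrakk> \<Longrightarrow>
       q \<cdot> y = q \<cdot> z \<longleftrightarrow> image_related e f y z"
    by (rule quotient_of_image_relation[OF em(1) f(1) fe]) blast
  have qe: "q \<cdot> e \<in> Arr C" "Dom C (q \<cdot> e) = X" "Cod C (q \<cdot> e) = Cod C q" using q e by simp_all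
  have k: "monic C (ker e)" "monic C (ker f)" "Cod C (ker e) = P X" "Cod C (ker f) = P X" using e f by simp_all
  have kc: "Cod C (ker e) = Cod C (ker f)" using k by simp
  obtain j where j: "monic C j" "Cod C j = Cod C (ker f)" "factors_through C (ker e) j" "factors_through C (ker f) j"
      "\<And>i. \<lbrakk>monic C i; Cod C i = Cod C (ker f); factors_through C (ker e) i; factors_through C (ker f) i\<rbrakk> \<Longrightarrow> factors_through C j i"
    by (rule join_exists[OF k(1,2) kc]) blast
  have jP: "Cod C j = P X" using j k by simp
  define w where "w = ker (q \<cdot> e)"
  have w: "monic C w" "Cod C w = P X" unfolding w_def using qe by simp_all
  have w_iff: "factors_through C x w \<longleftrightarrow> q \<cdot> (e \<cdot> (\<pi>\<^sub>2 X \<cdot> x)) = ini (Cod C q) \<cdot> (\<pi>\<^sub>1 X \<cdot> x)"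
    if x: "x \<in> Arr C" "Cod C x = P X" for x
    unfolding w_def using factors_ker_iff[OF qe(1), of x] qe x e q X by simp
  have "q \<cdot> (e \<cdot> (\<pi>\<^sub>2 X \<cdot> ker e)) = ini (Cod C q) \<cdot> (\<pi>\<^sub>1 X \<cdot> ker e)"
  proof -
    have "e \<cdot> (\<pi>\<^sub>2 X \<cdot> ker e) = ini (Cod C e) \<cdot> (\<pi>\<^sub>1 X \<cdot> ker e)"
      using factors_ker_iff[OF e(1), of "ker e"] e k by simp
    then show ?thesis using q X k e by simp
  qed
  then have 1: "factors_through C (ker e) w" using w_iff[of "ker e"] k by simp
  \<comment> \<open>If (z, x) lies in \<open>ker f\<close>, then \<open>f\<close> takes x and the
    base point at z to the same value. Their values under \<open>e\<close> are therefore related,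
    with an identity as cover, and \<open>q\<close> identifies them.\<close>
  have "q \<cdot> (e \<cdot> (\<pi>\<^sub>2 X \<cdot> ker f)) = q \<cdot> (e \<cdot> (ini X \<cdot> (\<pi>\<^sub>1 X \<cdot> ker f)))"
  proof -
    have a: "f \<cdot> (\<pi>\<^sub>2 X \<cdot> ker f) = ini (Cod C f) \<cdot> (\<pi>\<^sub>1 X \<cdot> ker f)"
      using factors_ker_iff[OF f(1), of "ker f"] f k by simp
    define u where "u = \<pi>\<^sub>2 X \<cdot> ker f"
    define v where "v = ini X \<cdot> (\<pi>\<^sub>1 X \<cdot> ker f)"
    have u: "u \<in> Arr C" "Cod C u = X" "Dom C u = Dom C (ker f)" "v \<in> Arr C" "Cod C v = X" "Dom C v = Dom C (ker f)"
      unfolding u_def v_def using X k by simp_all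
    have "f \<cdot> v = ini (Cod C f) \<cdot> (\<pi>\<^sub>1 X \<cdot> ker f)" unfolding v_def using X k f by simp
    then have fuv: "f \<cdot> u = f \<cdot> v" using a unfolding u_def by simp
    have obj: "Dom C (ker f) \<in> Obj C" using k by simp
    have "image_related e f (e \<cdot> u) (e \<cdot> v)"
      unfolding image_related_def
    proof (rule exI[of _ "Id C (Dom C (ker f))"], rule exI[of _ u], rule exI[of _ v], intro conjI)
      have "is_iso C (Id C (Dom C (ker f)))"
        by (rule is_isoI[of _ "Id C (Dom C (ker f))"]) (use obj in simp_all)
      then show "regular_epi C (Id C (Dom C (ker f)))" by (rule iso_regular_epi)
    qed (use u e obj fuv in simp_all)
    then have "q \<cdot> (e \<cdot> u) = q \<cdot> (e \<cdot> v)" using q_iff[of "e \<cdot> u" "e \<cdot> v"] u e by simp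
    then show ?thesis unfolding u_def v_def .
  qed
  then have "q \<cdot> (e \<cdot> (\<pi>\<^sub>2 X \<cdot> ker f)) = ini (Cod C q) \<cdot> (\<pi>\<^sub>1 X \<cdot> ker f)" using q X k e by simp
  then have 2: "factors_through C (ker f) w" using w_iff[of "ker f"] k by simp
  have jw: "factors_through C j w" by (rule j(5)[OF w(1) _ 1 2]) (use w k in simp)
  define y where "y = \<pi>\<^sub>2 X \<cdot> w"
  define z where "z = \<pi>\<^sub>1 X \<cdot> w"
  have yz: "y \<in> Arr C" "Cod C y = X" "Dom C y = Dom C w" "z \<in> Arr C" "Cod C z = Z" "Dom C z = Dom C w"
    unfolding y_def z_def using w X by simp_all
  have "q \<cdot> (e \<cdot> y) = ini (Cod C q) \<cdot> z" using w_iff[of w] w unfolding y_def z_def by simp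
  also have "\<dots> = q \<cdot> (ini (Cod C e) \<cdot> z)" using yz q e by simp
  finally have qeq: "q \<cdot> (ini (Cod C e) \<cdot> z) = q \<cdot> (e \<cdot> y)" by simp
  have "ini (Cod C e) \<cdot> z \<in> Arr C" "e \<cdot> y \<in> Arr C" "Dom C (ini (Cod C e) \<cdot> z) = Dom C (e \<cdot> y)"
    "Cod C (ini (Cod C e) \<cdot> z) = Cod C e" "Cod C (e \<cdot> y) = Cod C e"
    using yz e by simp_all
  from iffD1[OF q_iff[OF this] qeq] obtain c u v where c: "regular_epi C c" "Cod C c = Dom C (e \<cdot> y)" "u \<in> Arr C" "v \<in> Arr C"
         "Dom C u = Dom C c" "Dom C v = Dom C c" "Cod C u = Dom C e" "Cod C v = Dom C e"
         "(ini (Cod C e) \<cdot> z) \<cdot> c = e \<cdot> u" "(e \<cdot> y) \<cdot> c = e \<cdot> v" "f \<cdot> u = f \<cdot> v"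
    unfolding image_related_def by blast
  have c': "c \<in> Arr C" "Cod C c = Dom C w" "Cod C u = X" "Cod C v = X" using c yz e by simp_all
  have eu: "e \<cdot> u = ini (Cod C e) \<cdot> (z \<cdot> c)" using c(9) yz c' e by simp
  have ev: "e \<cdot> v = e \<cdot> (y \<cdot> c)" using c(10) yz c' e by simp
  have zc: "z \<cdot> c \<in> Arr C" "Dom C (z \<cdot> c) = Dom C c" "Cod C (z \<cdot> c) = Z" using yz c' by simp_all
  \<comment> \<open>Saturation compares elements of 0 \<times> X with equal first components only,
    so \<open>u\<close>, and below also \<open>v\<close>, is paired with the first component of the
    element under test.\<close>
  obtain a where a: "a \<in> Arr C" "Dom C a = Dom C u" "Cod C a = P X" "\<pi>\<^sub>1 X \<cdot> a = z \<cdot> c" "\<pi>\<^sub>2 X \<cdot> a = u"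
    by (rule product_lift[OF product[OF X], of "z \<cdot> c" u]) (use zc c c' in simp_all)
  obtain b where b: "b \<in> Arr C" "Dom C b = Dom C v" "Cod C b = P X" "\<pi>\<^sub>1 X \<cdot> b = z \<cdot> c" "\<pi>\<^sub>2 X \<cdot> b = v"
    by (rule product_lift[OF product[OF X], of "z \<cdot> c" v]) (use zc c c' in simp_all)
  have "factors_through C a (ker e)" using factors_ker_iff[OF e(1), of a] a e eu by simp
  then have aj: "factors_through C a j" by (rule factors_through_trans[OF _ j(3)]) (use j in simp)
  have bj: "factors_through C b j"
    by (rule saturated[OF f(1) j(1) _ j(4) aj]) (use f jP a b c(5,6,11) in simp_all)
  have wc: "\<pi>\<^sub>1 X \<cdot> (w \<cdot> c) = z \<cdot> c" "\<pi>\<^sub>2 X \<cdot> (w \<cdot> c) = y \<cdot> c" unfolding y_def z_def using w c' X by simp_all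
  have "factors_through C (w \<cdot> c) j"
    by (rule saturated[OF e(1) j(1) _ j(3) bj]) (use e jP b c(6) c' w wc ev in simp_all)
  then have "factors_through C w j"
    by (rule factors_through_descent[OF _ c(1) j(1)]) (use w c' jP in simp_all)
  then have wj: "cl X w = cl X j" by (intro cl_eqI w j jw)
  have "K \<squnion>\<^bsub>fibre F X\<^esub> L = cl X j"
    unfolding f'(3)[symmetric] em(5)[symmetric] f(3)[symmetric] Ker_cl_eq[OF e] Ker_cl_eq[OF f(1,2)]
    by (rule join_cl) (use X k j jP in simp_all)
  then have "K \<squnion>\<^bsub>fibre F X\<^esub> L = Ker_cl C F (q \<cdot> e)"
    unfolding Ker_cl_eq[OF qe(1,2)] w_def[symmetric] wj .
  then show ?thesis using normal_Ker[OF qe(1,2)] by simp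
qed

lemma canonical_form_noetherian:
  assumes "well_powered \<kappa> C"
  shows "noetherian_form \<kappa> C F"
  unfolding noetherian_form_def
proof (intro conjI allI ballI impI; (elim conjE)?)
  show "orean_form \<kappa> C F" by (rule canonical_form_orean[OF assms])
next
  fix X Y f S assume "f \<in> hom_set C X Y" and S: "S \<in> carrier (fibre F X)"
  then have f: "f \<in> Arr C" "Dom C f = X" "Cod C f = Y" by simp_all
  then have "X \<in> Obj C" by auto
  with S obtain m where m: "monic C m" "Cod C m = P X" "S = cl X m" by (rule carrier_fibreE)
  show "invim F f (dirim F f S) = S \<squnion>\<^bsub>fibre F X\<^esub> Ker_cl C F f"
    unfolding m(3) by (rule invim_dirim[OF f m(1,2)])
next
  fix X Y f T assume "f \<in> hom_set C X Y" and T: "T \<in> carrier (fibre F Y)"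
  then have f: "f \<in> Arr C" "Dom C f = X" "Cod C f = Y" by simp_all
  then have "Y \<in> Obj C" by auto
  with T obtain m where m: "monic C m" "Cod C m = P Y" "T = cl Y m" by (rule carrier_fibreE)
  show "dirim F f (invim F f T) = T \<sqinter>\<^bsub>fibre F Y\<^esub> Im_cl C F f"
    unfolding m(3) by (rule dirim_invim[OF f m(1,2)])
next
  fix X Y f assume "f \<in> hom_set C X Y"
  then have f: "f \<in> Arr C" "Dom C f = X" "Cod C f = Y" by simp_all
  show "\<exists>e m. quotient_of C F X (Ker_cl C F f) e \<and> embedding_of C F Y (Im_cl C F f) m \<and>
        Cod C e = Dom C m \<and> f = m \<cdot> e"
    by (rule quotient_embedding_factorization[OF f]) blast
next
  fix X K L assume "X \<in> Obj C" "normal C F X K" "normal C F X L"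
  then show "normal C F X (K \<squnion>\<^bsub>fibre F X\<^esub> L)" by (rule normal_join)
next
  fix X S T assume "X \<in> Obj C" "conormal C F X S" "conormal C F X T"
  then show "conormal C F X (S \<sqinter>\<^bsub>fibre F X\<^esub> T)" by (rule conormal_meet)
qed

section \<open>The induced factorization system\<close>

lemma regular_epi_mono_factorization_system:
  "proper_factorization_system C {e. regular_epi C e} {m. monic C m}"
  unfolding proper_factorization_system_def
proof (intro conjI ballI allI impI; (unfold mem_Collect_eq)?)
  fix f assume "f \<in> Arr C"
  then obtain e m where "regular_epi C e" "monic C m" "Dom C e = Dom C f" "Cod C e = Dom C m"
    "Cod C m = Cod C f" "m \<cdot> e = f" by (rule factorization)
  then show "\<exists>e\<in>{e. regular_epi C e}. \<exists>m\<in>{m. monic C m}. Dom C e = Dom C f \<and> Cod C e = Dom C m \<and> Cod C m = Cod C f \<and> f = m \<cdot> e"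
    by blast
next
  fix e m assume e: "regular_epi C e" and m: "monic C m"
  show "orthogonal C e m"
    unfolding orthogonal_def
  proof (intro ballI impI)
    fix u v assume uv: "u \<in> hom_set C (Dom C e) (Dom C m)" "v \<in> hom_set C (Cod C e) (Cod C m)" "m \<cdot> u = v \<cdot> e"
    obtain d where d: "d \<in> Arr C" "Dom C d = Cod C e" "Cod C d = Dom C m" "d \<cdot> e = u" "m \<cdot> d = v"
      by (rule regular_epi_diagonal[OF e m _ _ _ _ _ _ uv(3)]) (use uv(1,2) in simp_all)
    show "\<exists>!d. d \<in> hom_set C (Cod C e) (Dom C m) \<and> d \<cdot> e = u \<and> m \<cdot> d = v"
    proof (rule ex1I[of _ d])
      fix k assume k: "k \<in> hom_set C (Cod C e) (Dom C m) \<and> k \<cdot> e = u \<and> m \<cdot> k = v"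
      then have "k \<cdot> e = d \<cdot> e" using d by simp
      then show "k = d" by (rule epicD[OF regular_epi_epic[OF e]]) (use k[THEN conjunct1] d(1-3) in simp_all)
    qed (use d in simp)
  qed
qed (simp_all add: regular_epi_epic iso_regular_epi iso_monic regular_epi_comp monic_Comp)

text \<open>In p = m e the factor \<open>e\<close> has the kernel of \<open>p\<close>, so e = h p by
  universality. Then m h fixes \<open>p\<close>, and uniqueness makes it an identity;
  \<open>m\<close> is a split monomorphism with section \<open>h\<close>, hence invertible.\<close>

lemma quotient_regular_epi:
  assumes "quotient_of C F X K p" shows "regular_epi C p"
proof -
  have p: "p \<in> Arr C" "Dom C p = X" "Ker_cl C F p = K" and K: "K \<in> carrier (fibre F X)"
    and univ: "\<And>g. \<lbrakk>g \<in> Arr C; Dom C g = X; K \<sqsubseteq>\<^bsub>fibre F X\<^esub> Ker_cl C F g\<rbrakk> \<Longrightarrow>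
      \<exists>!h. h \<in> hom_set C (Cod C p) (Cod C g) \<and> g = h \<cdot> p"
    using assms unfolding quotient_of_def normal_def by blast+
  have X: "X \<in> Obj C" using p by auto
  interpret L: bounded_lattice "fibre F X" by (rule bounded_lattice_fibre[OF X])
  obtain e m where em: "regular_epi C e" "monic C m" "Cod C e = Dom C m" "m \<cdot> e = p" "Ker_cl C F e = Ker_cl C F p"
    by (rule quotient_embedding_factorization[OF p(1,2) refl])
  have e: "e \<in> Arr C" "Dom C e = X" and m: "m \<in> Arr C" "Cod C m = Cod C p"
    using em p Comp_simps[of e m] by simp_all
  obtain h where h: "h \<in> hom_set C (Cod C p) (Cod C e)" "e = h \<cdot> p"
    using univ[OF e] em(5) p(3) L.le_refl[OF K] by auto
  have "(m \<cdot> h) \<cdot> p = m \<cdot> (h \<cdot> p)" by (rule Comp_assoc_simp) (use p m h(1) em in simp_all)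
  then have mh: "p = (m \<cdot> h) \<cdot> p" using h(2) em(4) by simp
  have "\<exists>!h. h \<in> hom_set C (Cod C p) (Cod C p) \<and> p = h \<cdot> p"
    using univ[OF p(1,2)] p(3) L.le_refl[OF K] by simp
  moreover have "m \<cdot> h \<in> hom_set C (Cod C p) (Cod C p) \<and> p = (m \<cdot> h) \<cdot> p"
  proof
    show "m \<cdot> h \<in> hom_set C (Cod C p) (Cod C p)" using m h(1) em(3) by simp
  qed (rule mh)
  moreover have "Id C (Cod C p) \<in> hom_set C (Cod C p) (Cod C p) \<and> p = Id C (Cod C p) \<cdot> p" using p by simp
  ultimately have "m \<cdot> h = Id C (Cod C p)" by blast
  then have "is_iso C m"
    by (intro monic_split_epi_is_iso[OF em(2), of h]) (use m h(1) em(3) in simp_all)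
  then have "regular_epi C (m \<cdot> e)" by (rule iso_comp_regular_epi[OF em(1) _ em(3)[symmetric]])
  then show ?thesis using em(4) by simp
qed

text \<open>Dually, in i = m e the factor \<open>m\<close> has the image of \<open>i\<close>, so m =
  i h, and uniqueness gives h e = 1. Thus \<open>e\<close> is a split monomorphism and
  \<open>i\<close> is a composite of monomorphisms.\<close>

lemma embedding_monic:
  assumes "embedding_of C F Y S i" shows "monic C i"
proof -
  have i: "i \<in> Arr C" "Cod C i = Y" "Im_cl C F i = S" and S: "S \<in> carrier (fibre F Y)"
    and univ: "\<And>f. \<lbrakk>f \<in> Arr C; Cod C f = Y; Im_cl C F f \<sqsubseteq>\<^bsub>fibre F Y\<^esub> S\<rbrakk> \<Longrightarrow>
      \<exists>!h. h \<in> hom_set C (Dom C f) (Dom C i) \<and> f = i \<cdot> h"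
    using assms unfolding embedding_of_def conormal_def by blast+
  have Y: "Y \<in> Obj C" using i by auto
  interpret L: bounded_lattice "fibre F Y" by (rule bounded_lattice_fibre[OF Y])
  obtain e m where em: "regular_epi C e" "monic C m" "Cod C e = Dom C m" "m \<cdot> e = i" "Im_cl C F m = Im_cl C F i"
    by (rule quotient_embedding_factorization[OF i(1) refl i(2)])
  have e: "e \<in> Arr C" "Dom C e = Dom C i" and m: "m \<in> Arr C" "Cod C m = Y"
    using em i Comp_simps[of e m] by simp_all
  obtain h where h: "h \<in> hom_set C (Dom C m) (Dom C i)" "m = i \<cdot> h"
    using univ[OF m] em(5) i(3) L.le_refl[OF S] by auto
  have "(i \<cdot> h) \<cdot> e = i \<cdot> (h \<cdot> e)" by (rule Comp_assoc_simp) (use e i h(1) em(3) in simp_all)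
  then have he: "i = i \<cdot> (h \<cdot> e)" using h(2) em(4) by simp
  have "\<exists>!h. h \<in> hom_set C (Dom C i) (Dom C i) \<and> i = i \<cdot> h"
    using univ[OF i(1,2)] i(3) L.le_refl[OF S] by simp
  moreover have "h \<cdot> e \<in> hom_set C (Dom C i) (Dom C i) \<and> i = i \<cdot> (h \<cdot> e)"
  proof
    show "h \<cdot> e \<in> hom_set C (Dom C i) (Dom C i)" using e h(1) em(3) by simp
  qed (rule he)
  moreover have "Id C (Dom C i) \<in> hom_set C (Dom C i) (Dom C i) \<and> i = i \<cdot> Id C (Dom C i)" using i by simp
  ultimately have "h \<cdot> e = Id C (Dom C i)" by blast
  then have "monic C e" by (intro split_monic[of h]) (use e h(1) em(3) in simp_all)
  then have "monic C (m \<cdot> e)" by (rule monic_Comp[OF _ em(2,3)])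
  then show ?thesis using em(4) by simp
qed

lemma canonical_form_induces:
  "form_induces C F {e. regular_epi C e} {m. monic C m}"
  unfolding form_induces_def
proof (intro conjI)
  show "quotients C F = {e. regular_epi C e}"
    unfolding quotients_def using quotient_regular_epi regular_epi_quotient[OF _ refl]
    by (blast intro: Dom_closed[OF regular_epi_Arr])
  show "embeddings C F = {m. monic C m}"
    unfolding embeddings_def using embedding_monic monic_embedding[OF _ refl]
    by (blast intro: Cod_closed[OF monic_Arr])
qed (rule regular_epi_mono_factorization_system)

end

text \<open>The canonical form takes the products 0 \<times> X as given data; choosing them object
  by object yields a witness for the existence claim.\<close>

lemma (in ideally_exact_cat) product_choice_exists:
  assumes "Z \<in> Obj C"
  obtains P p q where "product_choice C Z P p q"
proof -
  have "\<forall>X\<in>Obj C. \<exists>t. is_product C Z X (fst t) (fst (snd t)) (snd (snd t))"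
  proof
    fix X assume X: "X \<in> Obj C"
    obtain P p q where "is_product C Z X P p q" by (rule product_exists[OF assms X])
    then show "\<exists>t. is_product C Z X (fst t) (fst (snd t)) (snd (snd t))" by (intro exI[of _ "(P, p, q)"]) simp
  qed
  from bchoice[OF this] obtain t where "\<forall>X\<in>Obj C. is_product C Z X (fst (t X)) (fst (snd (t X))) (snd (snd (t X)))"
    by blast
  then have "product_choice C Z (\<lambda>X. fst (t X)) (\<lambda>X. fst (snd (t X))) (\<lambda>X. snd (snd (t X)))"
    unfolding product_choice_def .
  then show ?thesis by (rule that)
qed

theorem theorem3p36:
  fixes C :: "('o, 'a) cat" and \<kappa> :: "'u rel"
  assumes "Card_order \<kappa>"
    and "locally_small \<kappa> C"
    and "ideally_exact C"
    and "well_powered \<kappa> C"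
  shows "(\<exists>F :: ('o, 'a, ('a \<times> 'a \<times> 'a) set) form.
            noetherian_form \<kappa> C F \<and> form_induces C F {e. regular_epi C e} {m. monic C m}) \<and>
         (\<forall>Z P \<pi>\<^sub>1 \<pi>\<^sub>2. is_initial C Z \<and> product_choice C Z P \<pi>\<^sub>1 \<pi>\<^sub>2 \<longrightarrow>
            noetherian_form \<kappa> C (canonical_form C Z P \<pi>\<^sub>1 \<pi>\<^sub>2) \<and>
            form_induces C (canonical_form C Z P \<pi>\<^sub>1 \<pi>\<^sub>2) {e. regular_epi C e} {m. monic C m})"
proof -
  interpret ideally_exact_cat C by unfold_locales (rule assms(3))
  have canonical: "noetherian_form \<kappa> C (canonical_form C Z P \<pi>\<^sub>1 \<pi>\<^sub>2) \<and>
      form_induces C (canonical_form C Z P \<pi>\<^sub>1 \<pi>\<^sub>2) {e. regular_epi C e} {m. monic C m}"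
    if "is_initial C Z" "product_choice C Z P \<pi>\<^sub>1 \<pi>\<^sub>2" for Z P \<pi>\<^sub>1 \<pi>\<^sub>2
  proof -
    interpret canonical_form_setup C Z P \<pi>\<^sub>1 \<pi>\<^sub>2 by unfold_locales (rule that)+
    show ?thesis using canonical_form_noetherian[OF assms(4)] canonical_form_induces by blast
  qed
  obtain Z where Z: "is_initial C Z"
    using assms(3) unfolding ideally_exact_def has_finite_coproducts_def by blast
  then have "Z \<in> Obj C" unfolding is_initial_def by blast
  then obtain P p q where "product_choice C Z P p q" by (rule product_choice_exists)
  with Z canonical show ?thesis by blast
qed


end
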